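(* Let $r\geq 2$ and $p,q\geq 1$ be integers, and let $R_1,R_2>0$ satisfy $R_1^2+R_2^2=1$. Then the generalized Clifford torus inclusion $i:\mathbb{S}^p(R_1)\times\mathbb{S}^q(R_2)\hookrightarrow\mathbb{S}^{p+q+1}$ is: (a) minimal if and only if $$R_1^2=\frac{p}{p+q}\quad\text{and}\quad R_2^2=\frac{q}{p+q};\qquad(\ast)$$ (b) a proper $r$-harmonic submanifold of $\mathbb{S}^{p+q+1}$ if and only if $(\ast)$ does not hold and either $$r=2,\quad p\neq q\quad\text{and}\quad R_1^2=R_2^2=\frac12,$$ or $r\geq 3$ and $t=R_1^2$ is a root of the polynomial $$P(t)=r(p+q)\,t^3+[q-p-r(q+2p)]\,t^2+(2p+rp)\,t-p.$$
   Context: $\mathbb{S}^m(R)$ denotes the Euclidean sphere of radius $R$ in $\mathbb{R}^{m+1}$ with its induced metric, and $\mathbb{S}^m=\mathbb{S}^m(1)$. The inclusion $\mathbb{S}^p(R_1)\times\mathbb{S}^q(R_2)\hookrightarrow\mathbb{S}^{p+q+1}\subset\mathbb{R}^{p+1}\times\mathbb{R}^{q+1}$ is $(x,y)\mapsto(x,y)$; it is an isometric immersion of the Riemannian product. Let $\varphi:(M,g_M)\to(N,g_N)$ be a smooth map between Riemannian manifolds, $M$ compact, with $\nabla^\varphi$ the induced connection on $\varphi^{-1}TN$. The tension field is $\tau(\varphi)=\operatorname{trace}\nabla d\varphi\in\Gamma(\varphi^{-1}TN)$; $\varphi$ is harmonic if $\tau(\varphi)=0$ (for an isometric immersion: minimal).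 The rough Laplacian on sections of $\varphi^{-1}TN$ is $\overline{\Delta}=-\sum_{i}\{\nabla^{\varphi}_{e_i}\nabla^{\varphi}_{e_i}-\nabla^{\varphi}_{\nabla^M_{e_i}e_i}\}$, where $\{e_i\}$ is a local orthonormal frame on $M$. For $s\geq 1$ the $r$-energy ($r\ge 2$) is $$E_{2s}(\varphi)=\frac12\int_M\langle\overline{\Delta}^{s-1}\tau(\varphi),\overline{\Delta}^{s-1}\tau(\varphi)\rangle\,dv_M,\qquad E_{2s+1}(\varphi)=\frac12\int_M\sum_j\langle\nabla^\varphi_{e_j}\overline{\Delta}^{s-1}\tau(\varphi),\nabla^\varphi_{e_j}\overline{\Delta}^{s-1}\tau(\varphi)\rangle\,dv_M .$$ The map $\varphi$ is $r$-harmonic if $\frac{d}{dt}E_r(\varphi_t)|_{t=0}=0$ for all smooth variations $\varphi_t$ of $\varphi=\varphi_0$. An immersed submanifold (with the induced metric) is a proper $r$-harmonic submanifold if the immersion is an $r$-harmonic map which is not harmonic (equivalently, the submanifold is not minimal). *)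

theory Defs
  imports "HOL-Analysis.Analysis"
begin

text \<open>
  All Riemannian manifolds are embedded submanifolds \<open>M\<close> of a Euclidean space, given as sets and
  carrying the induced metric; a product of submanifolds, as a subset of the product Euclidean
  space, then carries the Riemannian product metric.
  Maps and sections are total functions on the ambient space of which only the values on \<open>M\<close>
  matter. The definitions make sense for arbitrary sets but have their intended meaning when \<open>M\<close>
  and \<open>N\<close> are embedded submanifolds.
\<close>

section \<open>Smooth maps\<close>

primrec Ck_on_open ::
    "nat \<Rightarrow> ('a::real_normed_vector \<Rightarrow> 'b::real_normed_vector) \<Rightarrow> 'a set \<Rightarrow> bool" where
  "Ck_on_open 0 f U \<longleftrightarrow> continuous_on U f"
| "Ck_on_open (Suc k) f U \<longleftrightarrow>
     f differentiable_on U \<and> (\<forall>v. Ck_on_open k (\<lambda>x. frechet_derivative f (at x) v) U)"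

text \<open>On a set that need not be open, smooth means: locally the restriction of a smooth function
  on an open set of the ambient space.\<close>

definition smooth_on :: "'a::euclidean_space set \<Rightarrow> ('a \<Rightarrow> 'b::euclidean_space) \<Rightarrow> bool" where
  "smooth_on S f \<longleftrightarrow>
     (\<forall>x\<in>S. \<exists>U g. open U \<and> x \<in> U \<and> (\<forall>k. Ck_on_open k g U) \<and> (\<forall>y\<in>U \<inter> S. f y = g y))"

definition smooth_map ::
    "'a::euclidean_space set \<Rightarrow> 'b::euclidean_space set \<Rightarrow> ('a \<Rightarrow> 'b) \<Rightarrow> bool" where
  "smooth_map M N \<phi> \<longleftrightarrow> smooth_on M \<phi> \<and> \<phi> ` M \<subseteq> N"

section \<open>Tangent spaces and connections\<close>

definition tangent_space :: "'a::euclidean_space set \<Rightarrow> 'a \<Rightarrow> 'a set" where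
  "tangent_space M x =
     {v. \<exists>\<epsilon>>0. \<exists>\<gamma>::real \<Rightarrow> 'a. smooth_on {-\<epsilon><..<\<epsilon>} \<gamma> \<and> \<gamma> ` {-\<epsilon><..<\<epsilon>} \<subseteq> M \<and> \<gamma> 0 = x \<and>
          (\<gamma> has_vector_derivative v) (at 0)}"

definition manifold_dim :: "'a::euclidean_space set \<Rightarrow> nat" where
  "manifold_dim M = (THE m. \<forall>x\<in>M. dim (tangent_space M x) = m)"

text \<open>The derivative within \<open>M\<close> is in general not unique as a linear map on the ambient space, but
  its values on tangent vectors of \<open>M\<close> are. It is only ever applied to such vectors.\<close>

definition differential ::
    "'a::euclidean_space set \<Rightarrow> ('a \<Rightarrow> 'b::euclidean_space) \<Rightarrow> 'a \<Rightarrow> 'a \<Rightarrow> 'b" where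
  "differential M f x v = frechet_derivative f (at x within M) v"

definition orth_proj :: "'a::euclidean_space set \<Rightarrow> 'a \<Rightarrow> 'a" where
  "orth_proj T v = (THE w. w \<in> T \<and> (\<forall>u\<in>T. (v - w) \<bullet> u = 0))"

text \<open>The connection on the pull-back bundle \<open>\<phi>\<^sup>-\<^sup>1TN\<close> induced by the Levi-Civita connection of
  \<open>N\<close>: the component tangent to \<open>N\<close> of the ambient derivative of the section \<open>V\<close> in direction
  \<open>v \<in> T\<^sub>xM\<close>. The Levi-Civita connection of \<open>M\<close> is the case \<open>\<phi> = id\<close>.\<close>

definition induced_conn ::
    "'a::euclidean_space set \<Rightarrow> 'b::euclidean_space set \<Rightarrow> ('a \<Rightarrow> 'b) \<Rightarrow> 'a \<Rightarrow> ('a \<Rightarrow> 'b) \<Rightarrow> 'a \<Rightarrow> 'b"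
  where
  "induced_conn M N \<phi> v V x = orth_proj (tangent_space N (\<phi> x)) (differential M V x v)"

definition levi_civita :: "'a::euclidean_space set \<Rightarrow> 'a \<Rightarrow> ('a \<Rightarrow> 'a) \<Rightarrow> 'a \<Rightarrow> 'a" where
  "levi_civita M v Y x = induced_conn M M (\<lambda>y. y) v Y x"

definition local_orthonormal_frame ::
    "'a::euclidean_space set \<Rightarrow> 'a \<Rightarrow> (nat \<Rightarrow> 'a \<Rightarrow> 'a) \<Rightarrow> bool" where
  "local_orthonormal_frame M x e \<longleftrightarrow>
     (\<exists>U. open U \<and> x \<in> U \<and>
        (\<forall>i<manifold_dim M. smooth_on (U \<inter> M) (e i)) \<and>
        (\<forall>y\<in>U \<inter> M.
           (\<forall>i<manifold_dim M. e i y \<in> tangent_space M y) \<and>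
           (\<forall>i<manifold_dim M. \<forall>j<manifold_dim M. e i y \<bullet> e j y = (if i = j then 1 else 0))))"

text \<open>All expressions below in which this choice occurs are independent of the frame.\<close>

definition frame_at :: "'a::euclidean_space set \<Rightarrow> 'a \<Rightarrow> nat \<Rightarrow> 'a \<Rightarrow> 'a" where
  "frame_at M x = (SOME e. local_orthonormal_frame M x e)"

section \<open>Tension field and rough Laplacian\<close>

definition nabla_d ::
    "'a::euclidean_space set \<Rightarrow> 'b::euclidean_space set \<Rightarrow> ('a \<Rightarrow> 'b)
       \<Rightarrow> ('a \<Rightarrow> 'a) \<Rightarrow> ('a \<Rightarrow> 'a) \<Rightarrow> 'a \<Rightarrow> 'b" where
  "nabla_d M N \<phi> X Y x =
     induced_conn M N \<phi> (X x) (\<lambda>y. differential M \<phi> y (Y y)) x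
     - differential M \<phi> x (levi_civita M (X x) Y x)"

definition tension ::
    "'a::euclidean_space set \<Rightarrow> 'b::euclidean_space set \<Rightarrow> ('a \<Rightarrow> 'b) \<Rightarrow> 'a \<Rightarrow> 'b" where
  "tension M N \<phi> x =
     (let e = frame_at M x in \<Sum>i<manifold_dim M. nabla_d M N \<phi> (e i) (e i) x)"

definition rough_laplacian ::
    "'a::euclidean_space set \<Rightarrow> 'b::euclidean_space set \<Rightarrow> ('a \<Rightarrow> 'b) \<Rightarrow> ('a \<Rightarrow> 'b) \<Rightarrow> 'a \<Rightarrow> 'b"
  where
  "rough_laplacian M N \<phi> V x =
     (let e = frame_at M x in
       - (\<Sum>i<manifold_dim M.
            induced_conn M N \<phi> (e i x) (\<lambda>y. induced_conn M N \<phi> (e i y) V y) x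
            - induced_conn M N \<phi> (levi_civita M (e i x) (e i) x) V x))"

section \<open>Riemannian volume\<close>

text \<open>The volume measure \<open>dv\<^sub>M\<close> of an \<open>m\<close>-dimensional submanifold is the restriction to \<open>M\<close> of the
  \<open>m\<close>-dimensional Hausdorff measure, normalised to agree with Lebesgue measure on \<open>m\<close>-dimensional
  Euclidean space. Empty members of a cover are given weight 0, since \<open>0 ^ 0 = 1\<close>.\<close>

definition hausdorff_content ::
    "nat \<Rightarrow> real \<Rightarrow> 'a::euclidean_space set \<Rightarrow> ennreal" where
  "hausdorff_content m \<delta> A =
     (INF C\<in>{C :: nat \<Rightarrow> 'a set. A \<subseteq> (\<Union>i. C i) \<and> (\<forall>i. bounded (C i) \<and> diameter (C i) \<le> \<delta>)}.
        \<Sum>i. if C i = {} then 0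
             else ennreal (unit_ball_vol (real m) * (diameter (C i) / 2) ^ m))"

definition hausdorff_measure :: "nat \<Rightarrow> 'a::euclidean_space measure" where
  "hausdorff_measure m = measure_of UNIV (sets borel) (\<lambda>A. SUP \<delta>\<in>{0<..}. hausdorff_content m \<delta> A)"

definition volume_measure :: "'a::euclidean_space set \<Rightarrow> 'a measure" where
  "volume_measure M = restrict_space (hausdorff_measure (manifold_dim M)) M"

section \<open>Harmonic and \<open>r\<close>-harmonic maps\<close>

text \<open>Only used for \<open>r \<ge> 2\<close>: the exponent \<open>r div 2 - 1\<close> is \<open>s - 1\<close> both for \<open>r = 2s\<close> and for
  \<open>r = 2s + 1\<close>.\<close>

definition r_energy ::
    "nat \<Rightarrow> 'a::euclidean_space set \<Rightarrow> 'b::euclidean_space set \<Rightarrow> ('a \<Rightarrow> 'b) \<Rightarrow> real" where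
  "r_energy r M N \<phi> =
     (let W = (rough_laplacian M N \<phi> ^^ (r div 2 - 1)) (tension M N \<phi>) in
      if even r then 1/2 * (\<integral>x. W x \<bullet> W x \<partial>volume_measure M)
      else 1/2 * (\<integral>x. (\<Sum>j<manifold_dim M.
                    induced_conn M N \<phi> (frame_at M x j x) W x
                    \<bullet> induced_conn M N \<phi> (frame_at M x j x) W x) \<partial>volume_measure M))"

definition harmonic ::
    "'a::euclidean_space set \<Rightarrow> 'b::euclidean_space set \<Rightarrow> ('a \<Rightarrow> 'b) \<Rightarrow> bool" where
  "harmonic M N \<phi> \<longleftrightarrow> smooth_map M N \<phi> \<and> (\<forall>x\<in>M. tension M N \<phi> x = 0)"

definition smooth_variation ::
    "'a::euclidean_space set \<Rightarrow> 'b::euclidean_space set \<Rightarrow> ('a \<Rightarrow> 'b)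
       \<Rightarrow> real \<Rightarrow> (real \<Rightarrow> 'a \<Rightarrow> 'b) \<Rightarrow> bool" where
  "smooth_variation M N \<phi> \<epsilon> \<Phi> \<longleftrightarrow>
     smooth_map ({-\<epsilon><..<\<epsilon>} \<times> M) N (\<lambda>(t, x). \<Phi> t x) \<and> (\<forall>x\<in>M. \<Phi> 0 x = \<phi> x)"

definition r_harmonic ::
    "nat \<Rightarrow> 'a::euclidean_space set \<Rightarrow> 'b::euclidean_space set \<Rightarrow> ('a \<Rightarrow> 'b) \<Rightarrow> bool" where
  "r_harmonic r M N \<phi> \<longleftrightarrow> smooth_map M N \<phi> \<and>
     (\<forall>\<epsilon>>0. \<forall>\<Phi>. smooth_variation M N \<phi> \<epsilon> \<Phi> \<longrightarrow>
        ((\<lambda>t. r_energy r M N (\<Phi> t)) has_real_derivative 0) (at 0))"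

definition isometric_immersion ::
    "'a::euclidean_space set \<Rightarrow> 'b::euclidean_space set \<Rightarrow> ('a \<Rightarrow> 'b) \<Rightarrow> bool" where
  "isometric_immersion M N \<phi> \<longleftrightarrow> smooth_map M N \<phi> \<and>
     (\<forall>x\<in>M. \<forall>u\<in>tangent_space M x. \<forall>v\<in>tangent_space M x.
        differential M \<phi> x u \<bullet> differential M \<phi> x v = u \<bullet> v)"

definition minimal_immersion ::
    "'a::euclidean_space set \<Rightarrow> 'b::euclidean_space set \<Rightarrow> ('a \<Rightarrow> 'b) \<Rightarrow> bool" where
  "minimal_immersion M N \<phi> \<longleftrightarrow> isometric_immersion M N \<phi> \<and> harmonic M N \<phi>"

definition proper_r_harmonic_submanifold ::
    "nat \<Rightarrow> 'a::euclidean_space set \<Rightarrow> 'b::euclidean_space set \<Rightarrow> ('a \<Rightarrow> 'b) \<Rightarrow> bool" where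
  "proper_r_harmonic_submanifold r M N \<phi> \<longleftrightarrow>
     isometric_immersion M N \<phi> \<and> r_harmonic r M N \<phi> \<and> \<not> harmonic M N \<phi>"

section \<open>Generalized Clifford tori\<close>

definition clifford_torus ::
    "real \<Rightarrow> real \<Rightarrow> ('a::euclidean_space \<times> 'b::euclidean_space) set" where
  "clifford_torus R1 R2 = sphere 0 R1 \<times> sphere 0 R2"

definition clifford_inclusion :: "'a::euclidean_space \<times> 'b::euclidean_space \<Rightarrow> 'a \<times> 'b" where
  "clifford_inclusion = (\<lambda>(x, y). (x, y))"

definition clifford_poly :: "nat \<Rightarrow> nat \<Rightarrow> nat \<Rightarrow> real \<Rightarrow> real" where
  "clifford_poly r p q t =
     real r * (real p + real q) * t ^ 3
     + (real q - real p - real r * (real q + 2 * real p)) * t ^ 2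
     + (2 * real p + real r * real p) * t - real p"

end

theory Submission
  imports Defs
begin

text \<open>
  On a product of spheres the infinitesimal rotations of the two factors, suitably scaled, are
  tangent fields \<open>X\<^sub>k\<close> with \<open>\<Sum>\<^sub>k X\<^sub>k \<otimes> X\<^sub>k\<close> the inverse metric and \<open>\<Sum>\<^sub>k \<nabla>\<^bsub>X\<^sub>k\<^esub> X\<^sub>k = 0\<close>. Hence the tension field
  and the rough Laplacian are \<open>\<Sum>\<^sub>k D\<^sub>k D\<^sub>k\<close>, with \<open>D\<^sub>k\<close> the induced covariant derivative along \<open>X\<^sub>k\<close>, and
  no local frames are needed. The volume measure is invariant under rotations, so \<open>\<integral> X\<^sub>k f = 0\<close>
  for smooth \<open>f\<close>, which gives integration by parts; of the Hausdorff measure one only needs that it is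
  a measure, invariant under isometries, and finite and positive on the torus.

  For the inclusion the normal field \<open>L(x, y) = (x/R\<^sub>1\<^sup>2, -y/R\<^sub>2\<^sup>2)\<close> is an eigensection of the rough
  Laplacian with an eigenvalue \<open>\<lambda> > 0\<close>, and the tension field is \<open>c L\<close>. Commuting the time
  derivative of a variation past the \<open>D\<^sub>k\<close> produces curvature terms of the unit sphere, and the first variation
  of the \<open>r\<close>-energy becomes a power of \<open>\<lambda>\<close> times \<open>c (\<lambda> (p + q - \<lambda>) - (r - 2) c \<sigma>) \<integral> \<langle>\<eta>, L\<rangle>\<close>, where
  \<open>\<eta>\<close> is the variation field and \<open>\<sigma> = p/R\<^sub>1\<^sup>2 - q/R\<^sub>2\<^sup>2\<close>. Clearing denominators turns the second
  factor into a multiple of \<open>c P(R\<^sub>1\<^sup>2)\<close>.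
\<close>

section \<open>Calculus of smooth functions\<close>

text \<open>The definitions pick a frame by \<open>SOME\<close>, separately at each point, so they
  do not show how an energy depends on the time parameter of a variation. Global fields remove this
  obstacle: along a variation all sections become functions on the product of the time interval and
  \<open>M\<close>, smooth in both variables jointly, where second derivatives are symmetric.
  Sections are kept as ambient vectors orthogonal to the map; curvature is never introduced as a
  tensor but appears as the difference between ambient and projected derivatives. No Euler-Lagrange
  equation is derived. At time 0 every iterated Laplacian of the tension field is a multiple of
  \<open>L\<close>, so the first variation only pairs time derivatives with \<open>L\<close> and its
  derivatives, and integration by parts reduces these pairings to one number per variation. All
  variations thus test the same scalar condition, and one variation whose number is nonzero gives
  the converse.\<close>

lemma Ck_on_open_cong:
  assumes "open U" "\<And>x. x \<in> U \<Longrightarrow> f x = g x"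
  shows "Ck_on_open k f U = Ck_on_open k g U"
  using assms(2)
proof (induction k arbitrary: f g)
  case 0
  then show ?case by (auto intro: continuous_on_cong)
next
  case (Suc k)
  have d: "f differentiable_on U \<longleftrightarrow> g differentiable_on U"
    using Suc.prems assms(1)
    by (auto simp: differentiable_on_def intro: differentiable_transform_within[OF _ zero_less_one])
  show ?case
  proof (cases "f differentiable_on U")
    case True
    have "Ck_on_open k (\<lambda>x. frechet_derivative f (at x) v) U =
          Ck_on_open k (\<lambda>x. frechet_derivative g (at x) v) U" for v
    proof (rule Suc.IH)
      fix x assume x: "x \<in> U"
      have "f differentiable at x"
        using True x assms(1) by (simp add: differentiable_on_eq_differentiable_at)
      then show "frechet_derivative f (at x) v = frechet_derivative g (at x) v"
        using frechet_derivative_transform_within_open[OF _ assms(1) x] Suc.prems by metis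
    qed
    then show ?thesis using d by simp
  next
    case False
    then show ?thesis using d by simp
  qed
qed

lemma Ck_on_open_Suc_lower: "Ck_on_open (Suc k) f U \<Longrightarrow> Ck_on_open k f U"
  by (induction k arbitrary: f) (auto intro: differentiable_imp_continuous_on)

lemma Ck_on_open_subset: "Ck_on_open k f U \<Longrightarrow> V \<subseteq> U \<Longrightarrow> Ck_on_open k f V"
  by (induction k arbitrary: f) (auto intro: continuous_on_subset differentiable_on_subset)

text \<open>Replaces the choice operator \<open>frechet_derivative\<close> by an explicit
  derivative, so that each closure property below is an induction in which the derivative formula
  stays in the class.\<close>

lemma Ck_on_open_SucI:
  assumes U: "open U"
    and d: "\<And>x. x \<in> U \<Longrightarrow> (f has_derivative f' x) (at x)"
    and c: "\<And>v. Ck_on_open k (\<lambda>x. f' x v) U"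
  shows "Ck_on_open (Suc k) f U"
proof -
  have e: "frechet_derivative f (at x) v = f' x v" if "x \<in> U" for x v
    using frechet_derivative_at[OF d[OF that]] by simp
  have "f differentiable_on U"
    using U d by (auto simp: differentiable_on_eq_differentiable_at differentiable_def)
  moreover have "Ck_on_open k (\<lambda>x. frechet_derivative f (at x) v) U" for v
    using c[of v] Ck_on_open_cong[OF U, of "\<lambda>x. frechet_derivative f (at x) v" "\<lambda>x. f' x v" k] e
    by simp
  ultimately show ?thesis by simp
qed

lemma Ck_on_open_SucD:
  assumes U: "open U" and f: "Ck_on_open (Suc k) f U" and x: "x \<in> U"
  shows "(f has_derivative frechet_derivative f (at x)) (at x)"
  using assms by (auto simp: differentiable_on_eq_differentiable_at frechet_derivative_works)

lemma Ck_on_open_const: "open U \<Longrightarrow> Ck_on_open k (\<lambda>x. c) U"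
proof (induction k arbitrary: c)
  case (Suc k)
  show ?case by (rule Ck_on_open_SucI[where f' = "\<lambda>x v. 0"]) (use Suc in auto)
qed simp

lemma Ck_on_open_linear: "open U \<Longrightarrow> bounded_linear f \<Longrightarrow> Ck_on_open k f U"
proof (induction k)
  case 0
  then show ?case by (simp add: linear_continuous_on)
next
  case (Suc k)
  show ?case
    by (rule Ck_on_open_SucI[where f' = "\<lambda>x. f"])
       (use Suc in \<open>auto intro: bounded_linear_imp_has_derivative Ck_on_open_const\<close>)
qed

lemma Ck_on_open_add:
  "open U \<Longrightarrow> Ck_on_open k f U \<Longrightarrow> Ck_on_open k g U \<Longrightarrow> Ck_on_open k (\<lambda>x. f x + g x) U"
proof (induction k arbitrary: f g)
  case 0
  then show ?case by (simp add: continuous_on_add)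
next
  case (Suc k)
  show ?case
    by (rule Ck_on_open_SucI[where f' = "\<lambda>x v. frechet_derivative f (at x) v + frechet_derivative g (at x) v"])
       (use Suc in \<open>auto intro!: has_derivative_add Ck_on_open_SucD[where k=k]\<close>)
qed

text \<open>The product rule gives two terms of the same shape with one factor differentiated, so
  the induction must vary \<open>f\<close> and \<open>g\<close>. Inner products, scalar multiples
  and products are instances.\<close>

lemma Ck_on_open_bilinear:
  assumes "bounded_bilinear h" "open U"
  shows "Ck_on_open k f U \<Longrightarrow> Ck_on_open k g U \<Longrightarrow> Ck_on_open k (\<lambda>x. h (f x) (g x)) U"
proof (induction k arbitrary: f g)
  case 0
  then show ?case using bounded_bilinear.continuous_on[OF assms(1)] by auto
next
  case (Suc k)
  show ?case
  proof (rule Ck_on_open_SucI[where f' = "\<lambda>x v. h (f x) (frechet_derivative g (at x) v)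
         + h (frechet_derivative f (at x) v) (g x)"])
    fix x assume "x \<in> U"
    then show "((\<lambda>x. h (f x) (g x)) has_derivative
        (\<lambda>v. h (f x) (frechet_derivative g (at x) v) + h (frechet_derivative f (at x) v) (g x))) (at x)"
      using Suc.prems assms
      by (intro bounded_bilinear.FDERIV[OF assms(1)] Ck_on_open_SucD)
  next
    fix v
    have "Ck_on_open k f U" "Ck_on_open k g U" using Suc.prems by (blast intro: Ck_on_open_Suc_lower)+
    moreover have "Ck_on_open k (\<lambda>x. frechet_derivative f (at x) v) U"
      "Ck_on_open k (\<lambda>x. frechet_derivative g (at x) v) U" using Suc.prems by auto
    ultimately show "Ck_on_open k (\<lambda>x. h (f x) (frechet_derivative g (at x) v)
        + h (frechet_derivative f (at x) v) (g x)) U"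
      by (intro Ck_on_open_add assms Suc.IH)
  qed (use assms in auto)
qed

lemma Ck_on_open_inverse:
  fixes f :: "'a::real_normed_vector \<Rightarrow> real"
  assumes "open U" "\<And>x. x \<in> U \<Longrightarrow> f x \<noteq> 0"
  shows "Ck_on_open k f U \<Longrightarrow> Ck_on_open k (\<lambda>x. inverse (f x)) U"
proof (induction k)
  case 0
  then show ?case using assms by (auto intro: continuous_on_inverse)
next
  case (Suc k)
  show ?case
  proof (rule Ck_on_open_SucI[where f' = "\<lambda>x v. (-1) * (inverse (f x) * frechet_derivative f (at x) v * inverse (f x))"])
    fix x assume x: "x \<in> U"
    then show "((\<lambda>x. inverse (f x)) has_derivative
        (\<lambda>v. (-1) * (inverse (f x) * frechet_derivative f (at x) v * inverse (f x)))) (at x)"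
      using Deriv.has_derivative_inverse[OF assms(2)[OF x] Ck_on_open_SucD[OF assms(1) Suc.prems x]] by simp
  next
    fix v
    have "Ck_on_open k (\<lambda>x. inverse (f x)) U" using Suc by (blast intro: Ck_on_open_Suc_lower)
    moreover have "Ck_on_open k (\<lambda>x. frechet_derivative f (at x) v) U" using Suc.prems by auto
    ultimately show "Ck_on_open k (\<lambda>x. (-1) * (inverse (f x) * frechet_derivative f (at x) v * inverse (f x))) U"
      by (intro Ck_on_open_bilinear[OF bounded_bilinear_mult] Ck_on_open_const assms)
  qed (use assms in auto)
qed

text \<open>Both mixed derivatives are the limit of the same symmetric second difference quotient.\<close>

lemma frechet_derivative_commute:
  fixes g :: "'a::real_normed_vector \<Rightarrow> 'b::euclidean_space"
  assumes U: "open U" and x: "x \<in> U" and g: "Ck_on_open 2 g U"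
  shows "frechet_derivative (\<lambda>y. frechet_derivative g (at y) v) (at x) w
       = frechet_derivative (\<lambda>y. frechet_derivative g (at y) w) (at x) v"
proof -
  define D where "D v = (\<lambda>y. frechet_derivative g (at y) v)" for v
  define DD where "DD v w = (\<lambda>y. frechet_derivative (D v) (at y) w)" for v w
  have C1: "Ck_on_open (Suc 0) (D v) U" for v
    using g by (simp add: D_def numeral_2_eq_2)
  have C2: "continuous_on U (DD v w)" for v w
    using C1[of v] by (simp add: DD_def)
  have dg: "(g has_derivative (\<lambda>v. D v y)) (at y)" if "y \<in> U" for y
    unfolding D_def using Ck_on_open_SucD[OF U, of 1] g that by (simp add: numeral_2_eq_2)
  have dD: "(D v has_derivative (\<lambda>w. DD v w y)) (at y)" if "y \<in> U" for y v
    unfolding DD_def using Ck_on_open_SucD[OF U C1 that] by simp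
  obtain r where r: "r > 0" "ball x r \<subseteq> U"
    using U x openE by blast
  \<comment> \<open>Small enough for the parallelograms to stay in the ball; the summand 1 covers
    the case that \<open>v\<close> and \<open>w\<close> are both 0.\<close>
  define d where "d = r / (norm v + norm w + 1)"
  have nz: "norm v + norm w + 1 > 0" using norm_ge_zero[of v] norm_ge_zero[of w] by linarith
  have d: "d > 0" unfolding d_def using r nz by simp
  have inU: "x + s *\<^sub>R v + t *\<^sub>R w \<in> U" if "\<bar>s\<bar> < d" "\<bar>t\<bar> < d" for s t
  proof -
    have "norm (s *\<^sub>R v + t *\<^sub>R w) \<le> \<bar>s\<bar> * norm v + \<bar>t\<bar> * norm w"
      by (metis norm_scaleR norm_triangle_ineq)
    also have "\<dots> \<le> d * norm v + d * norm w"
      using that by (intro add_mono mult_right_mono) auto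
    also have "\<dots> < d * (norm v + norm w + 1)" using d by (simp add: algebra_simps)
    also have "\<dots> = r" unfolding d_def using nz by simp
    finally have "x + s *\<^sub>R v + t *\<^sub>R w \<in> ball x r"
      by (metis add.assoc add_diff_cancel_left' dist_commute dist_norm mem_ball)
    then show ?thesis using r by auto
  qed
  \<comment> \<open>The mean value theorem is applied in the direction \<open>a\<close> to the
    increment of \<open>g\<close> along \<open>b\<close>, and then in the direction \<open>b\<close>
    to \<open>D a\<close>. It needs real values, hence the component along \<open>i\<close>.\<close>
  have key: "\<exists>s t. \<bar>s\<bar> \<le> h \<and> \<bar>t\<bar> \<le> h \<and>
      (g (x + h *\<^sub>R a + h *\<^sub>R b) - g (x + h *\<^sub>R a) - g (x + h *\<^sub>R b) + g x) \<bullet> i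
        = h^2 * (DD a b (x + s *\<^sub>R a + t *\<^sub>R b) \<bullet> i)"
    if h: "0 < h" "h < d" and inU: "\<And>s t. \<bar>s\<bar> < d \<Longrightarrow> \<bar>t\<bar> < d \<Longrightarrow> x + s *\<^sub>R a + t *\<^sub>R b \<in> U" for h i a b
  proof -
    have 1: "((\<lambda>s. (g (x + s *\<^sub>R a + h *\<^sub>R b) - g (x + s *\<^sub>R a)) \<bullet> i) has_real_derivative
        (D a (x + s *\<^sub>R a + h *\<^sub>R b) - D a (x + s *\<^sub>R a)) \<bullet> i) (at s)" if s: "\<bar>s\<bar> < d" for s
    proof -
      have u: "x + s *\<^sub>R a + h *\<^sub>R b \<in> U" "x + s *\<^sub>R a \<in> U"
        using inU[of s h] inU[of s 0] s h by auto
      have "((\<lambda>s. x + s *\<^sub>R a + h *\<^sub>R b) has_derivative (\<lambda>t. t *\<^sub>R a)) (at s)"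
        "((\<lambda>s. x + s *\<^sub>R a) has_derivative (\<lambda>t. t *\<^sub>R a)) (at s)"
        by (auto intro!: derivative_eq_intros)
      from has_derivative_compose[OF this(1) dg[OF u(1)]] has_derivative_compose[OF this(2) dg[OF u(2)]]
      have "((\<lambda>s. (g (x + s *\<^sub>R a + h *\<^sub>R b) - g (x + s *\<^sub>R a)) \<bullet> i) has_derivative
         (\<lambda>t. (D (t *\<^sub>R a) (x + s *\<^sub>R a + h *\<^sub>R b) - D (t *\<^sub>R a) (x + s *\<^sub>R a)) \<bullet> i)) (at s)"
        by (intro has_derivative_inner_left has_derivative_diff)
      moreover have "D (t *\<^sub>R a) y = t *\<^sub>R D a y" if "y \<in> U" for t y
        by (rule linear_cmul[OF has_derivative_linear[OF dg[OF that]]])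
      ultimately show ?thesis
        using u unfolding has_field_derivative_def
        by (elim has_derivative_eq_rhs) (auto simp: fun_eq_iff inner_diff_left left_diff_distrib)
    qed
    obtain s where s: "0 < s" "s < h" and
      e1: "(g (x + h *\<^sub>R a + h *\<^sub>R b) - g (x + h *\<^sub>R a)) \<bullet> i - (g (x + 0 *\<^sub>R a + h *\<^sub>R b) - g (x + 0 *\<^sub>R a)) \<bullet> i
        = (h - 0) * ((D a (x + s *\<^sub>R a + h *\<^sub>R b) - D a (x + s *\<^sub>R a)) \<bullet> i)"
      using MVT2[OF h(1), of "\<lambda>s. (g (x + s *\<^sub>R a + h *\<^sub>R b) - g (x + s *\<^sub>R a)) \<bullet> i"
         "\<lambda>s. (D a (x + s *\<^sub>R a + h *\<^sub>R b) - D a (x + s *\<^sub>R a)) \<bullet> i"] 1 h by force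
    have 2: "((\<lambda>t. D a (x + s *\<^sub>R a + t *\<^sub>R b) \<bullet> i) has_real_derivative
        DD a b (x + s *\<^sub>R a + t *\<^sub>R b) \<bullet> i) (at t)" if t: "\<bar>t\<bar> < d" for t
    proof -
      have u: "x + s *\<^sub>R a + t *\<^sub>R b \<in> U" using inU[of s t] s t h by auto
      have "((\<lambda>t. x + s *\<^sub>R a + t *\<^sub>R b) has_derivative (\<lambda>t. t *\<^sub>R b)) (at t)"
        by (auto intro!: derivative_eq_intros)
      from has_derivative_compose[OF this dD[OF u]]
      have "((\<lambda>t. D a (x + s *\<^sub>R a + t *\<^sub>R b) \<bullet> i) has_derivative
         (\<lambda>r. DD a (r *\<^sub>R b) (x + s *\<^sub>R a + t *\<^sub>R b) \<bullet> i)) (at t)"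
        by (intro has_derivative_inner_left)
      moreover have "DD a (r *\<^sub>R b) y = r *\<^sub>R DD a b y" if "y \<in> U" for r y
        by (rule linear_cmul[OF has_derivative_linear[OF dD[OF that]]])
      ultimately show ?thesis
        using u unfolding has_field_derivative_def
        by (elim has_derivative_eq_rhs) (auto simp: fun_eq_iff)
    qed
    obtain t where t: "0 < t" "t < h" and
      e2: "D a (x + s *\<^sub>R a + h *\<^sub>R b) \<bullet> i - D a (x + s *\<^sub>R a + 0 *\<^sub>R b) \<bullet> i
        = (h - 0) * (DD a b (x + s *\<^sub>R a + t *\<^sub>R b) \<bullet> i)"
      using MVT2[OF h(1), of "\<lambda>t. D a (x + s *\<^sub>R a + t *\<^sub>R b) \<bullet> i"
         "\<lambda>t. DD a b (x + s *\<^sub>R a + t *\<^sub>R b) \<bullet> i"] 2 h by force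
    show ?thesis
      using s t e1 e2 h
      by (intro exI[of _ s] exI[of _ t] conjI)
         (simp_all add: inner_diff_left inner_add_left power2_eq_square)
  qed
  have "DD v w x \<bullet> i = DD w v x \<bullet> i" for i
  proof -
    define Q where "Q h = (g (x + h *\<^sub>R v + h *\<^sub>R w) - g (x + h *\<^sub>R v) - g (x + h *\<^sub>R w) + g x) \<bullet> i / h^2" for h :: real
    have lim: "(Q' \<longlongrightarrow> DD a b x \<bullet> i) (at_right 0)"
      if Q': "\<And>h. Q' h = (g (x + h *\<^sub>R a + h *\<^sub>R b) - g (x + h *\<^sub>R a) - g (x + h *\<^sub>R b) + g x) \<bullet> i / h^2"
      and inU: "\<And>s t. \<bar>s\<bar> < d \<Longrightarrow> \<bar>t\<bar> < d \<Longrightarrow> x + s *\<^sub>R a + t *\<^sub>R b \<in> U" for Q' a b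
    proof -
      have "\<forall>h. \<exists>s t. 0 < h \<and> h < d \<longrightarrow> (\<bar>s\<bar> \<le> h \<and> \<bar>t\<bar> \<le> h \<and> Q' h = DD a b (x + s *\<^sub>R a + t *\<^sub>R b) \<bullet> i)"
      proof
        fix h
        show "\<exists>s t. 0 < h \<and> h < d \<longrightarrow> (\<bar>s\<bar> \<le> h \<and> \<bar>t\<bar> \<le> h \<and> Q' h = DD a b (x + s *\<^sub>R a + t *\<^sub>R b) \<bullet> i)"
        proof (cases "0 < h \<and> h < d")
          case True
          then obtain s t where st: "\<bar>s\<bar> \<le> h" "\<bar>t\<bar> \<le> h"
            "(g (x + h *\<^sub>R a + h *\<^sub>R b) - g (x + h *\<^sub>R a) - g (x + h *\<^sub>R b) + g x) \<bullet> i
              = h^2 * (DD a b (x + s *\<^sub>R a + t *\<^sub>R b) \<bullet> i)"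
            using key[of h a b i] inU by blast
          have "Q' h = DD a b (x + s *\<^sub>R a + t *\<^sub>R b) \<bullet> i" using True by (simp add: Q' st(3))
          then show ?thesis using st by blast
        qed auto
      qed
      then obtain S T where ST: "\<And>h. 0 < h \<Longrightarrow> h < d \<Longrightarrow> \<bar>S h\<bar> \<le> h \<and> \<bar>T h\<bar> \<le> h \<and>
         Q' h = DD a b (x + S h *\<^sub>R a + T h *\<^sub>R b) \<bullet> i" by metis
      have ev: "\<forall>\<^sub>F h in at_right 0. 0 < h \<and> h < d"
        using eventually_at_right_real[OF d] by simp
      have "\<forall>\<^sub>F h in at_right 0. norm (S h) \<le> h" "\<forall>\<^sub>F h in at_right 0. norm (T h) \<le> h"
        using ST by (auto intro: eventually_mono[OF ev])
      then have S0: "(S \<longlongrightarrow> 0) (at_right 0)" "(T \<longlongrightarrow> 0) (at_right 0)"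
        using Lim_null_comparison[OF _ tendsto_ident_at] by blast+
      have "((\<lambda>h. x + S h *\<^sub>R a + T h *\<^sub>R b) \<longlongrightarrow> x + 0 *\<^sub>R a + 0 *\<^sub>R b) (at_right 0)"
        by (intro tendsto_intros S0)
      then have l: "((\<lambda>h. x + S h *\<^sub>R a + T h *\<^sub>R b) \<longlongrightarrow> x) (at_right 0)"
        by simp
      have c: "isCont (DD a b) x"
        using C2 U x continuous_on_eq_continuous_at by blast
      have "((\<lambda>h. DD a b (x + S h *\<^sub>R a + T h *\<^sub>R b) \<bullet> i) \<longlongrightarrow> DD a b x \<bullet> i) (at_right 0)"
        by (rule tendsto_inner[OF isCont_tendsto_compose[OF c l] tendsto_const])
      then show ?thesis
        by (rule Lim_transform_eventually) (use ST in \<open>auto intro: eventually_mono[OF ev]\<close>)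
    qed
    have "(Q \<longlongrightarrow> DD v w x \<bullet> i) (at_right 0)"
      by (rule lim) (use Q_def inU in auto)
    moreover have "(Q \<longlongrightarrow> DD w v x \<bullet> i) (at_right 0)"
    proof (rule lim)
      show "Q h = (g (x + h *\<^sub>R w + h *\<^sub>R v) - g (x + h *\<^sub>R w) - g (x + h *\<^sub>R v) + g x) \<bullet> i / h^2" for h
        by (simp add: Q_def add.commute add.left_commute add.assoc diff_diff_eq)
      show "x + s *\<^sub>R w + t *\<^sub>R v \<in> U" if "\<bar>s\<bar> < d" "\<bar>t\<bar> < d" for s t
        using inU[OF that(2,1)] by (simp add: add.commute add.left_commute)
    qed
    ultimately show ?thesis
      by (rule tendsto_unique[OF trivial_limit_at_right_real])
  qed
  then show ?thesis
    unfolding DD_def D_def by (rule euclidean_eqI)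
qed

lemma Ck_on_open_linear_compose:
  assumes "bounded_linear h" "open U"
  shows "Ck_on_open k f U \<Longrightarrow> Ck_on_open k (\<lambda>x. h (f x)) U"
proof (induction k arbitrary: f)
  case 0
  then show ?case using bounded_linear.continuous_on[OF assms(1)] by auto
next
  case (Suc k)
  show ?case
    by (rule Ck_on_open_SucI[where f' = "\<lambda>x v. h (frechet_derivative f (at x) v)"])
       (use Suc assms in \<open>auto intro!: bounded_linear.has_derivative[OF assms(1)] Ck_on_open_SucD[where k=k]\<close>)
qed

section \<open>Closure properties of smooth functions on arbitrary subsets\<close>

lemma smooth_onI_local:
  assumes "\<And>x. x \<in> S \<Longrightarrow> \<exists>U. open U \<and> x \<in> U \<and> smooth_on (U \<inter> S) f"
  shows "smooth_on S f"
  unfolding smooth_on_def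
proof
  fix x assume "x \<in> S"
  then obtain U where U: "open U" "x \<in> U" "smooth_on (U \<inter> S) f" using assms by blast
  then obtain V g where "open V" "x \<in> V" "\<forall>k. Ck_on_open k g V" "\<forall>y\<in>V \<inter> (U \<inter> S). f y = g y"
    using \<open>x \<in> S\<close> unfolding smooth_on_def by blast
  then show "\<exists>U g. open U \<and> x \<in> U \<and> (\<forall>k. Ck_on_open k g U) \<and> (\<forall>y\<in>U \<inter> S. f y = g y)"
    using U by (intro exI[of _ "U \<inter> V"] exI[of _ g]) (auto intro: Ck_on_open_subset)
qed

lemma smooth_on_subset: "smooth_on S f \<Longrightarrow> T \<subseteq> S \<Longrightarrow> smooth_on T f"
  unfolding smooth_on_def by (rule ballI, drule bspec, erule (1) subsetD) blast

lemma smooth_on_cong: "(\<And>x. x \<in> S \<Longrightarrow> f x = g x) \<Longrightarrow> smooth_on S f \<Longrightarrow> smooth_on S g"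
  unfolding smooth_on_def by simp

lemma Ck_on_open_imp_smooth_on: "open U \<Longrightarrow> (\<And>k. Ck_on_open k f U) \<Longrightarrow> smooth_on U f"
  unfolding smooth_on_def by blast

lemma smooth_on_linear: "bounded_linear f \<Longrightarrow> smooth_on S f"
  unfolding smooth_on_def
  by (metis Ck_on_open_linear UNIV_I open_UNIV)

lemma smooth_on_const: "smooth_on S (\<lambda>x. c)"
  unfolding smooth_on_def
  by (metis Ck_on_open_const UNIV_I open_UNIV)

lemma smooth_on_bilinear:
  assumes h: "bounded_bilinear h" and f: "smooth_on S f" and g: "smooth_on S g"
  shows "smooth_on S (\<lambda>x. h (f x) (g x))"
  unfolding smooth_on_def
proof
  fix x assume x: "x \<in> S"
  obtain U f' where U: "open U" "x \<in> U" "\<And>k. Ck_on_open k f' U" "\<And>y. y\<in>U \<inter> S \<Longrightarrow> f y = f' y"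
    using f x unfolding smooth_on_def by metis
  obtain V g' where V: "open V" "x \<in> V" "\<And>k. Ck_on_open k g' V" "\<And>y. y\<in>V \<inter> S \<Longrightarrow> g y = g' y"
    using g x unfolding smooth_on_def by metis
  have "Ck_on_open k (\<lambda>x. h (f' x) (g' x)) (U \<inter> V)" for k
    using U V by (intro Ck_on_open_bilinear[OF h]) (auto intro: Ck_on_open_subset)
  then show "\<exists>W e. open W \<and> x \<in> W \<and> (\<forall>k. Ck_on_open k e W) \<and> (\<forall>y\<in>W \<inter> S. h (f y) (g y) = e y)"
    using U V by (intro exI[of _ "U \<inter> V"] exI[of _ "\<lambda>x. h (f' x) (g' x)"]) auto
qed

lemma smooth_on_add:
  assumes f: "smooth_on S f" and g: "smooth_on S g"
  shows "smooth_on S (\<lambda>x. f x + g x)"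
  unfolding smooth_on_def
proof
  fix x assume x: "x \<in> S"
  obtain U f' where U: "open U" "x \<in> U" "\<And>k. Ck_on_open k f' U" "\<And>y. y\<in>U \<inter> S \<Longrightarrow> f y = f' y"
    using f x unfolding smooth_on_def by metis
  obtain V g' where V: "open V" "x \<in> V" "\<And>k. Ck_on_open k g' V" "\<And>y. y\<in>V \<inter> S \<Longrightarrow> g y = g' y"
    using g x unfolding smooth_on_def by metis
  have "Ck_on_open k (\<lambda>x. f' x + g' x) (U \<inter> V)" for k
    using U V by (intro Ck_on_open_add) (auto intro: Ck_on_open_subset)
  then show "\<exists>W e. open W \<and> x \<in> W \<and> (\<forall>k. Ck_on_open k e W) \<and> (\<forall>y\<in>W \<inter> S. f y + g y = e y)"
    using U V by (intro exI[of _ "U \<inter> V"] exI[of _ "\<lambda>x. f' x + g' x"]) auto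
qed

lemma smooth_on_linear_compose:
  assumes h: "bounded_linear h" and f: "smooth_on S f"
  shows "smooth_on S (\<lambda>x. h (f x))"
  unfolding smooth_on_def
proof
  fix x assume x: "x \<in> S"
  obtain U f' where U: "open U" "x \<in> U" "\<And>k. Ck_on_open k f' U" "\<And>y. y\<in>U \<inter> S \<Longrightarrow> f y = f' y"
    using f x unfolding smooth_on_def by metis
  then show "\<exists>W e. open W \<and> x \<in> W \<and> (\<forall>k. Ck_on_open k e W) \<and> (\<forall>y\<in>W \<inter> S. h (f y) = e y)"
    using Ck_on_open_linear_compose[OF h U(1) U(3)]
    by (intro exI[of _ U] exI[of _ "\<lambda>x. h (f' x)"]) auto
qed

lemma smooth_on_inverse:
  fixes f :: "'a::euclidean_space \<Rightarrow> real"
  assumes f: "smooth_on S f" and nz: "\<And>x. x \<in> S \<Longrightarrow> f x \<noteq> 0"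
  shows "smooth_on S (\<lambda>x. inverse (f x))"
  unfolding smooth_on_def
proof
  fix x assume x: "x \<in> S"
  obtain U f' where U: "open U" "x \<in> U" "\<And>k. Ck_on_open k f' U" "\<And>y. y\<in>U \<inter> S \<Longrightarrow> f y = f' y"
    using f x unfolding smooth_on_def by metis
  define V where "V = {y \<in> U. f' y \<noteq> 0}"
  have "continuous_on U f'" using U(3)[of 0] by simp
  then have "open V"
    using U(1) continuous_open_preimage[of U f' "- {0}"] unfolding V_def vimage_def Int_def by auto
  moreover have "x \<in> V" using U(2) U(4)[of x] x nz[of x] by (simp add: V_def)
  moreover have "Ck_on_open k (\<lambda>x. inverse (f' x)) V" for k
    using U \<open>open V\<close> by (intro Ck_on_open_inverse) (auto intro: Ck_on_open_subset simp: V_def)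
  ultimately show "\<exists>W e. open W \<and> x \<in> W \<and> (\<forall>k. Ck_on_open k e W) \<and> (\<forall>y\<in>W \<inter> S. inverse (f y) = e y)"
    using U by (intro exI[of _ V] exI[of _ "\<lambda>x. inverse (f' x)"]) (auto simp: V_def)
qed

lemma smooth_on_sum:
  "(\<And>i. i \<in> I \<Longrightarrow> smooth_on S (f i)) \<Longrightarrow> smooth_on S (\<lambda>x. \<Sum>i\<in>I. f i x)"
  by (induction I rule: infinite_finite_induct) (auto intro: smooth_on_const smooth_on_add)

lemma smooth_on_diff: "smooth_on S f \<Longrightarrow> smooth_on S g \<Longrightarrow> smooth_on S (\<lambda>x. f x - g x)"
  using smooth_on_add[of S f "\<lambda>x. - g x"] smooth_on_linear_compose[OF bounded_linear_minus[OF bounded_linear_ident]]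
  by auto

lemma smooth_on_inner: "smooth_on S f \<Longrightarrow> smooth_on S g \<Longrightarrow> smooth_on S (\<lambda>x. f x \<bullet> g x)"
  by (rule smooth_on_bilinear[OF bounded_bilinear_inner])

lemma smooth_on_scaleR: "smooth_on S f \<Longrightarrow> smooth_on S g \<Longrightarrow> smooth_on S (\<lambda>x. f x *\<^sub>R g x)"
  by (rule smooth_on_bilinear[OF bounded_bilinear_scaleR])

lemma smooth_on_mult:
  fixes f g :: "'a::euclidean_space \<Rightarrow> real"
  shows "smooth_on S f \<Longrightarrow> smooth_on S g \<Longrightarrow> smooth_on S (\<lambda>x. f x * g x)"
  by (rule smooth_on_bilinear[OF bounded_bilinear_mult])

lemma smooth_on_Pair:
  assumes "smooth_on S f" "smooth_on S g"
  shows "smooth_on S (\<lambda>x. (f x, g x))"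
proof -
  have "bounded_linear (\<lambda>a. (a, 0))" "bounded_linear (\<lambda>a. (0, a))"
    by (intro bounded_linear_Pair bounded_linear_ident bounded_linear_zero)+
  from smooth_on_add[OF smooth_on_linear_compose[OF this(1) assms(1)] smooth_on_linear_compose[OF this(2) assms(2)]]
  show ?thesis by simp
qed

lemma smooth_on_fst: "smooth_on S f \<Longrightarrow> smooth_on S (\<lambda>x. fst (f x))"
  and smooth_on_snd: "smooth_on S f \<Longrightarrow> smooth_on S (\<lambda>x. snd (f x))"
  by (fact smooth_on_linear_compose[OF bounded_linear_fst] smooth_on_linear_compose[OF bounded_linear_snd])+

lemma smooth_on_ident: "smooth_on S (\<lambda>x. x)"
  by (rule smooth_on_linear[OF bounded_linear_ident])

lemmas smooth_on_intros =
  smooth_on_const smooth_on_ident smooth_on_add smooth_on_diff smooth_on_inner smooth_on_scaleR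
  smooth_on_mult smooth_on_Pair smooth_on_fst smooth_on_snd smooth_on_sum smooth_on_inverse

section \<open>The differential on tangent vectors\<close>

lemma eventually_within_openI:
  assumes "open U" "x \<in> U" "\<And>y. y \<in> U \<inter> S \<Longrightarrow> P y"
  shows "\<forall>\<^sub>F y in at x within S. P y"
  using assms unfolding eventually_at_topological by blast

text \<open>A curve in \<open>S\<close> with velocity \<open>v\<close> turns every derivative
  \<open>E\<close> of \<open>f\<close> within \<open>S\<close> into a vector derivative
  \<open>E v\<close> of one function of a real variable, and such a derivative is unique.\<close>

lemma differential_eqI:
  assumes v: "v \<in> tangent_space S x" and D: "(f has_derivative D) (at x within S)"
  shows "differential S f x v = D v"
proof -
  obtain \<epsilon> \<gamma> where \<gamma>: "\<epsilon> > 0" "\<gamma> ` {-\<epsilon><..<\<epsilon>} \<subseteq> S" "\<gamma> 0 = x" "(\<gamma> has_vector_derivative v) (at 0)"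
    using v unfolding tangent_space_def mem_Collect_eq by (elim exE conjE) (rule that)
  have *: "((\<lambda>s. f (\<gamma> s)) has_vector_derivative E v) (at 0)"
    if "(f has_derivative E) (at x within S)" for E
  proof -
    have "(f has_derivative E) (at (\<gamma> 0) within \<gamma> ` {-\<epsilon><..<\<epsilon>})"
      using has_derivative_subset[OF that \<gamma>(2)] \<gamma>(3) by simp
    moreover have "(\<gamma> has_derivative (\<lambda>t. t *\<^sub>R v)) (at 0 within {-\<epsilon><..<\<epsilon>})"
      using \<gamma>(4) unfolding has_vector_derivative_def by (rule has_derivative_at_withinI)
    ultimately have "((\<lambda>s. f (\<gamma> s)) has_derivative (\<lambda>t. E (t *\<^sub>R v))) (at 0 within {-\<epsilon><..<\<epsilon>})"
      by (rule has_derivative_in_compose[rotated])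
    then have "((\<lambda>s. f (\<gamma> s)) has_derivative (\<lambda>t. E (t *\<^sub>R v))) (at 0)"
      using \<gamma>(1) at_within_open[of 0 "{-\<epsilon><..<\<epsilon>}"] by simp
    moreover have "E (t *\<^sub>R v) = t *\<^sub>R E v" for t
      by (rule linear_cmul[OF has_derivative_linear[OF that]])
    ultimately show ?thesis by (simp add: has_vector_derivative_def)
  qed
  have "f differentiable (at x within S)" using D differentiable_def by blast
  then have "(f has_derivative differential S f x) (at x within S)"
    unfolding differential_def frechet_derivative_works by simp
  from *[OF this] *[OF D] show ?thesis by (rule vector_derivative_unique_at)
qed

lemma differentiable_imp_has_derivative_differential:
  "f differentiable (at x within S) \<Longrightarrow> (f has_derivative differential S f x) (at x within S)"
  unfolding differential_def frechet_derivative_works by simp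

text \<open>One extension \<open>g\<close> supplies the derivative at all points of
  \<open>U \<inter> S\<close>, not only at \<open>x\<close>; differentiating a second time requires
  this.\<close>

lemma smooth_on_local_rep:
  assumes "smooth_on S f" "x \<in> S"
  obtains U g where "open U" "x \<in> U" "\<And>k. Ck_on_open k g U" "\<And>y. y \<in> U \<inter> S \<Longrightarrow> f y = g y"
    "\<And>y. y \<in> U \<inter> S \<Longrightarrow> (f has_derivative frechet_derivative g (at y)) (at y within S)"
proof -
  obtain U g where U: "open U" "x \<in> U" "\<And>k. Ck_on_open k g U" "\<And>y. y\<in>U \<inter> S \<Longrightarrow> f y = g y"
    using assms unfolding smooth_on_def by metis
  have "(f has_derivative frechet_derivative g (at y)) (at y within S)" if "y \<in> U \<inter> S" for y
  proof (rule has_derivative_transform_eventually)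
    show "(g has_derivative frechet_derivative g (at y)) (at y within S)"
      using Ck_on_open_SucD[OF U(1) U(3)] that by (auto intro: has_derivative_at_withinI)
    show "\<forall>\<^sub>F z in at y within S. g z = f z"
      using U that by (intro eventually_within_openI[of U]) auto
  qed (use U that in auto)
  then show thesis using that U by blast
qed

lemma smooth_on_differentiable:
  "smooth_on S f \<Longrightarrow> x \<in> S \<Longrightarrow> f differentiable (at x within S)"
  by (rule smooth_on_local_rep[of S f x]) (auto simp: differentiable_def)

lemma smooth_on_continuous_on: "smooth_on S f \<Longrightarrow> continuous_on S f"
  by (auto simp: continuous_on_eq_continuous_within intro: differentiable_imp_continuous_within smooth_on_differentiable)

lemma has_derivative_within_cong:
  assumes "open U" "x \<in> U \<inter> S" "\<And>y. y \<in> U \<inter> S \<Longrightarrow> f y = g y"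
  shows "(f has_derivative D) (at x within S) \<longleftrightarrow> (g has_derivative D) (at x within S)"
proof -
  have "\<forall>\<^sub>F y in at x within S. f y = g y" "\<forall>\<^sub>F y in at x within S. g y = f y"
    using assms by (auto intro!: eventually_within_openI[of U])
  then show ?thesis
    using assms by (auto elim!: has_derivative_transform_eventually)
qed

text \<open>Gives equality of the chosen linear maps themselves, not only on tangent vectors: both
  are chosen by the same predicate.\<close>

lemma differential_cong:
  assumes "open U" "x \<in> U \<inter> S" "\<And>y. y \<in> U \<inter> S \<Longrightarrow> f y = g y"
  shows "differential S f x = differential S g x"
  using has_derivative_within_cong[OF assms] by (auto simp: differential_def frechet_derivative_def)

lemma linear_differential: "f differentiable (at x within S) \<Longrightarrow> linear (differential S f x)"
  unfolding differential_def by (rule linear_frechet_derivative)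

context
  fixes S :: "'a::euclidean_space set" and x v
  assumes v: "v \<in> tangent_space S x"
begin

lemma differential_linear: "bounded_linear h \<Longrightarrow> differential S h x v = h v"
  by (rule differential_eqI[OF v]) (rule bounded_linear_imp_has_derivative)

lemma differential_const: "differential S (\<lambda>x. c) x v = 0"
  by (rule differential_eqI[OF v]) (rule has_derivative_const)

lemma differential_linear_compose:
  "bounded_linear h \<Longrightarrow> f differentiable (at x within S) \<Longrightarrow>
     differential S (\<lambda>x. h (f x)) x v = h (differential S f x v)"
  by (rule differential_eqI[OF v])
     (erule bounded_linear.has_derivative, erule differentiable_imp_has_derivative_differential)

lemma differential_add:
  "f differentiable (at x within S) \<Longrightarrow> g differentiable (at x within S) \<Longrightarrow>
     differential S (\<lambda>x. f x + g x) x v = differential S f x v + differential S g x v"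
  by (rule differential_eqI[OF v])
     (rule has_derivative_add; erule differentiable_imp_has_derivative_differential)

lemma differential_diff:
  "f differentiable (at x within S) \<Longrightarrow> g differentiable (at x within S) \<Longrightarrow>
     differential S (\<lambda>x. f x - g x) x v = differential S f x v - differential S g x v"
  by (rule differential_eqI[OF v])
     (rule has_derivative_diff; erule differentiable_imp_has_derivative_differential)

lemma differential_sum:
  "(\<And>i. i \<in> I \<Longrightarrow> f i differentiable (at x within S)) \<Longrightarrow>
     differential S (\<lambda>x. \<Sum>i\<in>I. f i x) x v = (\<Sum>i\<in>I. differential S (f i) x v)"
  by (rule differential_eqI[OF v])
     (rule has_derivative_sum, rule differentiable_imp_has_derivative_differential)

lemma differential_bilinear:
  "bounded_bilinear h \<Longrightarrow> f differentiable (at x within S) \<Longrightarrow> g differentiable (at x within S) \<Longrightarrow>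
     differential S (\<lambda>x. h (f x) (g x)) x v = h (f x) (differential S g x v) + h (differential S f x v) (g x)"
  by (rule differential_eqI[OF v])
     (erule bounded_bilinear.FDERIV; erule differentiable_imp_has_derivative_differential)

lemma differential_inner:
  "f differentiable (at x within S) \<Longrightarrow> g differentiable (at x within S) \<Longrightarrow>
     differential S (\<lambda>x. f x \<bullet> g x) x v = f x \<bullet> differential S g x v + differential S f x v \<bullet> g x"
  by (rule differential_bilinear[OF bounded_bilinear_inner])

lemma differential_scaleR:
  "f differentiable (at x within S) \<Longrightarrow> g differentiable (at x within S) \<Longrightarrow>
     differential S (\<lambda>x. f x *\<^sub>R g x) x v = f x *\<^sub>R differential S g x v + differential S f x v *\<^sub>R g x"
  by (rule differential_bilinear[OF bounded_bilinear_scaleR])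

end

lemma smooth_on_frechet_derivative:
  assumes "open U" "\<And>k. Ck_on_open k g U"
  shows "smooth_on U (\<lambda>y. frechet_derivative g (at y) v)"
proof (rule Ck_on_open_imp_smooth_on[OF assms(1)])
  show "Ck_on_open k (\<lambda>y. frechet_derivative g (at y) v) U" for k
    using assms(2)[of "Suc k"] by simp
qed

lemma linear_euclidean_expand:
  fixes L :: "'a::euclidean_space \<Rightarrow> 'b::real_vector"
  assumes "linear L"
  shows "L v = (\<Sum>b\<in>Basis. (v \<bullet> b) *\<^sub>R L b)"
proof -
  have "L v = L (\<Sum>b\<in>Basis. (v \<bullet> b) *\<^sub>R b)" by (simp add: euclidean_representation)
  also have "\<dots> = (\<Sum>b\<in>Basis. (v \<bullet> b) *\<^sub>R L b)"
    using linear_sum[OF assms, of "\<lambda>b. (v \<bullet> b) *\<^sub>R b"] linear_cmul[OF assms] by simp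
  finally show ?thesis .
qed

lemma differential_local_expand:
  assumes f: "\<And>y. y \<in> U \<inter> S \<Longrightarrow> (f has_derivative frechet_derivative g (at y)) (at y within S)"
    and y: "y \<in> U \<inter> S" and v: "v \<in> tangent_space S y"
  shows "differential S f y v = (\<Sum>b\<in>Basis. (v \<bullet> b) *\<^sub>R frechet_derivative g (at y) b)"
  by (rule trans[OF differential_eqI[OF v f[OF y]] linear_euclidean_expand[OF has_derivative_linear[OF f[OF y]]]])

text \<open>On tangent vectors the differential agrees with that of a local extension, which is a
  combination of smooth partial derivatives with the components of \<open>X\<close> as
  coefficients.\<close>

lemma smooth_on_differential:
  assumes f: "smooth_on S f" and X: "smooth_on S X" and T: "\<And>x. x \<in> S \<Longrightarrow> X x \<in> tangent_space S x"
  shows "smooth_on S (\<lambda>x. differential S f x (X x))"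
proof (rule smooth_onI_local)
  fix x assume x: "x \<in> S"
  obtain U g where U: "open U" "x \<in> U" "\<And>k. Ck_on_open k g U" "\<And>y. y \<in> U \<inter> S \<Longrightarrow> f y = g y"
    "\<And>y. y \<in> U \<inter> S \<Longrightarrow> (f has_derivative frechet_derivative g (at y)) (at y within S)"
    by (rule smooth_on_local_rep[OF f x]) (rule that)
  have "smooth_on (U \<inter> S) (\<lambda>y. \<Sum>b\<in>Basis. (X y \<bullet> b) *\<^sub>R frechet_derivative g (at y) b)"
    using smooth_on_subset[OF smooth_on_frechet_derivative[OF U(1,3)]] smooth_on_subset[OF X]
    by (intro smooth_on_intros) auto
  then have "smooth_on (U \<inter> S) (\<lambda>x. differential S f x (X x))"
    by (rule smooth_on_cong[rotated]) (use differential_local_expand[of U S f g, OF U(5)] T in auto)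
  then show "\<exists>U. open U \<and> x \<in> U \<and> smooth_on (U \<inter> S) (\<lambda>x. differential S f x (X x))"
    using U by blast
qed

text \<open>Smooth functions restricted to a set \<open>S\<close> inherit the symmetry of second derivatives from
  their local extensions.\<close>

lemma differential_commute:
  assumes f: "smooth_on S f" and X: "smooth_on S X" "\<And>x. x \<in> S \<Longrightarrow> X x \<in> tangent_space S x"
    and Y: "smooth_on S Y" "\<And>x. x \<in> S \<Longrightarrow> Y x \<in> tangent_space S x" and x: "x \<in> S"
    and br: "differential S X x (Y x) = differential S Y x (X x)"
  shows "differential S (\<lambda>y. differential S f y (X y)) x (Y x)
       = differential S (\<lambda>y. differential S f y (Y y)) x (X x)"
proof -
  obtain U g where U: "open U" "x \<in> U" "\<And>k. Ck_on_open k g U" "\<And>y. y \<in> U \<inter> S \<Longrightarrow> f y = g y"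
    "\<And>y. y \<in> U \<inter> S \<Longrightarrow> (f has_derivative frechet_derivative g (at y)) (at y within S)"
    by (rule smooth_on_local_rep[OF f x]) (rule that)
  define G where "G b = (\<lambda>y. frechet_derivative g (at y) b)" for b
  define H where "H b c = frechet_derivative (G b) (at x) c" for b c
  have sG: "Ck_on_open k (G b) U" for k b using U(3)[of "Suc k"] by (simp add: G_def)
  have dG: "(G b has_derivative H b) (at x within S)" for b
    unfolding H_def using Ck_on_open_SucD[OF U(1) sG U(2)] by (auto intro: has_derivative_at_withinI)
  have symm: "H b c = H c b" for b c
    unfolding H_def G_def using frechet_derivative_commute[OF U(1,2) U(3)[of 2]] .
  \<comment> \<open>Leibniz rule: the first term sees only the derivative of the field, the second
    is the Hessian of \<open>g\<close>. Exchanging the two fields changes neither, the first by the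
    vanishing bracket \<open>br\<close>, the second by \<open>symm\<close>.\<close>
  have *: "differential S (\<lambda>y. differential S f y (Z y)) x w =
     frechet_derivative g (at x) (differential S Z x w) + (\<Sum>b\<in>Basis. \<Sum>c\<in>Basis. ((Z x \<bullet> b) * (w \<bullet> c)) *\<^sub>R H b c)"
    if Z: "smooth_on S Z" "\<And>x. x \<in> S \<Longrightarrow> Z x \<in> tangent_space S x" and w: "w \<in> tangent_space S x" for Z w
  proof -
    have dZ: "Z differentiable (at x within S)" using smooth_on_differentiable[OF Z(1) x] .
    then have dZb: "(\<lambda>y. Z y \<bullet> b) differentiable (at x within S)" for b
      by (auto intro!: derivative_intros)
    have dGd: "G b differentiable (at x within S)" for b using dG differentiable_def by blast
    have "differential S (\<lambda>y. differential S f y (Z y)) x w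
        = differential S (\<lambda>y. \<Sum>b\<in>Basis. (Z y \<bullet> b) *\<^sub>R G b y) x w"
      by (subst differential_cong[OF U(1)])
         (use x U differential_local_expand[of U S f g, OF U(5)] Z in \<open>auto simp: G_def\<close>)
    also have "\<dots> = (\<Sum>b\<in>Basis. differential S (\<lambda>y. (Z y \<bullet> b) *\<^sub>R G b y) x w)"
      by (rule differential_sum[OF w]) (intro differentiable_scaleR dZb dGd)
    also have "\<dots> = (\<Sum>b\<in>Basis. (Z x \<bullet> b) *\<^sub>R H b w + (differential S Z x w \<bullet> b) *\<^sub>R G b x)"
    proof (rule sum.cong[OF refl])
      fix b :: 'a
      have "differential S (\<lambda>y. Z y \<bullet> b) x w = differential S Z x w \<bullet> b"
        by (rule differential_linear_compose[OF w bounded_linear_inner_left dZ])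
      then show "differential S (\<lambda>y. (Z y \<bullet> b) *\<^sub>R G b y) x w = (Z x \<bullet> b) *\<^sub>R H b w + (differential S Z x w \<bullet> b) *\<^sub>R G b x"
        using differential_scaleR[OF w dZb dGd] differential_eqI[OF w dG] by simp
    qed
    also have "\<dots> = (\<Sum>b\<in>Basis. (Z x \<bullet> b) *\<^sub>R H b w) + frechet_derivative g (at x) (differential S Z x w)"
      using linear_euclidean_expand[OF has_derivative_linear[OF U(5)[OF IntI[OF U(2) x]]], of "differential S Z x w", symmetric]
      by (simp add: sum.distrib G_def)
    also have "(\<Sum>b\<in>Basis. (Z x \<bullet> b) *\<^sub>R H b w) = (\<Sum>b\<in>Basis. \<Sum>c\<in>Basis. ((Z x \<bullet> b) * (w \<bullet> c)) *\<^sub>R H b c)"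
      by (subst linear_euclidean_expand[OF has_derivative_linear[OF dG]])
         (simp add: scaleR_sum_right)
    finally show ?thesis by simp
  qed
  have "(\<Sum>b\<in>Basis. \<Sum>c\<in>Basis. ((X x \<bullet> b) * (Y x \<bullet> c)) *\<^sub>R H b c)
      = (\<Sum>b\<in>Basis. \<Sum>c\<in>Basis. ((Y x \<bullet> b) * (X x \<bullet> c)) *\<^sub>R H b c)"
    by (subst sum.swap) (simp add: symm mult.commute)
  then show ?thesis
    using *[OF X Y(2)[OF x]] *[OF Y X(2)[OF x]] br by simp
qed

section \<open>Hausdorff measure\<close>

definition hausdorff_gauge :: "nat \<Rightarrow> 'a::euclidean_space set \<Rightarrow> ennreal" where
  "hausdorff_gauge m C = (if C = {} then 0 else ennreal (unit_ball_vol (real m) * (diameter C / 2) ^ m))"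

definition hausdorff_covers :: "real \<Rightarrow> 'a::euclidean_space set \<Rightarrow> (nat \<Rightarrow> 'a set) set" where
  "hausdorff_covers \<delta> A = {C. A \<subseteq> (\<Union>i. C i) \<and> (\<forall>i. bounded (C i) \<and> diameter (C i) \<le> \<delta>)}"

text \<open>The set function passed to \<open>measure_of\<close> in
  \<open>hausdorff_measure\<close>. The result has these values only if they form a measure on the
  Borel sets and is zero otherwise, so this must be proved before any value is known.\<close>

definition hausdorff_outer :: "nat \<Rightarrow> 'a::euclidean_space set \<Rightarrow> ennreal" where
  "hausdorff_outer m A = (SUP \<delta>\<in>{0<..}. hausdorff_content m \<delta> A)"

lemma hausdorff_gauge_empty [simp]: "hausdorff_gauge m {} = 0"
  by (simp add: hausdorff_gauge_def)

lemma hausdorff_content_alt: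
  "hausdorff_content m \<delta> A = (INF C\<in>hausdorff_covers \<delta> A. \<Sum>i. hausdorff_gauge m (C i))"
  unfolding hausdorff_content_def hausdorff_covers_def hausdorff_gauge_def ..

lemma hausdorff_content_le:
  "C \<in> hausdorff_covers \<delta> A \<Longrightarrow> hausdorff_content m \<delta> A \<le> (\<Sum>i. hausdorff_gauge m (C i))"
  unfolding hausdorff_content_alt by (rule INF_lower)

lemma hausdorff_content_mono: "A \<subseteq> B \<Longrightarrow> hausdorff_content m \<delta> A \<le> hausdorff_content m \<delta> B"
  unfolding hausdorff_content_alt by (rule INF_superset_mono) (auto simp: hausdorff_covers_def)

lemma hausdorff_content_antimono:
  "\<delta> \<le> \<delta>' \<Longrightarrow> hausdorff_content m \<delta>' A \<le> hausdorff_content m \<delta> A"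
  unfolding hausdorff_content_alt
  by (rule INF_superset_mono) (auto simp: hausdorff_covers_def intro: order_trans)

lemma hausdorff_content_empty:
  assumes "\<delta> > 0" shows "hausdorff_content m \<delta> {} = 0"
  using hausdorff_content_le[of "\<lambda>_. {}" \<delta> "{}" m] assms by (simp add: hausdorff_covers_def)

text \<open>Diagonal argument: covers of the \<open>A n\<close> that are optimal up to
  \<open>e / 2^(n+1)\<close> are merged into one sequence by \<open>prod_decode\<close>.\<close>

lemma hausdorff_content_subadditive:
  "hausdorff_content m \<delta> (\<Union>i. A i) \<le> (\<Sum>i. hausdorff_content m \<delta> (A i))"
proof (rule ennreal_le_epsilon)
  fix e :: real assume e: "0 < e" and fin: "(\<Sum>i. hausdorff_content m \<delta> (A i)) < top"
  have "\<exists>C\<in>hausdorff_covers \<delta> (A n). (\<Sum>i. hausdorff_gauge m (C i)) \<le> hausdorff_content m \<delta> (A n) + e * (1/2)^Suc n" for n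
  proof -
    have "hausdorff_content m \<delta> (A n) \<noteq> top" using fin ennreal_suminf_lessD by (metis less_top)
    then have "hausdorff_content m \<delta> (A n) < hausdorff_content m \<delta> (A n) + e * (1/2)^Suc n"
      using e by (simp add: less_top)
    then have "(INF C\<in>hausdorff_covers \<delta> (A n). \<Sum>i. hausdorff_gauge m (C i)) < hausdorff_content m \<delta> (A n) + e * (1/2)^Suc n"
      by (simp add: hausdorff_content_alt)
    then show ?thesis unfolding INF_less_iff by (auto intro: less_imp_le)
  qed
  then obtain B where B: "\<And>n. B n \<in> hausdorff_covers \<delta> (A n)"
    and Ble: "\<And>n. (\<Sum>i. hausdorff_gauge m (B n i)) \<le> hausdorff_content m \<delta> (A n) + e * (1/2)^Suc n"
    by metis
  define C where "C = case_prod B o prod_decode"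
  have "(\<Union>i. A i) \<subseteq> (\<Union>i. C i)"
  proof
    fix x assume "x \<in> (\<Union>i. A i)"
    then obtain i j where "x \<in> B i j" using B unfolding hausdorff_covers_def by blast
    then have "x \<in> C (prod_encode (i, j))" by (simp add: C_def)
    then show "x \<in> (\<Union>i. C i)" by blast
  qed
  then have "C \<in> hausdorff_covers \<delta> (\<Union>i. A i)"
    using B by (auto simp: hausdorff_covers_def C_def split_def)
  then have "hausdorff_content m \<delta> (\<Union>i. A i) \<le> (\<Sum>i. hausdorff_gauge m (C i))"
    by (rule hausdorff_content_le)
  also have "\<dots> = (\<Sum>n. \<Sum>i. hausdorff_gauge m (B n i))"
    unfolding C_def comp_def
    using suminf_ennreal_2dimen[of _ "\<lambda>p. hausdorff_gauge m (case_prod B p)"] by simp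
  also have "\<dots> \<le> (\<Sum>n. hausdorff_content m \<delta> (A n) + e * (1/2) ^ Suc n)"
    by (intro suminf_le allI Ble) auto
  also have "\<dots> = (\<Sum>n. hausdorff_content m \<delta> (A n)) + (\<Sum>n. ennreal e * ennreal ((1/2) ^ Suc n))"
    using e by (subst suminf_add[symmetric])
       (auto simp del: ennreal_suminf_cmult simp add: ennreal_mult[symmetric])
  also have "\<dots> = (\<Sum>n. hausdorff_content m \<delta> (A n)) + e"
    unfolding ennreal_suminf_cmult
    by (subst suminf_ennreal_eq[OF zero_le_power power_half_series]) auto
  finally show "hausdorff_content m \<delta> (\<Union>i. A i) \<le> (\<Sum>n. hausdorff_content m \<delta> (A n)) + e" .
qed

lemma hausdorff_content_le_outer: "\<delta> > 0 \<Longrightarrow> hausdorff_content m \<delta> A \<le> hausdorff_outer m A"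
  unfolding hausdorff_outer_def by (rule SUP_upper) simp

lemma hausdorff_outer_mono: "A \<subseteq> B \<Longrightarrow> hausdorff_outer m A \<le> hausdorff_outer m B"
  unfolding hausdorff_outer_def by (rule SUP_mono) (use hausdorff_content_mono in blast)

lemma hausdorff_outer_empty [simp]: "hausdorff_outer m {} = 0"
proof -
  have "hausdorff_outer m {} = (SUP \<delta>\<in>{0<..}::real set. (0::ennreal))"
    unfolding hausdorff_outer_def by (rule SUP_cong) (auto simp: hausdorff_content_empty)
  then show ?thesis by simp
qed

lemma hausdorff_outer_subadditive: "hausdorff_outer m (\<Union>i. A i) \<le> (\<Sum>i. hausdorff_outer m (A i))"
proof -
  have "hausdorff_content m \<delta> (\<Union>i. A i) \<le> (\<Sum>i. hausdorff_outer m (A i))" if "\<delta> > 0" for \<delta>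
    using hausdorff_content_subadditive[of m \<delta> A]
      suminf_le[OF hausdorff_content_le_outer[OF that, of m] summableI summableI, of A]
    by (rule order_trans)
  then show ?thesis
    unfolding hausdorff_outer_def[of m "\<Union>i. A i"] by (intro SUP_least) auto
qed

section \<open>Caratheodory's criterion for metric outer measures\<close>

lemma outer_measure_space_hausdorff: "outer_measure_space (Pow UNIV) (hausdorff_outer m)"
  unfolding outer_measure_space_def positive_def increasing_def countably_subadditive_def
  using hausdorff_outer_mono hausdorff_outer_subadditive by auto

text \<open>A set of diameter at most \<open>\<delta>\<close> cannot meet both \<open>A\<close> and
  \<open>B\<close>, so a cover of the union splits into covers of the two parts; discarded members
  become \<open>{}\<close>, which costs nothing.\<close>

lemma hausdorff_content_separated:
  assumes sep: "\<And>a b. a \<in> A \<Longrightarrow> b \<in> B \<Longrightarrow> \<delta> < dist a b" and "\<delta> > 0"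
  shows "hausdorff_content m \<delta> A + hausdorff_content m \<delta> B \<le> hausdorff_content m \<delta> (A \<union> B)"
  unfolding hausdorff_content_alt[of m \<delta> "A \<union> B"]
proof (rule INF_greatest)
  fix C assume C: "C \<in> hausdorff_covers \<delta> (A \<union> B)"
  define CA where "CA i = (if C i \<inter> A = {} then {} else C i)" for i
  define CB where "CB i = (if C i \<inter> B = {} then {} else C i)" for i
  have "CA \<in> hausdorff_covers \<delta> A" "CB \<in> hausdorff_covers \<delta> B"
    using C \<open>\<delta> > 0\<close> by (fastforce simp: hausdorff_covers_def CA_def CB_def)+
  then have "hausdorff_content m \<delta> A + hausdorff_content m \<delta> B
     \<le> (\<Sum>i. hausdorff_gauge m (CA i)) + (\<Sum>i. hausdorff_gauge m (CB i))"
    by (intro add_mono hausdorff_content_le)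
  also have "\<dots> = (\<Sum>i. hausdorff_gauge m (CA i) + hausdorff_gauge m (CB i))"
    by (rule suminf_add) auto
  also have "\<dots> \<le> (\<Sum>i. hausdorff_gauge m (C i))"
  proof (rule suminf_le)
    fix i
    have "C i \<inter> A = {} \<or> C i \<inter> B = {}"
    proof (rule ccontr)
      assume "\<not> ?thesis"
      then obtain a b where ab: "a \<in> C i" "a \<in> A" "b \<in> C i" "b \<in> B" by blast
      have "dist a b \<le> diameter (C i)"
        using C ab by (auto intro!: diameter_bounded_bound simp: hausdorff_covers_def)
      also have "\<dots> \<le> \<delta>" using C by (auto simp: hausdorff_covers_def)
      finally show False using sep[OF ab(2,4)] by simp
    qed
    then show "hausdorff_gauge m (CA i) + hausdorff_gauge m (CB i) \<le> hausdorff_gauge m (C i)"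
      by (auto simp: CA_def CB_def)
  qed auto
  finally show "hausdorff_content m \<delta> A + hausdorff_content m \<delta> B \<le> (\<Sum>i. hausdorff_gauge m (C i))" .
qed

text \<open>As soon as the scale drops below the distance \<open>d\<close>, the contents at that
  scale are superadditive.\<close>

lemma hausdorff_outer_separated:
  assumes sep: "\<And>a b. a \<in> A \<Longrightarrow> b \<in> B \<Longrightarrow> d \<le> dist a b" and "d > 0"
  shows "hausdorff_outer m A + hausdorff_outer m B \<le> hausdorff_outer m (A \<union> B)"
proof -
  have *: "hausdorff_content m \<delta> A + hausdorff_content m \<delta> B \<le> hausdorff_outer m (A \<union> B)" if "\<delta> > 0" for \<delta>
  proof -
    define \<eta> where "\<eta> = min \<delta> (d/2)"
    have \<eta>: "\<eta> > 0" "\<eta> \<le> \<delta>" "\<eta> < d" using that \<open>d > 0\<close> by (auto simp: \<eta>_def)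
    have "hausdorff_content m \<delta> A + hausdorff_content m \<delta> B \<le> hausdorff_content m \<eta> A + hausdorff_content m \<eta> B"
      by (intro add_mono hausdorff_content_antimono \<eta>)
    also have "\<dots> \<le> hausdorff_content m \<eta> (A \<union> B)"
      by (rule hausdorff_content_separated) (use sep \<eta> in \<open>auto intro: less_le_trans\<close>)
    also have "\<dots> \<le> hausdorff_outer m (A \<union> B)" by (rule hausdorff_content_le_outer[OF \<eta>(1)])
    finally show ?thesis .
  qed
  \<comment> \<open>Both contents grow as \<open>\<delta>\<close> decreases, so the sum of the two
    suprema is the supremum of the sums.\<close>
  have "hausdorff_outer m A + hausdorff_outer m B
      = (SUP \<delta>\<in>{0<..}. hausdorff_content m \<delta> A + hausdorff_content m \<delta> B)"
    unfolding hausdorff_outer_def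
  proof (rule SUP_add_directed_ennreal[symmetric])
    fix i j :: real assume "i \<in> {0<..}" "j \<in> {0<..}"
    then show "\<exists>k\<in>{0<..}. hausdorff_content m i A + hausdorff_content m j B \<le> hausdorff_content m k A + hausdorff_content m k B"
      by (intro bexI[of _ "min i j"] add_mono hausdorff_content_antimono) auto
  qed
  also have "\<dots> \<le> hausdorff_outer m (A \<union> B)" by (rule SUP_least) (use * in auto)
  finally show ?thesis .
qed

lemma hausdorff_outer_Un: "hausdorff_outer m (A \<union> B) \<le> hausdorff_outer m A + hausdorff_outer m B"
proof -
  have "hausdorff_outer m (\<Union>i. binaryset A B i) \<le> (\<Sum>i. hausdorff_outer m (binaryset A B i))"
    by (rule hausdorff_outer_subadditive)
  then show ?thesis by (simp add: UN_binaryset_eq suminf_binaryset_eq)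
qed

text \<open>Caratheodory's argument: the layers of \<open>A - F\<close> around the closed set \<open>F\<close> have finite total
  measure because every second layer is separated from the previous ones.\<close>

lemma hausdorff_outer_closed_split:
  fixes F :: "'a::euclidean_space set"
  assumes F: "closed F"
  shows "hausdorff_outer m (A \<inter> F) + hausdorff_outer m (A - F) \<le> hausdorff_outer m A"
proof (cases "F = {}")
  case False
  let ?\<mu> = "hausdorff_outer m"
  define An where "An n = {x \<in> A - F. inverse (real (Suc n)) \<le> infdist x F}" for n
  define R where "R n = An (Suc n) - An n" for n
  have sepd: "0 < inverse (real (Suc n)) - inverse (real (Suc (Suc n)))" for n
    by simp
  have sep: "inverse (real (Suc n)) - inverse (real (Suc (Suc n))) \<le> dist a b"
    if "a \<in> An n" "infdist b F \<le> inverse (real (Suc (Suc n)))" for a b n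
    using that infdist_triangle[of a F b] by (auto simp: An_def)
  have An_mono: "An n \<subseteq> An k" if "n \<le> k" for n k
  proof -
    have "inverse (real (Suc k)) \<le> inverse (real (Suc n))" using that by simp
    then show ?thesis unfolding An_def by (blast intro: order_trans)
  qed
  have An_A: "An n \<subseteq> A" for n by (auto simp: An_def)
  have R_inf: "infdist b F \<le> inverse (real (Suc n))" if "b \<in> R n" for b n
    using that by (auto simp: R_def An_def)
  have R_An: "R k \<subseteq> An n" if "k < n" for k n
    using An_mono[of "Suc k" n] that by (auto simp: R_def)
  have half: "(\<Sum>j<n. ?\<mu> (R (2*j+i))) \<le> ?\<mu> (\<Union>j<n. R (2*j+i))" for n i
  proof (induction n)
    case (Suc n)
    have "(\<Sum>j<Suc n. ?\<mu> (R (2*j+i))) \<le> ?\<mu> (\<Union>j<n. R (2*j+i)) + ?\<mu> (R (2*n+i))"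
      using Suc by (auto intro: add_right_mono)
    also have "\<dots> \<le> ?\<mu> ((\<Union>j<n. R (2*j+i)) \<union> R (2*n+i))"
    proof (cases n)
      case 0
      then show ?thesis by simp
    next
      case (Suc l)
      \<comment> \<open>The earlier layers end with \<open>R (2*l+i)\<close>, so all lie in
        \<open>An (2*l+1+i)\<close>; the skipped layer \<open>R (2*l+1+i)\<close> provides the gap
        to the new one.\<close>
      show ?thesis
      proof (rule hausdorff_outer_separated[OF _ sepd[of "2*l+1+i"]])
        fix a b assume a: "a \<in> (\<Union>j<n. R (2*j+i))" and b: "b \<in> R (2*n+i)"
        have "a \<in> An (2*l+1+i)"
        proof -
          obtain j where j: "j < n" "a \<in> R (2*j+i)" using a by blast
          moreover have "2*j+i < 2*l+1+i" using j Suc by linarith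
          ultimately show ?thesis using R_An by blast
        qed
        moreover have "infdist b F \<le> inverse (real (Suc (Suc (2*l+1+i))))"
          using R_inf[OF b] Suc by simp
        ultimately show "inverse (real (Suc (2*l+1+i))) - inverse (real (Suc (Suc (2*l+1+i)))) \<le> dist a b"
          by (rule sep)
      qed
    qed
    also have "(\<Union>j<n. R (2*j+i)) \<union> R (2*n+i) = (\<Union>j<Suc n. R (2*j+i))"
      by (auto simp: less_Suc_eq)
    finally show ?case .
  qed simp
  have half': "(\<Sum>j<n. ?\<mu> (R (2*j+i))) \<le> ?\<mu> A" for n i
    by (rule order_trans[OF half], rule hausdorff_outer_mono) (use An_A in \<open>auto simp: R_def\<close>)
  have tot: "(\<Sum>k<n. ?\<mu> (R k)) \<le> 2 * ?\<mu> A" for n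
  proof -
    have "(\<Sum>k<2*n. ?\<mu> (R k)) = (\<Sum>j<n. ?\<mu> (R (2*j+0))) + (\<Sum>j<n. ?\<mu> (R (2*j+1)))" for n
      by (induction n) (auto simp: algebra_simps)
    then have "(\<Sum>k<2*n. ?\<mu> (R k)) \<le> ?\<mu> A + ?\<mu> A"
      using add_mono[OF half'[of 0 n] half'[of 1 n]] by simp
    moreover have "(\<Sum>k<n. ?\<mu> (R k)) \<le> (\<Sum>k<2*n. ?\<mu> (R k))"
      by (rule sum_mono2) auto
    ultimately show ?thesis by (simp add: mult_2)
  qed
  have cover: "A - F \<subseteq> An n \<union> (\<Union>k. R (k + n))" for n
  proof
    fix x assume x: "x \<in> A - F"
    then have "infdist x F > 0" using F False infdist_pos_not_in_closed by blast
    then obtain l where l: "inverse (real (Suc l)) < infdist x F" using reals_Archimedean by blast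
    then have "x \<in> An (l + n)" using x An_mono[of l "l+n"] by (auto simp: An_def)
    moreover have "x \<in> An (k + n) \<Longrightarrow> x \<in> An n \<union> (\<Union>k. R (k + n))" for k
      by (induction k) (auto simp: R_def)
    ultimately show "x \<in> An n \<union> (\<Union>k. R (k + n))" by blast
  qed
  show ?thesis
  proof (rule ennreal_le_epsilon)
    fix e :: real assume fin: "?\<mu> A < top" and e: "e > 0"
    have "(\<Sum>k. ?\<mu> (R k)) \<le> 2 * ?\<mu> A"
      by (rule suminf_le_const[OF summableI]) (use tot in auto)
    then have sfin: "(\<Sum>k. ?\<mu> (R k)) < top" using fin by (auto simp: ennreal_mult_less_top intro: le_less_trans)
    then have Rfin: "?\<mu> (R k) < top" for k by (rule ennreal_suminf_lessD)
    define r where "r k = enn2real (?\<mu> (R k))" for k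
    have r: "?\<mu> (R k) = ennreal (r k)" "r k \<ge> 0" for k using Rfin[of k] by (auto simp: r_def)
    have sr: "summable r"
    proof (rule summable_suminf_not_top)
      show "(\<Sum>k. ennreal (r k)) \<noteq> top" using sfin unfolding r(1) by (rule less_imp_neq)
    qed (rule r(2))
    \<comment> \<open>From \<open>n\<close> on the layers contribute less than \<open>e\<close>,
      while \<open>An n\<close> has positive distance from \<open>F\<close>, so its measure and that
      of \<open>A \<inter> F\<close> add up.\<close>
    then obtain n where n: "norm (\<Sum>i. r (i + n)) < e" using suminf_exist_split[OF e] by blast
    have "(\<Sum>k. ?\<mu> (R (k + n))) = ennreal (\<Sum>k. r (k + n))"
      unfolding r(1) by (rule suminf_ennreal2[OF r(2)]) (use sr in \<open>simp add: summable_iff_shift\<close>)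
    also have "\<dots> \<le> ennreal e" using n by (intro ennreal_leI) simp
    finally have tail: "(\<Sum>k. ?\<mu> (R (k + n))) \<le> ennreal e" .
    have "?\<mu> (A - F) \<le> ?\<mu> (An n \<union> (\<Union>k. R (k + n)))" by (rule hausdorff_outer_mono[OF cover])
    also have "\<dots> \<le> ?\<mu> (An n) + ?\<mu> (\<Union>k. R (k + n))" by (rule hausdorff_outer_Un)
    also have "\<dots> \<le> ?\<mu> (An n) + (\<Sum>k. ?\<mu> (R (k + n)))"
      by (intro add_left_mono hausdorff_outer_subadditive)
    also have "\<dots> \<le> ?\<mu> (An n) + e" by (intro add_left_mono tail)
    finally have "?\<mu> (A \<inter> F) + ?\<mu> (A - F) \<le> ?\<mu> (A \<inter> F) + (?\<mu> (An n) + e)"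
      by (rule add_left_mono)
    also have "\<dots> = ?\<mu> (An n) + ?\<mu> (A \<inter> F) + e" by (simp add: ac_simps)
    also have "\<dots> \<le> ?\<mu> (An n \<union> A \<inter> F) + e"
    proof (intro add_right_mono hausdorff_outer_separated[OF _ sepd[of n]] sep)
      show "infdist b F \<le> inverse (real (Suc (Suc n)))" if "b \<in> A \<inter> F" for b
        using that by simp
    qed
    also have "\<dots> \<le> ?\<mu> A + e"
      using An_A[of n] by (intro add_right_mono hausdorff_outer_mono) auto
    finally show "?\<mu> (A \<inter> F) + ?\<mu> (A - F) \<le> ?\<mu> A + e" .
  qed
qed simp

text \<open>The Caratheodory-measurable sets form a sigma-algebra on which the outer measure is
  countably additive. The splitting by closed sets puts these, and hence all Borel sets, into
  it.\<close>

lemma measure_space_hausdorff: "measure_space UNIV (sets (borel :: 'a::euclidean_space measure)) (hausdorff_outer m)"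
proof -
  interpret P: sigma_algebra "UNIV :: 'a set" "Pow UNIV" by (rule sigma_algebra_Pow)
  let ?L = "lambda_system UNIV (Pow UNIV) (hausdorff_outer m) :: 'a set set"
  have ms: "measure_space UNIV ?L (hausdorff_outer m)"
    by (rule P.caratheodory_lemma[OF outer_measure_space_hausdorff])
  then interpret L: sigma_algebra UNIV ?L by (simp add: measure_space_def)
  have "F \<in> ?L" if "closed F" for F :: "'a set"
  proof -
    have "hausdorff_outer m (F \<inter> A) + hausdorff_outer m ((UNIV - F) \<inter> A) = hausdorff_outer m A" for A
    proof (rule antisym)
      have "(UNIV - F) \<inter> A = A - F" "F \<inter> A = A \<inter> F" by auto
      then show "hausdorff_outer m (F \<inter> A) + hausdorff_outer m ((UNIV - F) \<inter> A) \<le> hausdorff_outer m A"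
        using hausdorff_outer_closed_split[OF that, of m A] by simp
      have "A = F \<inter> A \<union> (UNIV - F) \<inter> A" by auto
      then show "hausdorff_outer m A \<le> hausdorff_outer m (F \<inter> A) + hausdorff_outer m ((UNIV - F) \<inter> A)"
        using hausdorff_outer_Un by metis
    qed
    then show ?thesis by (simp add: lambda_system_def)
  qed
  then have "sigma_sets UNIV (Collect closed) \<subseteq> ?L"
    by (intro L.sigma_sets_subset) auto
  then have "sets (borel :: 'a measure) \<subseteq> ?L"
    by (simp add: borel_eq_closed)
  moreover have "sigma_algebra UNIV (sets (borel :: 'a measure))"
    using sets.sigma_algebra_axioms[of "borel :: 'a measure"] by simp
  ultimately show ?thesis using measure_down[OF ms] by blast
qed

lemma space_hausdorff_measure [simp]: "space (hausdorff_measure m) = UNIV"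
  and sets_hausdorff_measure [simp]: "sets (hausdorff_measure m) = sets (borel :: 'a::euclidean_space measure)"
  unfolding hausdorff_measure_def
  using sets.sigma_sets_eq[of "borel :: 'a measure"] by (simp_all add: sets_measure_of)

lemma emeasure_hausdorff_measure:
  assumes "A \<in> sets (borel :: 'a::euclidean_space measure)"
  shows "emeasure (hausdorff_measure m) A = hausdorff_outer m A"
proof (rule emeasure_measure_of[OF hausdorff_measure_def[unfolded hausdorff_outer_def[symmetric]]])
  show "positive (sets (hausdorff_measure m)) (hausdorff_outer m :: 'a set \<Rightarrow> ennreal)"
    "countably_additive (sets (hausdorff_measure m)) (hausdorff_outer m :: 'a set \<Rightarrow> ennreal)"
    using measure_space_hausdorff[of m, where 'a='a] by (simp_all add: measure_space_def)
qed (use assms in auto)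

text \<open>An isometry maps covers to covers with the same gauges. The opposite inequality will
  come from applying this to the inverse map.\<close>

lemma hausdorff_outer_isometry:
  fixes f :: "'a::euclidean_space \<Rightarrow> 'a"
  assumes iso: "\<And>x y. dist (f x) (f y) = dist x y"
  shows "hausdorff_outer m (f ` A) \<le> hausdorff_outer m A"
proof -
  have diam: "diameter (f ` C) = diameter C" for C
  proof -
    have "(\<lambda>(x, y). dist x y) ` (f ` C \<times> f ` C) = (\<lambda>(x, y). dist x y) ` (C \<times> C)"
      by (force simp: iso image_iff)
    then show ?thesis by (simp add: diameter_def)
  qed
  have bdd: "bounded (f ` C)" if C: "bounded C" for C
  proof -
    obtain a e where "\<forall>y\<in>C. dist a y \<le> e" using C unfolding bounded_def by blast
    then have "\<forall>y\<in>f ` C. dist (f a) y \<le> e" by (auto simp: iso)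
    then show ?thesis unfolding bounded_def by blast
  qed
  have gauge: "hausdorff_gauge m (f ` C) = hausdorff_gauge m C" for C
    by (simp add: hausdorff_gauge_def diam)
  have "hausdorff_content m \<delta> (f ` A) \<le> hausdorff_content m \<delta> A" for \<delta>
    unfolding hausdorff_content_alt[of m \<delta> A]
  proof (rule INF_greatest)
    fix C assume "C \<in> hausdorff_covers \<delta> A"
    then have "(\<lambda>i. f ` C i) \<in> hausdorff_covers \<delta> (f ` A)"
      by (fastforce simp: hausdorff_covers_def diam bdd)
    from hausdorff_content_le[OF this, of m]
    show "hausdorff_content m \<delta> (f ` A) \<le> (\<Sum>i. hausdorff_gauge m (C i))"
      by (simp add: gauge)
  qed
  then show ?thesis unfolding hausdorff_outer_def by (auto intro!: SUP_mono)
qed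

section \<open>Finiteness and positivity of the Hausdorff measure of the torus\<close>

lemma power_diff_le_linear:
  fixes c :: real
  assumes "0 \<le> c"
  shows "\<exists>K\<ge>0. \<forall>a b. 0 \<le> b \<longrightarrow> b \<le> a \<longrightarrow> a \<le> c \<longrightarrow> a ^ d - b ^ d \<le> K * (a - b)"
proof (induction d)
  case (Suc d)
  then obtain K where K: "K \<ge> 0" "\<And>a b. 0 \<le> b \<Longrightarrow> b \<le> a \<Longrightarrow> a \<le> c \<Longrightarrow> a ^ d - b ^ d \<le> K * (a - b)"
    by blast
  have "a ^ Suc d - b ^ Suc d \<le> (c * K + c ^ d) * (a - b)" if ab: "0 \<le> b" "b \<le> a" "a \<le> c" for a b
  proof -
    have "a ^ Suc d - b ^ Suc d = a * (a ^ d - b ^ d) + (a - b) * b ^ d" by (simp add: algebra_simps)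
    also have "\<dots> \<le> c * (K * (a - b)) + (a - b) * c ^ d"
      using ab K by (intro add_mono mult_mono power_mono) (auto intro: power_mono)
    finally show ?thesis by (simp add: algebra_simps)
  qed
  then show ?case using K(1) assms by (intro exI[of _ "c * K + c ^ d"]) auto
qed (auto intro: exI[of _ 0])

text \<open>Powers are Lipschitz on a bounded interval, so the difference of two ball volumes is
  linear in the thickness; \<open>\<eta> \<le> R\<close> keeps the inner radius nonnegative.\<close>

lemma emeasure_shell_le:
  assumes R: "0 < R"
  shows "\<exists>K\<ge>0. \<forall>\<eta>. 0 < \<eta> \<longrightarrow> \<eta> \<le> R \<longrightarrow>
     emeasure lborel (cball (0::'a::euclidean_space) (R + \<eta>) - ball 0 (R - \<eta>)) \<le> ennreal (K * \<eta>)"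
proof -
  let ?d = "DIM('a)"
  obtain K where K: "K \<ge> 0" "\<And>a b. 0 \<le> b \<Longrightarrow> b \<le> a \<Longrightarrow> a \<le> 2 * R \<Longrightarrow> a ^ ?d - b ^ ?d \<le> K * (a - b)"
    using power_diff_le_linear[of "2 * R" ?d] R by auto
  have "emeasure lborel (cball (0::'a) (R + \<eta>) - ball 0 (R - \<eta>)) \<le> ennreal (2 * unit_ball_vol ?d * K * \<eta>)"
    if \<eta>: "0 < \<eta>" "\<eta> \<le> R" for \<eta>
  proof -
    have "emeasure lborel (cball (0::'a) (R + \<eta>) - ball 0 (R - \<eta>))
        = emeasure lborel (cball (0::'a) (R + \<eta>)) - emeasure lborel (ball (0::'a) (R - \<eta>))"
      using \<eta> by (intro emeasure_Diff) (auto simp: emeasure_ball)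
    also have "\<dots> = ennreal (unit_ball_vol ?d * ((R + \<eta>) ^ ?d - (R - \<eta>) ^ ?d))"
      using \<eta> R by (simp add: emeasure_ball emeasure_cball ennreal_minus right_diff_distrib)
    also have "\<dots> \<le> ennreal (unit_ball_vol ?d * (K * (2 * \<eta>)))"
      using K(2)[of "R - \<eta>" "R + \<eta>"] \<eta> by (intro ennreal_leI mult_left_mono) auto
    finally show ?thesis by (simp add: mult_ac)
  qed
  then show ?thesis using K(1) by (intro exI[of _ "2 * unit_ball_vol ?d * K"]) auto
qed

lemma hausdorff_content_finite_cover:
  assumes F: "finite F" and cov: "M \<subseteq> (\<Union>f\<in>F. cball f \<eta>)" and "\<eta> > 0"
  shows "hausdorff_content m (2 * \<eta>) M \<le> ennreal (real (card F) * (unit_ball_vol (real m) * \<eta> ^ m))"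
proof -
  obtain h where h: "bij_betw h {0..<card F} F" using ex_bij_betw_nat_finite[OF F] by blast
  define C where "C i = (if i < card F then cball (h i) \<eta> else {})" for i
  have "(\<Union>i. C i) = (\<Union>f\<in>F. cball f \<eta>)"
    using h unfolding C_def bij_betw_def by (auto split: if_splits) (metis atLeast0LessThan imageE lessThan_iff)
  then have "C \<in> hausdorff_covers (2 * \<eta>) M"
    using cov \<open>\<eta> > 0\<close> by (auto simp: hausdorff_covers_def C_def)
  from hausdorff_content_le[OF this, of m]
  have "hausdorff_content m (2 * \<eta>) M \<le> (\<Sum>i. hausdorff_gauge m (C i))" .
  also have "\<dots> = (\<Sum>i<card F. hausdorff_gauge m (C i))"
    by (rule suminf_finite) (auto simp: C_def)
  also have "\<dots> = (\<Sum>i<card F. ennreal (unit_ball_vol (real m) * \<eta> ^ m))"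
    using \<open>\<eta> > 0\<close> by (intro sum.cong) (auto simp: C_def hausdorff_gauge_def)
  also have "\<dots> = ennreal (real (card F) * (unit_ball_vol (real m) * \<eta> ^ m))"
    using \<open>\<eta> > 0\<close> by (simp add: ennreal_mult ennreal_of_nat_eq_real_of_nat)
  finally show ?thesis .
qed

text \<open>A maximal \<open>\<eta>\<close>-separated subset has \<open>O(\<eta>\<^sup>-\<^sup>m)\<close> points, because the balls of radius \<open>\<eta>/2\<close>
  around them are disjoint and lie in a shell of codimension two, of volume \<open>O(\<eta>\<^sup>2)\<close>.\<close>

lemma hausdorff_outer_clifford_torus_finite:
  assumes R: "0 < R1" "0 < R2" and m: "m + 2 = DIM('a) + DIM('b)"
  shows "hausdorff_outer m (clifford_torus R1 R2 :: ('a::euclidean_space \<times> 'b::euclidean_space) set) < top"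
proof -
  let ?M = "clifford_torus R1 R2 :: ('a \<times> 'b) set"
  let ?S1 = "\<lambda>\<eta>. cball (0::'a) (R1 + \<eta>) - ball 0 (R1 - \<eta>)"
  let ?S2 = "\<lambda>\<eta>. cball (0::'b) (R2 + \<eta>) - ball 0 (R2 - \<eta>)"
  let ?D = "DIM('a \<times> 'b)"
  obtain K1 where K1: "K1 \<ge> 0" "\<And>\<eta>. 0 < \<eta> \<Longrightarrow> \<eta> \<le> R1 \<Longrightarrow> emeasure lborel (?S1 \<eta>) \<le> ennreal (K1 * \<eta>)"
    using emeasure_shell_le[OF R(1), where 'a='a] by blast
  obtain K2 where K2: "K2 \<ge> 0" "\<And>\<eta>. 0 < \<eta> \<Longrightarrow> \<eta> \<le> R2 \<Longrightarrow> emeasure lborel (?S2 \<eta>) \<le> ennreal (K2 * \<eta>)"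
    using emeasure_shell_le[OF R(2), where 'a='b] by blast
  \<comment> \<open>The shell volume \<open>K1 * K2 * \<eta>^2\<close> divided by the volume of a
    ball of radius \<open>\<eta>/2\<close>, times \<open>\<eta>^m\<close>; the powers of
    \<open>\<eta>\<close> cancel since \<open>m + 2\<close> is the ambient dimension.\<close>
  define K where "K = K1 * K2 * 2 ^ ?D / unit_ball_vol ?D"
  have main: "hausdorff_content m (2 * \<eta>) ?M \<le> ennreal (K * unit_ball_vol (real m))"
    if \<eta>: "0 < \<eta>" "\<eta> \<le> R1" "\<eta> \<le> R2" for \<eta>
  proof -
    define Q where "Q F \<longleftrightarrow> finite F \<and> F \<subseteq> ?M \<and> (\<forall>x\<in>F. \<forall>y\<in>F. x \<noteq> y \<longrightarrow> \<eta> \<le> dist x y)" for F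
    have bnd: "real (card F) * \<eta> ^ m \<le> K" if F: "Q F" for F
    proof -
      let ?v = "unit_ball_vol ?D * (\<eta> / 2) ^ ?D"
      have "(\<Union>f\<in>F. ball f (\<eta>/2)) \<subseteq> ?S1 \<eta> \<times> ?S2 \<eta>"
      proof
        fix z assume "z \<in> (\<Union>f\<in>F. ball f (\<eta>/2))"
        then obtain f where f: "f \<in> F" "z \<in> ball f (\<eta>/2)" by blast
        obtain a b where ab: "f = (a, b)" by (cases f)
        obtain c d where cd: "z = (c, d)" by (cases z)
        have n: "norm a = R1" "norm b = R2" "dist a c < \<eta>" "dist b d < \<eta>"
          using F f ab cd dist_fst_le[of "(a,b)" "(c,d)"] dist_snd_le[of "(a,b)" "(c,d)"] \<eta>
          by (auto simp: Q_def clifford_torus_def simp del: dist_fst_le dist_snd_le)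
        have "\<bar>norm a - norm c\<bar> < \<eta>" "\<bar>norm b - norm d\<bar> < \<eta>"
          using n norm_triangle_ineq3[of a c] norm_triangle_ineq3[of b d] by (auto simp: dist_norm)
        then show "z \<in> ?S1 \<eta> \<times> ?S2 \<eta>" using n cd by auto
      qed
      then have "emeasure lborel (\<Union>f\<in>F. ball f (\<eta>/2)) \<le> emeasure lborel (?S1 \<eta> \<times> ?S2 \<eta>)"
        by (intro emeasure_mono) (auto intro: borel_Times)
      also have "\<dots> = emeasure lborel (?S1 \<eta>) * emeasure lborel (?S2 \<eta>)"
        by (subst lborel_prod[symmetric], rule lborel.emeasure_pair_measure_Times) auto
      also have "\<dots> \<le> ennreal (K1 * \<eta>) * ennreal (K2 * \<eta>)"
        using K1(2) K2(2) \<eta> by (intro mult_mono) auto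
      also have "\<dots> = ennreal (K1 * K2 * \<eta>^2)"
        using K1 K2 \<eta> by (simp add: ennreal_mult[symmetric] power2_eq_square mult_ac)
      also have "emeasure lborel (\<Union>f\<in>F. ball f (\<eta>/2)) = (\<Sum>f\<in>F. emeasure lborel (ball f (\<eta>/2)))"
      proof (rule sum_emeasure[symmetric])
        show "disjoint_family_on (\<lambda>f. ball f (\<eta>/2)) F"
          unfolding disjoint_family_on_def
        proof (intro ballI impI)
          fix x y assume "x \<in> F" "y \<in> F" "x \<noteq> y"
          then have "\<eta> \<le> dist x y" using F by (auto simp: Q_def)
          then have "\<not> (dist x z < \<eta>/2 \<and> dist y z < \<eta>/2)" for z
            using dist_triangle2[of x y z] by auto
          then show "ball x (\<eta>/2) \<inter> ball y (\<eta>/2) = {}" by auto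
        qed
      qed (use F in \<open>auto simp: Q_def\<close>)
      also have "\<dots> = ennreal (real (card F) * ?v)"
        using \<eta> by (simp add: emeasure_ball ennreal_mult ennreal_of_nat_eq_real_of_nat)
      finally have "real (card F) * ?v \<le> K1 * K2 * \<eta>^2"
        using K1 K2 by (subst (asm) ennreal_le_iff) auto
      moreover have "\<eta> ^ ?D = \<eta> ^ m * \<eta>^2" using m by (simp add: power_add[symmetric])
      ultimately have "(real (card F) * \<eta> ^ m) * (\<eta>^2 * unit_ball_vol ?D / 2 ^ ?D) \<le> K1 * K2 * \<eta>^2"
        by (simp add: power_divide mult_ac)
      then have "(real (card F) * \<eta> ^ m) * (unit_ball_vol ?D / 2 ^ ?D) * \<eta>^2 \<le> K1 * K2 * \<eta>^2"
        by (simp add: mult_ac)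
      then have "(real (card F) * \<eta> ^ m) * (unit_ball_vol ?D / 2 ^ ?D) \<le> K1 * K2"
        by (rule mult_right_le_imp_le) (use \<eta> in simp)
      then have "real (card F) * \<eta> ^ m \<le> K1 * K2 / (unit_ball_vol ?D / 2 ^ ?D)"
        by (subst pos_le_divide_eq) auto
      then show ?thesis by (simp add: K_def)
    qed
    \<comment> \<open>The bound \<open>bnd\<close> limits the cardinality, so a separated set with
      the most points exists; no point can be added to it, hence its closed
      \<open>\<eta>\<close>-balls cover the torus.\<close>
    have "\<exists>F. Q F \<and> (\<forall>G. Q G \<longrightarrow> card G \<le> card F)"
    proof (rule Lattices_Big.ex_has_greatest_nat)
      show "Q {}" by (simp add: Q_def)
      show "\<forall>G. Q G \<longrightarrow> card G < Suc (nat \<lceil>K / \<eta> ^ m\<rceil>)"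
      proof (intro allI impI)
        fix G assume "Q G"
        from bnd[OF this] have "real (card G) \<le> K / \<eta> ^ m" using \<eta> by (simp add: pos_le_divide_eq)
        then show "card G < Suc (nat \<lceil>K / \<eta> ^ m\<rceil>)" by linarith
      qed
    qed
    then obtain F where F: "Q F" "\<And>G. Q G \<Longrightarrow> card G \<le> card F" by blast
    have "?M \<subseteq> (\<Union>f\<in>F. cball f \<eta>)"
    proof (rule ccontr)
      assume "\<not> ?thesis"
      then obtain x where x: "x \<in> ?M" "\<And>f. f \<in> F \<Longrightarrow> \<eta> < dist f x" by fastforce
      then have "Q (insert x F)" using F(1) by (auto simp: Q_def dist_commute less_imp_le)
      moreover have "x \<notin> F" using x(2)[of x] \<eta> by auto
      ultimately show False using F(2)[of "insert x F"] F(1) by (auto simp: Q_def)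
    qed
    from hausdorff_content_finite_cover[OF _ this \<eta>(1), of m] F(1)
    have "hausdorff_content m (2 * \<eta>) ?M \<le> ennreal (real (card F) * (unit_ball_vol (real m) * \<eta> ^ m))"
      by (simp add: Q_def)
    also have "\<dots> \<le> ennreal (K * unit_ball_vol (real m))"
      using mult_right_mono[OF bnd[OF F(1)], of "unit_ball_vol (real m)"]
      by (intro ennreal_leI) (simp add: mult_ac)
    finally show ?thesis .
  qed
  have "hausdorff_content m \<delta> ?M \<le> ennreal (K * unit_ball_vol (real m))" if "\<delta> > 0" for \<delta>
  proof -
    define \<eta> where "\<eta> = min (\<delta>/2) (min R1 R2)"
    have "0 < \<eta>" "\<eta> \<le> R1" "\<eta> \<le> R2" "2 * \<eta> \<le> \<delta>" using that R by (auto simp: \<eta>_def)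
    then show ?thesis using main hausdorff_content_antimono order_trans by blast
  qed
  then have "hausdorff_outer m ?M \<le> ennreal (K * unit_ball_vol (real m))"
    unfolding hausdorff_outer_def by (intro SUP_least) auto
  then show ?thesis using ennreal_less_top le_less_trans by blast
qed

text \<open>The coordinate along \<open>b1\<close> is solved from the equation of the sphere; the
  bound on the others keeps the sum of their squares below \<open>R\<^sup>2\<close>.\<close>

lemma sphere_point_with_coordinates:
  fixes x :: "'a::euclidean_space"
  assumes b1: "b1 \<in> Basis" and R: "0 < R" and x: "\<And>b. b \<in> Basis \<Longrightarrow> \<bar>x \<bullet> b\<bar> \<le> R / DIM('a)"
  shows "\<exists>x'\<in>sphere 0 R. \<forall>b\<in>Basis - {b1}. x' \<bullet> b = x \<bullet> b"
proof -
  define s where "s = (\<Sum>b\<in>Basis - {b1}. (x \<bullet> b)\<^sup>2)"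
  have "s \<le> (\<Sum>b\<in>Basis - {b1}. (R / DIM('a))\<^sup>2)"
    unfolding s_def using x R by (intro sum_mono abs_le_square_iff[THEN iffD1]) auto
  also have "\<dots> \<le> DIM('a) * (R / DIM('a))\<^sup>2"
    by (simp add: card_Diff_singleton b1 mult_right_mono)
  also have "\<dots> \<le> R\<^sup>2"
    by (simp add: power2_eq_square divide_le_eq) (use DIM_positive[where 'a='a] R in \<open>simp add: mult_le_cancel_left1 Suc_leI\<close>)
  finally have s: "s \<le> R\<^sup>2" .
  define x' where "x' = (\<Sum>b\<in>Basis. (if b = b1 then sqrt (R\<^sup>2 - s) else x \<bullet> b) *\<^sub>R b)"
  have c: "x' \<bullet> b = (if b = b1 then sqrt (R\<^sup>2 - s) else x \<bullet> b)" if "b \<in> Basis" for b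
    unfolding x'_def using that by (simp add: inner_sum_left_Basis)
  have "x' \<bullet> x' = (\<Sum>b\<in>Basis. (x' \<bullet> b)\<^sup>2)"
    by (subst euclidean_inner) (simp add: power2_eq_square)
  also have "\<dots> = (x' \<bullet> b1)\<^sup>2 + (\<Sum>b\<in>Basis - {b1}. (x' \<bullet> b)\<^sup>2)"
    using b1 by (simp add: sum.remove)
  also have "(\<Sum>b\<in>Basis - {b1}. (x' \<bullet> b)\<^sup>2) = s"
    unfolding s_def by (rule sum.cong) (auto simp: c)
  also have "(x' \<bullet> b1)\<^sup>2 = R\<^sup>2 - s" using c[OF b1] s by simp
  finally have "x' \<bullet> x' = R\<^sup>2" by simp
  then have "norm x' = R" using R by (simp add: norm_eq_sqrt_inner)
  then show ?thesis using c by (intro bexI[of _ x']) auto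
qed

text \<open>A set of diameter \<open>d\<close> lies below a box with \<open>m\<close> sides of length \<open>2d\<close> and two fixed sides, and
  the boxes belonging to a cover of the torus fill a fixed cube, since the torus projects onto the
  cube's \<open>m\<close>-dimensional face.\<close>

lemma hausdorff_outer_clifford_torus_pos:
  assumes R: "0 < R1" "0 < R2" and m: "m + 2 = DIM('a) + DIM('b)"
  shows "0 < hausdorff_outer m (clifford_torus R1 R2 :: ('a::euclidean_space \<times> 'b::euclidean_space) set)"
proof -
  let ?M = "clifford_torus R1 R2 :: ('a \<times> 'b) set"
  obtain b1 :: 'a where b1: "b1 \<in> Basis" using nonempty_Basis by blast
  obtain b2 :: 'b where b2: "b2 \<in> Basis" using nonempty_Basis by blast
  let ?B = "{(b1, 0), (0, b2)} :: ('a \<times> 'b) set"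
  have B: "?B \<subseteq> Basis" "(b1, 0) \<noteq> (0, b2)" using b1 b2 by (auto simp: Basis_prod_def nonzero_Basis)
  define \<rho> where "\<rho> = min (R1 / DIM('a)) (R2 / DIM('b))"
  have \<rho>: "\<rho> > 0" using R by (simp add: \<rho>_def)
  let ?Z = "cbox (- (\<rho> *\<^sub>R One)) (\<rho> *\<^sub>R One) :: ('a \<times> 'b) set"
  have Z: "z \<in> ?Z \<longleftrightarrow> (\<forall>b\<in>Basis. \<bar>z \<bullet> b\<bar> \<le> \<rho>)" for z
    by (auto simp: mem_box abs_le_iff)
  have proj: "\<exists>z'\<in>?M. \<forall>b\<in>Basis - ?B. z' \<bullet> b = z \<bullet> b" if "z \<in> ?Z" for z
  proof -
    obtain x y where xy: "z = (x, y)" by (cases z)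
    have "\<bar>x \<bullet> b\<bar> \<le> R1 / DIM('a)" if "b \<in> Basis" for b
    proof -
      have "(b, 0) \<in> (Basis :: ('a \<times> 'b) set)" using that by (simp add: Basis_prod_def)
      then show ?thesis using \<open>z \<in> ?Z\<close> unfolding Z xy by (force simp: \<rho>_def)
    qed
    from sphere_point_with_coordinates[OF b1 R(1) this]
    obtain x' where x': "x' \<in> sphere 0 R1" "\<forall>b \<in> Basis - {b1}. x' \<bullet> b = x \<bullet> b" by blast
    have "\<bar>y \<bullet> b\<bar> \<le> R2 / DIM('b)" if "b \<in> Basis" for b
    proof -
      have "(0, b) \<in> (Basis :: ('a \<times> 'b) set)" using that by (simp add: Basis_prod_def)
      then show ?thesis using \<open>z \<in> ?Z\<close> unfolding Z xy by (force simp: \<rho>_def)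
    qed
    from sphere_point_with_coordinates[OF b2 R(2) this]
    obtain y' where y': "y' \<in> sphere 0 R2" "\<forall>b \<in> Basis - {b2}. y' \<bullet> b = y \<bullet> b" by blast
    show ?thesis
      using x' y' xy by (intro bexI[of _ "(x', y')"]) (auto simp: clifford_torus_def Basis_prod_def)
  qed
  \<comment> \<open>Ratio of the volume of the box built from a set of diameter \<open>d\<close>,
    which is \<open>(2 * \<rho>)\<^sup>2 * (2 * d) ^ m\<close>, to the gauge of that set.\<close>
  define \<kappa> where "\<kappa> = (2 * \<rho>)\<^sup>2 * 4 ^ m / unit_ball_vol (real m)"
  have \<kappa>: "\<kappa> > 0" using \<rho> by (simp add: \<kappa>_def)
  define \<zeta> where "\<zeta> = (2 * \<rho>) ^ (m + 2)"
  have "emeasure lborel ?Z = (\<Prod>b\<in>Basis. (\<rho> *\<^sub>R One - - (\<rho> *\<^sub>R One :: 'a \<times> 'b)) \<bullet> b)"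
    using \<rho> by (intro emeasure_lborel_cbox) auto
  also have "(\<Prod>b\<in>Basis. (\<rho> *\<^sub>R One - - (\<rho> *\<^sub>R One :: 'a \<times> 'b)) \<bullet> b) = (\<Prod>b\<in>(Basis :: ('a \<times> 'b) set). 2 * \<rho>)"
    by (rule prod.cong) (simp_all add: inner_add_left)
  also have "\<dots> = \<zeta>" using m by (simp add: \<zeta>_def)
  finally have vZ: "emeasure lborel ?Z = ennreal \<zeta>" .
  \<comment> \<open>A single scale bounds the supremum over all scales from below, so covers with
    diameters at most 1 suffice.\<close>
  have key: "ennreal (\<zeta> / \<kappa>) \<le> (\<Sum>i. hausdorff_gauge m (C i))" if C: "C \<in> hausdorff_covers 1 ?M" for C
  proof -
    have "\<exists>c. \<forall>i. C i \<noteq> {} \<longrightarrow> c i \<in> C i" by (rule exI[of _ "\<lambda>i. SOME x. x \<in> C i"]) (auto intro: someI)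
    then obtain c where c: "\<And>i. C i \<noteq> {} \<Longrightarrow> c i \<in> C i" by blast
    define lo where "lo i = (\<Sum>b\<in>Basis. (if b \<in> ?B then -\<rho> else c i \<bullet> b - diameter (C i)) *\<^sub>R b)" for i
    define hi where "hi i = (\<Sum>b\<in>Basis. (if b \<in> ?B then \<rho> else c i \<bullet> b + diameter (C i)) *\<^sub>R b)" for i
    define T where "T i = (if C i = {} then {} else cbox (lo i) (hi i))" for i
    have lo: "lo i \<bullet> b = (if b \<in> ?B then -\<rho> else c i \<bullet> b - diameter (C i))" if "b \<in> Basis" for i b
      unfolding lo_def using that by (simp add: inner_sum_left_Basis)
    have hi: "hi i \<bullet> b = (if b \<in> ?B then \<rho> else c i \<bullet> b + diameter (C i))" if "b \<in> Basis" for i b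
      unfolding hi_def using that by (simp add: inner_sum_left_Basis)
    have bd: "bounded (C i)" for i using C by (simp add: hausdorff_covers_def)
    have vT: "emeasure lborel (T i) = ennreal \<kappa> * hausdorff_gauge m (C i)" for i
    proof (cases "C i = {}")
      case False
      let ?d = "diameter (C i)"
      have d: "?d \<ge> 0" using diameter_ge_0[OF bd] .
      have "emeasure lborel (T i) = (\<Prod>b\<in>Basis. (hi i - lo i) \<bullet> b)"
        using False \<rho> d by (auto simp: T_def lo hi intro!: emeasure_lborel_cbox)
      also have "(\<Prod>b\<in>Basis. (hi i - lo i) \<bullet> b) = (\<Prod>b\<in>(Basis :: ('a \<times> 'b) set). if b \<in> ?B then 2 * \<rho> else 2 * ?d)"
        by (rule prod.cong) (auto simp: inner_diff_left lo hi)
      also have "\<dots> = (2 * \<rho>)\<^sup>2 * (2 * ?d) ^ m"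
      proof -
        have "Basis \<inter> {b. b \<in> ?B} = ?B" using B by auto
        moreover have "Basis \<inter> - {b. b \<in> ?B} = Basis - ?B" by auto
        moreover have "card (Basis - ?B) = m"
          using B m by (subst card_Diff_subset) auto
        moreover have "card ?B = 2" using B by simp
        ultimately show ?thesis by (subst prod.If_cases) simp_all
      qed
      also have "\<dots> = \<kappa> * (unit_ball_vol (real m) * (?d / 2) ^ m)"
      proof -
        have "(2 * ?d) ^ m = 4 ^ m * (?d / 2) ^ m" by (subst power_mult_distrib[symmetric]) simp
        moreover have "unit_ball_vol (real m) \<noteq> 0" using unit_ball_vol_pos[of "real m"] by linarith
        ultimately show ?thesis by (simp add: \<kappa>_def)
      qed
      finally show ?thesis using False \<kappa> d by (simp add: hausdorff_gauge_def ennreal_mult)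
    qed (simp add: T_def)
    have "?Z \<subseteq> (\<Union>i. T i)"
    proof
      fix z assume z: "z \<in> ?Z"
      obtain z' where z': "z' \<in> ?M" "\<And>b. b \<in> Basis - ?B \<Longrightarrow> z' \<bullet> b = z \<bullet> b" using proj[OF z] by blast
      then obtain i where i: "z' \<in> C i" using C by (auto simp: hausdorff_covers_def)
      have "z \<in> cbox (lo i) (hi i)"
        unfolding mem_box
      proof (intro ballI)
        fix b :: "'a \<times> 'b" assume b: "b \<in> Basis"
        show "lo i \<bullet> b \<le> z \<bullet> b \<and> z \<bullet> b \<le> hi i \<bullet> b"
        proof (cases "b \<in> ?B")
          case True
          then show ?thesis using z b unfolding Z lo[OF b] hi[OF b] by (auto simp: abs_le_iff dest!: bspec[OF _ b])
        next
          case False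
          have "\<bar>(z' - c i) \<bullet> b\<bar> \<le> norm (z' - c i)" by (rule Basis_le_norm[OF b])
          also have "\<dots> \<le> diameter (C i)"
            using diameter_bounded_bound[OF bd i c[of i]] i by (auto simp: dist_norm)
          finally show ?thesis using False z'(2)[of b] b by (simp add: lo hi inner_diff_left abs_le_iff)
        qed
      qed
      then show "z \<in> (\<Union>i. T i)" using i by (auto simp: T_def)
    qed
    then have "ennreal \<zeta> \<le> emeasure lborel (\<Union>i. T i)"
      unfolding vZ[symmetric] by (intro emeasure_mono) (auto simp: T_def)
    also have "\<dots> \<le> (\<Sum>i. emeasure lborel (T i))"
      by (rule emeasure_subadditive_countably) (auto simp: T_def)
    also have "\<dots> = ennreal \<kappa> * (\<Sum>i. hausdorff_gauge m (C i))"
      by (simp add: vT)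
    finally have le: "ennreal \<zeta> \<le> ennreal \<kappa> * (\<Sum>i. hausdorff_gauge m (C i))" .
    show ?thesis
    proof (cases "\<Sum>i. hausdorff_gauge m (C i)")
      case (real s)
      then have "ennreal \<zeta> \<le> ennreal (\<kappa> * s)" using le \<kappa> by (simp add: ennreal_mult)
      then have "\<zeta> \<le> \<kappa> * s" using \<kappa> real by (subst (asm) ennreal_le_iff) auto
      then show ?thesis using \<kappa> real by (simp add: pos_divide_le_eq mult.commute)
    qed simp
  qed
  have "0 < ennreal (\<zeta> / \<kappa>)" using \<kappa> \<rho> by (simp add: \<zeta>_def)
  also have "\<dots> \<le> hausdorff_content m 1 ?M"
    unfolding hausdorff_content_alt by (rule INF_greatest) (rule key)
  also have "\<dots> \<le> hausdorff_outer m ?M" by (rule hausdorff_content_le_outer) simp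
  finally show ?thesis .
qed

section \<open>Geometry of spheres and of the torus\<close>

text \<open>Differentiate the constant function \<open>h y \<bullet> h y\<close>. The map
  \<open>h\<close> will be the identity for a sphere and a coordinate projection for the
  torus.\<close>

lemma tangent_space_norm_orthogonal:
  fixes h :: "'a::euclidean_space \<Rightarrow> 'b::euclidean_space"
  assumes h: "bounded_linear h" and S: "\<And>y. y \<in> S \<Longrightarrow> norm (h y) = R" and z: "z \<in> S"
    and v: "v \<in> tangent_space S z"
  shows "h z \<bullet> h v = 0"
proof -
  have d: "h differentiable (at z within S)"
    using bounded_linear_imp_differentiable[OF h] .
  have "differential S (\<lambda>y. h y \<bullet> h y) z v = h z \<bullet> h v + h v \<bullet> h z"
    using differential_inner[OF v d d] differential_linear[OF v h] by simp
  moreover have "differential S (\<lambda>y. h y \<bullet> h y) z v = differential S (\<lambda>y. R\<^sup>2) z v"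
    using differential_cong[of UNIV z S "\<lambda>y. h y \<bullet> h y" "\<lambda>y. R\<^sup>2"] z S
    by (simp add: power2_norm_eq_inner[symmetric])
  ultimately show ?thesis using differential_const[OF v, of "R\<^sup>2"] by (simp add: inner_commute)
qed

text \<open>The curve is obtained from stereographic projection.\<close>

lemma sphere_curve:
  fixes x v :: "'a::euclidean_space"
  assumes x: "norm x = R" and R: "R > 0" and v: "x \<bullet> v = 0"
  shows "\<exists>\<gamma>::real \<Rightarrow> 'a. (\<forall>T. smooth_on T \<gamma>) \<and> (\<forall>s. norm (\<gamma> s) = R) \<and> \<gamma> 0 = x \<and>
     (\<gamma> has_vector_derivative v) (at 0)"
proof -
  \<comment> \<open>Determined by the length:
    \<open>(1 - k s^2)^2 R^2 + s^2 |v|^2 = (1 + k s^2)^2 R^2\<close> holds for all \<open>s\<close>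
    exactly if \<open>|v|^2 = 4 k R^2\<close>.\<close>
  define k where "k = (norm v)\<^sup>2 / (4 * R\<^sup>2)"
  have k: "k \<ge> 0" by (simp add: k_def)
  have pos: "1 + k * (s * s) > 0" for s using k by (simp add: add_pos_nonneg)
  define \<gamma> where "\<gamma> s = inverse (1 + k * (s * s)) *\<^sub>R ((1 - k * (s * s)) *\<^sub>R x + s *\<^sub>R v)" for s
  have "smooth_on T \<gamma>" for T
    unfolding \<gamma>_def[abs_def] using pos by (intro smooth_on_intros) (auto simp: less_imp_neq[symmetric])
  moreover have "norm (\<gamma> s) = R" for s
  proof -
    have "norm ((1 - k * (s * s)) *\<^sub>R x + s *\<^sub>R v) ^ 2 = (1 - k * (s * s))\<^sup>2 * R\<^sup>2 + s\<^sup>2 * (norm v)\<^sup>2"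
    proof -
      have "x \<bullet> x = R\<^sup>2" using x by (simp add: dot_square_norm)
      then show ?thesis
        unfolding power2_norm_eq_inner
        by (simp add: inner_add_left inner_add_right v inner_commute[of v x] power2_eq_square)
    qed
    also have "(norm v)\<^sup>2 = k * (4 * R\<^sup>2)" using R by (simp add: k_def)
    also have "(1 - k * (s * s))\<^sup>2 * R\<^sup>2 + s\<^sup>2 * (k * (4 * R\<^sup>2)) = ((1 + k * (s * s)) * R)\<^sup>2"
      by (simp add: power2_eq_square algebra_simps)
    finally have "norm ((1 - k * (s * s)) *\<^sub>R x + s *\<^sub>R v) = (1 + k * (s * s)) * R"
      using pos[of s] R by (simp add: power2_eq_iff_nonneg)
    then show ?thesis unfolding \<gamma>_def using pos[of s] by simp
  qed
  moreover have "(\<gamma> has_vector_derivative v) (at 0)"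
    unfolding \<gamma>_def has_vector_derivative_def
    by (auto intro!: derivative_eq_intros simp: fun_eq_iff)
  ultimately show ?thesis by (intro exI[of _ \<gamma>]) (simp add: \<gamma>_def)
qed

lemma tangent_space_sphere:
  fixes u :: "'a::euclidean_space"
  assumes "R > 0" "norm u = R"
  shows "tangent_space (sphere 0 R) u = {w. u \<bullet> w = 0}"
proof
  show "tangent_space (sphere 0 R) u \<subseteq> {w. u \<bullet> w = 0}"
    using tangent_space_norm_orthogonal[OF bounded_linear_ident, of "sphere 0 R" R u] assms by auto
  show "{w. u \<bullet> w = 0} \<subseteq> tangent_space (sphere 0 R) u"
  proof
    fix w assume "w \<in> {w. u \<bullet> w = 0}"
    then obtain \<gamma> :: "real \<Rightarrow> 'a" where "\<forall>T. smooth_on T \<gamma>" "\<forall>s. norm (\<gamma> s) = R" "\<gamma> 0 = u"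
      "(\<gamma> has_vector_derivative w) (at 0)" using sphere_curve[OF assms(2,1), of w] by blast
    then show "w \<in> tangent_space (sphere 0 R) u"
      unfolding tangent_space_def by (auto intro!: exI[of _ 1] exI[of _ \<gamma>])
  qed
qed

lemma orth_proj_eqI:
  assumes T: "subspace T" and w: "w \<in> T" "\<And>u. u \<in> T \<Longrightarrow> (v - w) \<bullet> u = 0"
  shows "orth_proj T v = w"
  unfolding orth_proj_def
proof (rule the_equality)
  fix w' assume w': "w' \<in> T \<and> (\<forall>u\<in>T. (v - w') \<bullet> u = 0)"
  then have "w' - w \<in> T" using T w subspace_diff by blast
  then have "(v - w) \<bullet> (w' - w) = 0" "(v - w') \<bullet> (w' - w) = 0" using w w' by auto
  then have "(w' - w) \<bullet> (w' - w) = 0" by (simp add: inner_diff_left)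
  then show "w' = w" by simp
qed (use w in auto)

text \<open>For \<open>norm u = 1\<close> this is the orthogonal projection to the tangent space of
  the unit sphere at \<open>u\<close>. The formula is linear in \<open>w\<close> and smooth in both
  arguments, unlike the description operator in \<open>orth_proj\<close>.\<close>

definition sphere_proj :: "'a::real_inner \<Rightarrow> 'a \<Rightarrow> 'a" where
  "sphere_proj u w = w - (w \<bullet> u) *\<^sub>R u"

lemma bounded_linear_sphere_proj: "bounded_linear (sphere_proj u)"
  unfolding sphere_proj_def[abs_def]
  by (intro bounded_linear_sub bounded_linear_ident bounded_linear_scaleR_const bounded_linear_inner_left)

lemmas linear_sphere_proj = bounded_linear.linear[OF bounded_linear_sphere_proj]

lemma sphere_proj_inner: "norm u = 1 \<Longrightarrow> sphere_proj u w \<bullet> u = 0"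
  by (simp add: sphere_proj_def inner_diff_left dot_square_norm)

lemma sphere_proj_tangent: "w \<bullet> u = 0 \<Longrightarrow> sphere_proj u w = w"
  by (simp add: sphere_proj_def)

lemma induced_conn_sphere:
  assumes "norm (\<phi> x) = 1"
  shows "induced_conn M (sphere 0 1) \<phi> v V x = sphere_proj (\<phi> x) (differential M V x v)"
  unfolding induced_conn_def tangent_space_sphere[OF zero_less_one assms]
proof (rule orth_proj_eqI)
  show "subspace {w. \<phi> x \<bullet> w = 0}" by (rule subspace_hyperplane)
  show "sphere_proj (\<phi> x) (differential M V x v) \<in> {w. \<phi> x \<bullet> w = 0}"
    using sphere_proj_inner[OF assms] by (simp add: inner_commute)
qed (simp add: sphere_proj_def)

text \<open>Generator of the rotations in the plane of \<open>b\<close> and \<open>c\<close>. Sums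
  over all ordered pairs of basis vectors count every plane twice, whence the factors 2 below and
  the \<open>sqrt 2\<close> in \<open>killing\<close>.\<close>

definition rot_gen :: "'a::euclidean_space \<Rightarrow> 'a \<Rightarrow> 'a \<Rightarrow> 'a" where
  "rot_gen b c x = (x \<bullet> b) *\<^sub>R c - (x \<bullet> c) *\<^sub>R b"

lemma bounded_linear_rot_gen: "bounded_linear (rot_gen b c)"
  unfolding rot_gen_def[abs_def]
  by (intro bounded_linear_sub bounded_linear_scaleR_const bounded_linear_inner_left)

lemma rot_gen_skew: "rot_gen b c x \<bullet> x = 0"
  by (simp add: rot_gen_def inner_diff_left inner_commute[of b x] inner_commute[of c x])

lemma sum_scaleR_product:
  fixes f :: "'i \<Rightarrow> real" and g :: "'j \<Rightarrow> 'v::real_vector"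
  shows "(\<Sum>b\<in>B. \<Sum>c\<in>C. f b *\<^sub>R g c) = sum f B *\<^sub>R sum g C"
  by (simp only: scaleR_sum_left) (simp only: scaleR_sum_right)

lemma sum_Basis_Times_Basis:
  "(\<Sum>(b, c)\<in>Basis \<times> Basis. f b c) = (\<Sum>b\<in>Basis. \<Sum>c\<in>Basis. f b c)"
  by (simp add: sum.cartesian_product)

text \<open>For \<open>v\<close> orthogonal to \<open>x\<close> the right side is
  \<open>2 |x|^2 v\<close>: up to scale, the rotation fields resolve the identity on the tangent
  space of the sphere through \<open>x\<close>.\<close>

lemma rot_gen_sum_expand:
  fixes x v :: "'a::euclidean_space"
  shows "(\<Sum>(b, c)\<in>Basis \<times> Basis. (v \<bullet> rot_gen b c x) *\<^sub>R rot_gen b c x)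
     = 2 *\<^sub>R ((x \<bullet> x) *\<^sub>R v - (x \<bullet> v) *\<^sub>R x)"
proof -
  have "(v \<bullet> rot_gen b c x) *\<^sub>R rot_gen b c x =
      (((x \<bullet> b) * (x \<bullet> b)) *\<^sub>R ((v \<bullet> c) *\<^sub>R c) - ((x \<bullet> c) * (v \<bullet> c)) *\<^sub>R ((x \<bullet> b) *\<^sub>R b))
     + (((x \<bullet> c) * (x \<bullet> c)) *\<^sub>R ((v \<bullet> b) *\<^sub>R b) - ((x \<bullet> b) * (v \<bullet> b)) *\<^sub>R ((x \<bullet> c) *\<^sub>R c))" for b c
    by (simp add: rot_gen_def algebra_simps)
  then have "(\<Sum>(b, c)\<in>Basis \<times> Basis. (v \<bullet> rot_gen b c x) *\<^sub>R rot_gen b c x) =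
     ((\<Sum>b\<in>Basis. \<Sum>c\<in>Basis. ((x \<bullet> b) * (x \<bullet> b)) *\<^sub>R ((v \<bullet> c) *\<^sub>R c))
   - (\<Sum>b\<in>Basis. \<Sum>c\<in>Basis. ((x \<bullet> c) * (v \<bullet> c)) *\<^sub>R ((x \<bullet> b) *\<^sub>R b)))
   + ((\<Sum>b\<in>Basis. \<Sum>c\<in>Basis. ((x \<bullet> c) * (x \<bullet> c)) *\<^sub>R ((v \<bullet> b) *\<^sub>R b))
   - (\<Sum>b\<in>Basis. \<Sum>c\<in>Basis. ((x \<bullet> b) * (v \<bullet> b)) *\<^sub>R ((x \<bullet> c) *\<^sub>R c)))"
    by (simp only: sum_Basis_Times_Basis sum.distrib sum_subtractf)
  also have "\<dots> = ((x \<bullet> x) *\<^sub>R v - (x \<bullet> v) *\<^sub>R x) + ((x \<bullet> x) *\<^sub>R v - (x \<bullet> v) *\<^sub>R x)"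
  proof -
    have 1: "(\<Sum>b\<in>Basis. \<Sum>c\<in>Basis. ((x \<bullet> b) * (y \<bullet> b)) *\<^sub>R ((w \<bullet> c) *\<^sub>R c)) = (x \<bullet> y) *\<^sub>R w" for y w
      unfolding sum_scaleR_product euclidean_representation euclidean_inner[symmetric] ..
    have 2: "(\<Sum>b\<in>Basis. \<Sum>c\<in>Basis. ((x \<bullet> c) * (y \<bullet> c)) *\<^sub>R ((w \<bullet> b) *\<^sub>R b)) = (x \<bullet> y) *\<^sub>R w" for y w
      by (subst sum.swap) (rule 1)
    show ?thesis by (simp only: 1 2)
  qed
  finally show ?thesis by (simp add: scaleR_2)
qed

text \<open>The Casimir element of the rotation algebra acts on vectors as a scalar: each basis
  direction lies in one plane less than the dimension, and each plane counts twice.\<close>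

lemma rot_gen_sum_square:
  fixes x :: "'a::euclidean_space"
  shows "(\<Sum>(b, c)\<in>Basis \<times> Basis. rot_gen b c (rot_gen b c x)) = (2 * (1 - real DIM('a))) *\<^sub>R x"
proof -
  have "rot_gen b c (rot_gen b c x) =
     (if b = c then (x \<bullet> b) *\<^sub>R b + (x \<bullet> b) *\<^sub>R b else 0) - ((x \<bullet> c) *\<^sub>R c + (x \<bullet> b) *\<^sub>R b)" if "b \<in> Basis" "c \<in> Basis" for b c
    using that by (simp add: rot_gen_def inner_diff_left inner_Basis algebra_simps)
  then have "(\<Sum>(b, c)\<in>Basis \<times> Basis. rot_gen b c (rot_gen b c x)) =
     (\<Sum>b\<in>Basis. \<Sum>c\<in>Basis. (if b = c then (x \<bullet> b) *\<^sub>R b + (x \<bullet> b) *\<^sub>R b else 0) - ((x \<bullet> c) *\<^sub>R c + (x \<bullet> b) *\<^sub>R b))"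
    by (simp add: sum_Basis_Times_Basis)
  also have "\<dots> = (x + x) - (real DIM('a) *\<^sub>R x + real DIM('a) *\<^sub>R x)"
  proof -
    have 1: "(\<Sum>b\<in>(Basis :: 'a set). \<Sum>c\<in>Basis. (x \<bullet> c) *\<^sub>R c) = real DIM('a) *\<^sub>R x"
      by (simp only: euclidean_representation sum_constant_scaleR)
    have 2: "(\<Sum>b\<in>Basis. \<Sum>c\<in>(Basis :: 'a set). (x \<bullet> b) *\<^sub>R b) = real DIM('a) *\<^sub>R x"
      by (subst sum.swap) (rule 1)
    have 3: "(\<Sum>b\<in>Basis. \<Sum>c\<in>Basis. (if b = c then (x \<bullet> b) *\<^sub>R b + (x \<bullet> b) *\<^sub>R b else 0)) = x + x"
      by (simp add: sum.distrib euclidean_representation)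
    show ?thesis by (simp only: sum_subtractf sum.distrib 1 2 3)
  qed
  also have "\<dots> = (2 * (1 - real DIM('a))) *\<^sub>R x"
    by (simp only: mult_2 scaleR_add_left scaleR_diff_left scaleR_one add_diff_add)
  finally show ?thesis .
qed

text \<open>The generators are skew, so the squared lengths are minus the pairings of the Casimir
  sum with \<open>x\<close>.\<close>

lemma rot_gen_sum_norm:
  fixes x :: "'a::euclidean_space"
  shows "(\<Sum>(b, c)\<in>Basis \<times> Basis. rot_gen b c x \<bullet> rot_gen b c x) = 2 * (real DIM('a) - 1) * (x \<bullet> x)"
proof -
  have "rot_gen b c x \<bullet> rot_gen b c x = - (rot_gen b c (rot_gen b c x) \<bullet> x)" for b c
    by (simp add: rot_gen_def inner_diff_left inner_diff_right inner_commute algebra_simps)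
  then have "(\<Sum>(b, c)\<in>Basis \<times> Basis. rot_gen b c x \<bullet> rot_gen b c x)
     = - ((\<Sum>(b, c)\<in>Basis \<times> Basis. rot_gen b c (rot_gen b c x)) \<bullet> x)"
    by (simp add: inner_sum_left sum_negf split_def)
  then show ?thesis unfolding rot_gen_sum_square by (simp add: algebra_simps)
qed

section \<open>The torus: tangent spaces, Levi-Civita connection and Killing fields\<close>

locale clifford =
  fixes R1 R2 :: real and M :: "('a::euclidean_space \<times> 'b::euclidean_space) set"
  assumes R1: "R1 > 0" and R2: "R2 > 0" and M: "M = clifford_torus R1 R2"
begin

lemma M_iff: "z \<in> M \<longleftrightarrow> norm (fst z) = R1 \<and> norm (snd z) = R2"
  by (cases z) (simp add: M clifford_torus_def)

lemma compact_M: "compact M"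
  by (simp add: M clifford_torus_def compact_Times)

lemma M_nonempty: "M \<noteq> {}"
  using R1 R2 by (simp add: M clifford_torus_def less_imp_le)

lemma inner_M: "z \<in> M \<Longrightarrow> fst z \<bullet> fst z = R1\<^sup>2" "z \<in> M \<Longrightarrow> snd z \<bullet> snd z = R2\<^sup>2"
  by (simp_all add: M_iff dot_square_norm)

lemma tangent_space_M:
  assumes z: "z \<in> M"
  shows "tangent_space M z = {v. fst z \<bullet> fst v = 0 \<and> snd z \<bullet> snd v = 0}"
proof (intro equalityI subsetI)
  fix v assume v: "v \<in> tangent_space M z"
  have "fst z \<bullet> fst v = 0"
    by (rule tangent_space_norm_orthogonal[OF bounded_linear_fst _ z v, of R1]) (simp add: M_iff)
  moreover have "snd z \<bullet> snd v = 0"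
    by (rule tangent_space_norm_orthogonal[OF bounded_linear_snd _ z v, of R2]) (simp add: M_iff)
  ultimately show "v \<in> {v. fst z \<bullet> fst v = 0 \<and> snd z \<bullet> snd v = 0}" by simp
next
  fix v assume v: "v \<in> {v. fst z \<bullet> fst v = 0 \<and> snd z \<bullet> snd v = 0}"
  obtain \<gamma>1 :: "real \<Rightarrow> 'a" where 1: "\<forall>T. smooth_on T \<gamma>1" "\<forall>s. norm (\<gamma>1 s) = R1" "\<gamma>1 0 = fst z"
      "(\<gamma>1 has_vector_derivative fst v) (at 0)" using sphere_curve[of "fst z" R1 "fst v"] z v R1 by (auto simp: M_iff)
  obtain \<gamma>2 :: "real \<Rightarrow> 'b" where 2: "\<forall>T. smooth_on T \<gamma>2" "\<forall>s. norm (\<gamma>2 s) = R2" "\<gamma>2 0 = snd z"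
      "(\<gamma>2 has_vector_derivative snd v) (at 0)" using sphere_curve[of "snd z" R2 "snd v"] z v R2 by (auto simp: M_iff)
  have "((\<lambda>s. (\<gamma>1 s, \<gamma>2 s)) has_vector_derivative v) (at 0)"
    using has_vector_derivative_Pair[OF 1(4) 2(4)] by simp
  moreover have "smooth_on T (\<lambda>s. (\<gamma>1 s, \<gamma>2 s))" for T using 1 2 by (intro smooth_on_Pair) auto
  ultimately show "v \<in> tangent_space M z"
    unfolding tangent_space_def using 1 2
    by (auto simp: M_iff intro!: exI[of _ 1] exI[of _ "\<lambda>s. (\<gamma>1 s, \<gamma>2 s)"])
qed

lemma subspace_tangent_M: "z \<in> M \<Longrightarrow> subspace (tangent_space M z)"
  unfolding tangent_space_M by (auto simp: subspace_def inner_add_right)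

lemma dim_tangent_M:
  assumes z: "z \<in> M" shows "dim (tangent_space M z) = (DIM('a) - 1) + (DIM('b) - 1)"
proof -
  have "tangent_space M z = {v. fst z \<bullet> v = 0} \<times> {v. snd z \<bullet> v = 0}"
    unfolding tangent_space_M[OF z] by auto
  moreover have "fst z \<noteq> 0" "snd z \<noteq> 0" using z R1 R2 by (auto simp: M_iff)
  ultimately show ?thesis by (simp add: dim_Times subspace_hyperplane dim_hyperplane)
qed

lemma manifold_dim_M: "manifold_dim M = (DIM('a) - 1) + (DIM('b) - 1)"
  unfolding manifold_dim_def using dim_tangent_M M_nonempty by (intro the_equality) auto

definition torus_proj :: "'a \<times> 'b \<Rightarrow> 'a \<times> 'b \<Rightarrow> 'a \<times> 'b" where
  "torus_proj z v = (fst v - ((fst v \<bullet> fst z) / R1\<^sup>2) *\<^sub>R fst z, snd v - ((snd v \<bullet> snd z) / R2\<^sup>2) *\<^sub>R snd z)"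

lemma linear_torus_proj: "linear (torus_proj z)"
  by (rule linearI) (simp_all add: torus_proj_def inner_add_left add_divide_distrib algebra_simps)

lemma torus_proj_tangent: "z \<in> M \<Longrightarrow> v \<in> tangent_space M z \<Longrightarrow> torus_proj z v = v"
  by (simp add: torus_proj_def tangent_space_M inner_commute)

lemma levi_civita_M:
  assumes z: "z \<in> M"
  shows "levi_civita M v Y z = torus_proj z (differential M Y z v)"
  unfolding levi_civita_def induced_conn_def
  by (rule orth_proj_eqI[OF subspace_tangent_M[OF z]])
     (use z R1 R2 in \<open>auto simp: tangent_space_M torus_proj_def inner_prod_def inner_diff_right inner_diff_left inner_M inner_commute\<close>)

text \<open>The scaling makes \<open>\<Sum>\<^sub>k X\<^sub>k \<otimes> X\<^sub>k\<close> the inverse metric of the torus.\<close>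

fun killing :: "'a \<times> 'a + 'b \<times> 'b \<Rightarrow> 'a \<times> 'b \<Rightarrow> 'a \<times> 'b" where
  "killing (Inl (b, c)) z = ((1 / (sqrt 2 * R1)) *\<^sub>R rot_gen b c (fst z), 0)"
| "killing (Inr (b, c)) z = (0, (1 / (sqrt 2 * R2)) *\<^sub>R rot_gen b c (snd z))"

definition K :: "('a \<times> 'a + 'b \<times> 'b) set" where
  "K = (Basis \<times> Basis) <+> (Basis \<times> Basis)"

lemma sum_K: "sum f K = (\<Sum>(b, c)\<in>Basis \<times> Basis. f (Inl (b, c))) + (\<Sum>(b, c)\<in>Basis \<times> Basis. f (Inr (b, c)))"
  unfolding K_def by (subst sum.Plus) (auto simp: comp_def split_def)

lemma bounded_linear_killing: "bounded_linear (killing k)"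
proof (cases k rule: sum.exhaust)
  case (Inl p)
  obtain b c where "k = Inl (b, c)" using Inl by (cases p) auto
  then have "killing k = (\<lambda>z. ((1 / (sqrt 2 * R1)) *\<^sub>R rot_gen b c (fst z), 0))" by auto
  then show ?thesis
    by (auto intro!: bounded_linear_Pair bounded_linear_compose[OF bounded_linear_scaleR_right]
       bounded_linear_compose[OF bounded_linear_rot_gen] bounded_linear_fst bounded_linear_zero)
next
  case (Inr p)
  obtain b c where "k = Inr (b, c)" using Inr by (cases p) auto
  then have "killing k = (\<lambda>z. (0, (1 / (sqrt 2 * R2)) *\<^sub>R rot_gen b c (snd z)))" by auto
  then show ?thesis
    by (auto intro!: bounded_linear_Pair bounded_linear_compose[OF bounded_linear_scaleR_right]
       bounded_linear_compose[OF bounded_linear_rot_gen] bounded_linear_snd bounded_linear_zero)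
qed

lemma killing_fst_snd: "fst (killing k z) \<bullet> fst z = 0" "snd (killing k z) \<bullet> snd z = 0"
  by (cases "(k, z)" rule: killing.cases; simp add: rot_gen_skew)+

lemma killing_tangent: "z \<in> M \<Longrightarrow> killing k z \<in> tangent_space M z"
  using killing_fst_snd[of k z] by (simp add: tangent_space_M inner_commute)

lemma sum_killing_expand:
  assumes z: "z \<in> M" and v: "v \<in> tangent_space M z"
  shows "(\<Sum>k\<in>K. (v \<bullet> killing k z) *\<^sub>R killing k z) = v"
proof -
  have 1: "(\<Sum>(b, c)\<in>Basis \<times> Basis. (v \<bullet> killing (Inl (b, c)) z) *\<^sub>R killing (Inl (b, c)) z) = (fst v, 0)"
  proof -
    have "(\<Sum>(b, c)\<in>Basis \<times> Basis. (v \<bullet> killing (Inl (b, c)) z) *\<^sub>R killing (Inl (b, c)) z)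
      = ((1 / (2 * R1\<^sup>2)) *\<^sub>R (\<Sum>(b, c)\<in>Basis \<times> Basis. (fst v \<bullet> rot_gen b c (fst z)) *\<^sub>R rot_gen b c (fst z)), 0)"
      by (rule prod_eqI)
         (simp_all add: fst_sum snd_sum split_def inner_prod_def scaleR_sum_right power2_eq_square mult_ac)
    then show ?thesis
      unfolding rot_gen_sum_expand using z v R1 by (simp add: inner_M tangent_space_M)
  qed
  have 2: "(\<Sum>(b, c)\<in>Basis \<times> Basis. (v \<bullet> killing (Inr (b, c)) z) *\<^sub>R killing (Inr (b, c)) z) = (0, snd v)"
  proof -
    have "(\<Sum>(b, c)\<in>Basis \<times> Basis. (v \<bullet> killing (Inr (b, c)) z) *\<^sub>R killing (Inr (b, c)) z)
      = (0, (1 / (2 * R2\<^sup>2)) *\<^sub>R (\<Sum>(b, c)\<in>Basis \<times> Basis. (snd v \<bullet> rot_gen b c (snd z)) *\<^sub>R rot_gen b c (snd z)))"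
      by (rule prod_eqI)
         (simp_all add: fst_sum snd_sum split_def inner_prod_def scaleR_sum_right power2_eq_square mult_ac)
    then show ?thesis
      unfolding rot_gen_sum_expand using z v R2 by (simp add: inner_M tangent_space_M)
  qed
  show ?thesis unfolding sum_K 1 2 by simp
qed

definition p :: real where "p = real DIM('a) - 1"
definition q :: real where "q = real DIM('b) - 1"

text \<open>The Casimir identity on each factor. On the torus the result is normal to it, which is
  why the intrinsic sum of the derivatives of the Killing fields along themselves vanishes.\<close>

lemma sum_killing_square:
  "(\<Sum>k\<in>K. killing k (killing k z)) = (- (p / R1\<^sup>2) *\<^sub>R fst z, - (q / R2\<^sup>2) *\<^sub>R snd z)"
proof -
  have r: "rot_gen b c (s *\<^sub>R x) = s *\<^sub>R rot_gen b c x" for b c s and x :: "'e::euclidean_space"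
    by (simp add: rot_gen_def algebra_simps)
  have "(\<Sum>(b, c)\<in>Basis \<times> Basis. killing (Inl (b, c)) (killing (Inl (b, c)) z))
      = ((1 / (2 * R1\<^sup>2)) *\<^sub>R (\<Sum>(b, c)\<in>Basis \<times> Basis. rot_gen b c (rot_gen b c (fst z))), 0)"
    by (rule prod_eqI)
       (simp_all add: fst_sum snd_sum split_def r scaleR_sum_right power2_eq_square mult_ac)
  moreover have "(\<Sum>(b, c)\<in>Basis \<times> Basis. killing (Inr (b, c)) (killing (Inr (b, c)) z))
      = (0, (1 / (2 * R2\<^sup>2)) *\<^sub>R (\<Sum>(b, c)\<in>Basis \<times> Basis. rot_gen b c (rot_gen b c (snd z))))"
    by (rule prod_eqI)
       (simp_all add: fst_sum snd_sum split_def r scaleR_sum_right power2_eq_square mult_ac)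
  ultimately show ?thesis
    unfolding sum_K rot_gen_sum_square by (simp add: p_def q_def diff_divide_distrib)
qed

text \<open>A trace over the tangent space of the torus, weighted on the two factors. Weights 1 and
  1 give the dimension; the coefficients of the normal field \<open>L\<close> will give
  \<open>sig\<close>.\<close>

lemma sum_killing_norm:
  assumes z: "z \<in> M"
  shows "(\<Sum>k\<in>K. (\<alpha> *\<^sub>R fst (killing k z), \<beta> *\<^sub>R snd (killing k z)) \<bullet> killing k z) = \<alpha> * p + \<beta> * q"
proof -
  have e1: "(\<Sum>(b, c)\<in>Basis \<times> Basis. (\<alpha> *\<^sub>R fst (killing (Inl (b, c)) z), \<beta> *\<^sub>R snd (killing (Inl (b, c)) z)) \<bullet> killing (Inl (b, c)) z)
      = \<alpha> / (2 * R1\<^sup>2) * (\<Sum>(b, c)\<in>Basis \<times> Basis. rot_gen b c (fst z) \<bullet> rot_gen b c (fst z))"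
    by (simp add: split_def inner_prod_def sum_distrib_left power2_eq_square mult_ac)
  have e2: "(\<Sum>(b, c)\<in>Basis \<times> Basis. (\<alpha> *\<^sub>R fst (killing (Inr (b, c)) z), \<beta> *\<^sub>R snd (killing (Inr (b, c)) z)) \<bullet> killing (Inr (b, c)) z)
      = \<beta> / (2 * R2\<^sup>2) * (\<Sum>(b, c)\<in>Basis \<times> Basis. rot_gen b c (snd z) \<bullet> rot_gen b c (snd z))"
    by (simp add: split_def inner_prod_def sum_distrib_left power2_eq_square mult_ac)
  show ?thesis
    unfolding sum_K e1 e2 rot_gen_sum_norm using R1 R2 z by (simp add: inner_M p_def q_def field_simps)
qed

end

section \<open>Orthonormal frames and the trace formula\<close>

text \<open>The Householder reflection that maps \<open>x\<close> to \<open>- y\<close>, for \<open>x\<close> and \<open>y\<close> of norm \<open>R\<close>.\<close>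

definition householder :: "real \<Rightarrow> 'a::euclidean_space \<Rightarrow> 'a \<Rightarrow> 'a \<Rightarrow> 'a" where
  "householder R x y v = v - ((v \<bullet> (x + y)) * inverse (R\<^sup>2 + x \<bullet> y)) *\<^sub>R (x + y)"

lemma householder_inner:
  assumes "norm x = R" "norm y = R" "R\<^sup>2 + x \<bullet> y \<noteq> 0"
  shows "householder R x y v \<bullet> householder R x y w = v \<bullet> w"
proof -
  define D where "D = R\<^sup>2 + x \<bullet> y"
  define s where "s = x + y"
  have "x \<bullet> x = R\<^sup>2" "y \<bullet> y = R\<^sup>2" using assms by (simp_all add: dot_square_norm)
  then have ss: "s \<bullet> s = 2 * D"
    by (simp add: s_def D_def inner_add_left inner_add_right inner_commute[of y x])
  have D: "D \<noteq> 0" using assms by (simp add: D_def)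
  have *: "(v - a *\<^sub>R s) \<bullet> (w - b *\<^sub>R s) = v \<bullet> w - b * (v \<bullet> s) - a * (w \<bullet> s) + a * b * (2 * D)" for a b
    unfolding ss[symmetric] by (simp add: inner_diff_left inner_diff_right inner_commute[of s w] right_diff_distrib)
  show ?thesis
    unfolding householder_def s_def[symmetric] D_def[symmetric] * using D by (simp add: field_simps)
qed

text \<open>The reflection takes \<open>x\<close> to \<open>- y\<close>, hence the orthogonal
  complement of \<open>x\<close> to that of \<open>y\<close>.\<close>

lemma householder_tangent:
  assumes "norm y = R" "R\<^sup>2 + x \<bullet> y \<noteq> 0" "x \<bullet> v = 0"
  shows "y \<bullet> householder R x y v = 0"
proof -
  have "v \<bullet> (x + y) = y \<bullet> v" using assms(3) by (simp add: inner_add_right inner_commute)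
  moreover have "y \<bullet> (x + y) = R\<^sup>2 + x \<bullet> y"
    using assms(1) by (simp add: inner_add_right dot_square_norm inner_commute)
  ultimately show ?thesis using assms(2) unfolding householder_def by (simp add: inner_diff_right)
qed

lemma at_within_Int_open: "open U \<Longrightarrow> x \<in> U \<Longrightarrow> at x within (U \<inter> S) = at x within S"
  by (rule at_within_nhd[of x U]) auto

lemma norm_one_differential:
  assumes "\<And>y. y \<in> S \<Longrightarrow> norm (\<phi> y) = 1" "x \<in> S" "v \<in> tangent_space S x"
    "\<phi> differentiable (at x within S)"
  shows "differential S \<phi> x v \<bullet> \<phi> x = 0"
proof -
  have "differential S (\<lambda>y. \<phi> y \<bullet> \<phi> y) x v = differential S (\<lambda>y. 1) x v"
    using differential_cong[of UNIV x S "\<lambda>y. \<phi> y \<bullet> \<phi> y" "\<lambda>y. 1"] assms by (simp add: dot_square_norm)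
  then show ?thesis
    using differential_inner[OF assms(3,4,4)] differential_const[OF assms(3), of "1::real"]
    by (simp add: inner_commute)
qed

context clifford
begin

text \<open>An orthonormal basis at \<open>x\<close> is carried to nearby points by Householder
  reflections in both factors. These are rational in the point, hence smooth as long as neither
  component is antipodal to that of \<open>x\<close>.\<close>

lemma frame_exists:
  assumes x: "x \<in> M"
  shows "\<exists>e. local_orthonormal_frame M x e"
proof -
  obtain B where B: "B \<subseteq> tangent_space M x" "pairwise orthogonal B" "\<And>b. b \<in> B \<Longrightarrow> norm b = 1"
    "independent B" "card B = dim (tangent_space M x)"
    using orthonormal_basis_subspace[OF subspace_tangent_M[OF x]] by metis
  have fin: "finite B" using B(4) independent_imp_finite by blast
  have card: "card B = manifold_dim M" using B(5) by (simp add: dim_tangent_M[OF x] manifold_dim_M)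
  obtain h where h: "bij_betw h {0..<manifold_dim M} B"
    using ex_bij_betw_nat_finite[OF fin] card by auto
  have hB: "h i \<in> B" if "i < manifold_dim M" for i using h that by (auto simp: bij_betw_def)
  have hinj: "h i = h j \<longleftrightarrow> i = j" if "i < manifold_dim M" "j < manifold_dim M" for i j
    using h that by (auto simp: bij_betw_def inj_on_def)
  define e where "e i y = (householder R1 (fst x) (fst y) (fst (h i)), householder R2 (snd x) (snd y) (snd (h i)))" for i y
  define U where "U = {y. R1\<^sup>2 + fst x \<bullet> fst y \<noteq> 0} \<inter> {y. R2\<^sup>2 + snd x \<bullet> snd y \<noteq> 0}"
  have "open U" unfolding U_def by (intro open_Int open_Collect_neq continuous_intros)
  moreover have "x \<in> U"
    using x R1 R2 by (auto simp: U_def inner_M add_nonneg_eq_0_iff)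
  moreover have "smooth_on (U \<inter> M) (e i)" for i
    unfolding e_def[abs_def] householder_def
    by (intro smooth_on_intros) (auto simp: U_def)
  moreover have "e i y \<in> tangent_space M y" if "y \<in> U \<inter> M" "i < manifold_dim M" for i y
    using that hB[OF that(2)] B(1) x
    by (auto simp: tangent_space_M e_def U_def M_iff intro!: householder_tangent)
  moreover have "e i y \<bullet> e j y = (if i = j then 1 else 0)"
    if "y \<in> U \<inter> M" "i < manifold_dim M" "j < manifold_dim M" for i j y
  proof -
    have "e i y \<bullet> e j y = h i \<bullet> h j"
      using that x by (simp add: e_def inner_prod_def householder_inner U_def M_iff)
    also have "\<dots> = (if i = j then 1 else 0)"
    proof (cases "i = j")
      case True
      then show ?thesis using B(3)[OF hB[OF that(2)]] by (simp add: dot_square_norm)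
    next
      case False
      then show ?thesis
        using B(2) hB[OF that(2)] hB[OF that(3)] hinj[OF that(2,3)]
        by (auto simp: pairwise_def orthogonal_def)
    qed
    finally show ?thesis .
  qed
  ultimately show ?thesis
    unfolding local_orthonormal_frame_def by (intro exI[of _ e] exI[of _ U] conjI allI ballI impI) simp_all
qed

lemma frame_at: "x \<in> M \<Longrightarrow> local_orthonormal_frame M x (frame_at M x)"
  unfolding frame_at_def using frame_exists by (rule someI_ex)

lemma frame_properties:
  assumes x: "x \<in> M" and e: "local_orthonormal_frame M x e"
  obtains U where "open U" "x \<in> U" "\<And>i y. i < manifold_dim M \<Longrightarrow> y \<in> U \<inter> M \<Longrightarrow> e i y \<in> tangent_space M y"
    "\<And>i. i < manifold_dim M \<Longrightarrow> e i differentiable (at x within M)"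
    "\<And>v. v \<in> tangent_space M x \<Longrightarrow> (\<Sum>i<manifold_dim M. (v \<bullet> e i x) *\<^sub>R e i x) = v"
proof -
  let ?m = "manifold_dim M"
  obtain U where U: "open U" "x \<in> U" "\<And>i. i < ?m \<Longrightarrow> smooth_on (U \<inter> M) (e i)"
    "\<And>i y. i < ?m \<Longrightarrow> y \<in> U \<inter> M \<Longrightarrow> e i y \<in> tangent_space M y"
    "\<And>i j y. i < ?m \<Longrightarrow> j < ?m \<Longrightarrow> y \<in> U \<inter> M \<Longrightarrow> e i y \<bullet> e j y = (if i = j then 1 else 0)"
    using e unfolding local_orthonormal_frame_def by auto
  have d: "e i differentiable (at x within M)" if "i < ?m" for i
    using smooth_on_differentiable[OF U(3)[OF that], of x] x U(1,2) by (simp add: at_within_Int_open)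
  have on: "e i x \<bullet> e j x = (if i = j then 1 else 0)" if "i < ?m" "j < ?m" for i j
    using U(5)[OF that] x U(2) by simp
  let ?B = "(\<lambda>i. e i x) ` {..<?m}"
  have inj: "inj_on (\<lambda>i. e i x) {..<?m}"
  proof (rule inj_onI)
    fix i j assume "i \<in> {..<?m}" "j \<in> {..<?m}" "e i x = e j x"
    then show "i = j" using on[of i j] on[of i i] by (auto split: if_splits)
  qed
  have indep: "independent ?B"
  proof (rule pairwise_orthogonal_independent)
    show "pairwise orthogonal ?B"
      using on by (auto simp: pairwise_def orthogonal_def)
    show "0 \<notin> ?B" using on by force
  qed
  have sub: "?B \<subseteq> tangent_space M x"
    using U(4)[OF _ IntI[OF U(2) x]] by blast
  have "tangent_space M x \<subseteq> span ?B"
    using card_eq_dim[OF sub, of] indep inj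
    by (simp add: card_image dim_tangent_M[OF x] manifold_dim_M)
  then have sp: "v \<in> tangent_space M x \<Longrightarrow> v \<in> span ?B" for v by blast
  have ex: "(\<Sum>i<?m. (v \<bullet> e i x) *\<^sub>R e i x) = v" if v: "v \<in> tangent_space M x" for v
  proof -
    define w where "w = v - (\<Sum>i<?m. (v \<bullet> e i x) *\<^sub>R e i x)"
    have "(\<Sum>i<?m. (v \<bullet> e i x) *\<^sub>R e i x) \<in> span ?B"
      by (intro span_sum span_scale span_base) auto
    then have w: "w \<in> span ?B" unfolding w_def using sp[OF v] by (rule span_diff[rotated])
    have "orthogonal w b" if b: "b \<in> ?B" for b
    proof -
      obtain j where j: "j < ?m" "b = e j x" using b by auto
      have "(\<Sum>i<?m. (v \<bullet> e i x) * (e i x \<bullet> e j x)) = (\<Sum>i<?m. if i = j then v \<bullet> e i x else 0)"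
        by (rule sum.cong) (use on j in auto)
      then show ?thesis using j by (simp add: orthogonal_def w_def inner_diff_left inner_sum_left)
    qed
    then have "orthogonal w w" using orthogonal_to_span[OF w, of w] by simp
    then show ?thesis by (simp add: orthogonal_def w_def)
  qed
  show thesis using that[of U] U d ex by blast
qed

text \<open>Expanding the frame as \<open>e\<^sub>i = \<Sum>\<^sub>k \<langle>e\<^sub>i, X\<^sub>k\<rangle> X\<^sub>k\<close>, the derivatives of the coefficients cancel, and
  \<open>\<Sum>\<^sub>i \<langle>e\<^sub>i, X\<^sub>k\<rangle> e\<^sub>i = X\<^sub>k\<close>.\<close>

lemma frame_trace:
  fixes G :: "'a \<times> 'b \<Rightarrow> 'a \<times> 'b \<Rightarrow> 'c::euclidean_space"
  assumes x: "x \<in> M" and e: "local_orthonormal_frame M x e" and \<phi>: "norm (\<phi> x) = 1"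
    and lin: "\<And>y. y \<in> M \<Longrightarrow> linear (G y)"
    and tan: "\<And>v. v \<in> tangent_space M x \<Longrightarrow> G x v \<bullet> \<phi> x = 0"
    and diff: "\<And>k. k \<in> K \<Longrightarrow> (\<lambda>y. G y (killing k y)) differentiable (at x within M)"
  shows "(\<Sum>i<manifold_dim M. induced_conn M (sphere 0 1) \<phi> (e i x) (\<lambda>y. G y (e i y)) x
            - G x (levi_civita M (e i x) (e i) x))
       = (\<Sum>k\<in>K. sphere_proj (\<phi> x) (differential M (\<lambda>y. G y (killing k y)) x (killing k x)))"
proof -
  obtain U where U: "open U" "x \<in> U" "\<And>i y. i < manifold_dim M \<Longrightarrow> y \<in> U \<inter> M \<Longrightarrow> e i y \<in> tangent_space M y"
    "\<And>i. i < manifold_dim M \<Longrightarrow> e i differentiable (at x within M)"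
    "\<And>v. v \<in> tangent_space M x \<Longrightarrow> (\<Sum>i<manifold_dim M. (v \<bullet> e i x) *\<^sub>R e i x) = v"
    by (rule frame_properties[OF x e]) (rule that)
  let ?m = "manifold_dim M"
  define h where "h i k y = e i y \<bullet> killing k y" for i k y
  define Gk where "Gk k y = G y (killing k y)" for k y
  let ?P = "sphere_proj (\<phi> x)"
  \<comment> \<open>What is left of the \<open>k\<close>-th summand once the derivatives of the
    coefficients have cancelled. It is linear in \<open>v\<close>, so the sum over the frame can be
    pulled into its argument.\<close>
  define Q where "Q k v = ?P (differential M (Gk k) x v) - G x (torus_proj x (killing k v))" for k v
  have Gd: "Gk k differentiable (at x within M)" if "k \<in> K" for k
    using diff[OF that] unfolding Gk_def .
  have kd: "killing k differentiable (at x within M)" for k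
    using bounded_linear_imp_differentiable[OF bounded_linear_killing] .
  have hd: "h i k differentiable (at x within M)" if "i < ?m" for i k
    unfolding h_def[abs_def] by (intro differentiable_inner U(4) that kd)
  have exp: "e i y = (\<Sum>k\<in>K. h i k y *\<^sub>R killing k y)" if "i < ?m" "y \<in> U \<inter> M" for i y
    using sum_killing_expand[of y "e i y"] U(3)[OF that] that(2) by (simp add: h_def)
  have linG: "G y (\<Sum>k\<in>K. c k *\<^sub>R w k) = (\<Sum>k\<in>K. c k *\<^sub>R G y (w k))" if "y \<in> M" for y c and w :: "_ \<Rightarrow> 'a \<times> 'b"
    using lin[OF that] by (simp add: linear_sum linear_cmul)
  have linQ: "linear (Q k)" if "k \<in> K" for k
  proof -
    have "linear (\<lambda>v. ?P (differential M (Gk k) x v))"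
      by (rule linear_compose[unfolded o_def, OF linear_differential[OF Gd[OF that]] linear_sphere_proj])
    moreover have "linear (\<lambda>v. torus_proj x (killing k v))"
      by (rule linear_compose[unfolded o_def, OF bounded_linear.linear[OF bounded_linear_killing] linear_torus_proj])
    from linear_compose[unfolded o_def, OF this lin[OF x]]
    have "linear (\<lambda>v. G x (torus_proj x (killing k v)))" .
    ultimately show ?thesis unfolding Q_def[abs_def] by (rule linear_compose_sub)
  qed
  have term_i: "induced_conn M (sphere 0 1) \<phi> (e i x) (\<lambda>y. G y (e i y)) x - G x (levi_civita M (e i x) (e i) x)
      = (\<Sum>k\<in>K. h i k x *\<^sub>R Q k (e i x))" if i: "i < ?m" for i
  proof -
    let ?v = "e i x"
    have v: "?v \<in> tangent_space M x" using U(3)[OF i] x U(2) by simp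
    have "differential M (\<lambda>y. G y (e i y)) x ?v = differential M (\<lambda>y. \<Sum>k\<in>K. h i k y *\<^sub>R Gk k y) x ?v"
      by (subst differential_cong[OF U(1)])
         (use x U(2) exp[OF i] linG in \<open>auto simp: Gk_def\<close>)
    also have "\<dots> = (\<Sum>k\<in>K. differential M (\<lambda>y. h i k y *\<^sub>R Gk k y) x ?v)"
      by (rule differential_sum[OF v]) (intro differentiable_scaleR hd Gd i)
    also have "\<dots> = (\<Sum>k\<in>K. h i k x *\<^sub>R differential M (Gk k) x ?v + differential M (h i k) x ?v *\<^sub>R Gk k x)"
      by (rule sum.cong[OF refl]) (rule differential_scaleR[OF v hd[OF i] Gd])
    finally have A: "differential M (\<lambda>y. G y (e i y)) x ?v = \<dots>" .
    have "differential M (e i) x ?v = differential M (\<lambda>y. \<Sum>k\<in>K. h i k y *\<^sub>R killing k y) x ?v"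
      by (subst differential_cong[OF U(1)]) (use x U(2) exp[OF i] in auto)
    also have "\<dots> = (\<Sum>k\<in>K. differential M (\<lambda>y. h i k y *\<^sub>R killing k y) x ?v)"
      by (rule differential_sum[OF v]) (intro differentiable_scaleR hd kd i)
    also have "\<dots> = (\<Sum>k\<in>K. h i k x *\<^sub>R killing k ?v + differential M (h i k) x ?v *\<^sub>R killing k x)"
      using differential_scaleR[OF v hd[OF i] kd] differential_linear[OF v bounded_linear_killing]
      by simp
    finally have B: "differential M (e i) x ?v = \<dots>" .
    have "?P (differential M (\<lambda>y. G y (e i y)) x ?v)
        = (\<Sum>k\<in>K. h i k x *\<^sub>R ?P (differential M (Gk k) x ?v) + differential M (h i k) x ?v *\<^sub>R Gk k x)"
      unfolding A using sphere_proj_tangent[OF tan[OF killing_tangent[OF x]]]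
      by (simp add: linear_sum[OF linear_sphere_proj] linear_add[OF linear_sphere_proj]
          linear_cmul[OF linear_sphere_proj] Gk_def)
    moreover have "G x (torus_proj x (differential M (e i) x ?v))
        = (\<Sum>k\<in>K. h i k x *\<^sub>R G x (torus_proj x (killing k ?v)) + differential M (h i k) x ?v *\<^sub>R Gk k x)"
      unfolding B using torus_proj_tangent[OF x killing_tangent[OF x]]
      by (simp add: linear_sum[OF linear_torus_proj] linear_add[OF linear_torus_proj]
          linear_cmul[OF linear_torus_proj] Gk_def linear_sum[OF lin[OF x]] linear_add[OF lin[OF x]]
          linear_cmul[OF lin[OF x]])
    ultimately show ?thesis
      unfolding induced_conn_sphere[of \<phi> x, OF \<phi>] levi_civita_M[OF x] Q_def
      by (simp add: sum_subtractf[symmetric] scaleR_diff_right)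
  qed
  have "(\<Sum>i<?m. induced_conn M (sphere 0 1) \<phi> (e i x) (\<lambda>y. G y (e i y)) x - G x (levi_civita M (e i x) (e i) x))
      = (\<Sum>i<?m. \<Sum>k\<in>K. h i k x *\<^sub>R Q k (e i x))"
    by (rule sum.cong) (use term_i in auto)
  also have "\<dots> = (\<Sum>k\<in>K. \<Sum>i<?m. h i k x *\<^sub>R Q k (e i x))" by (rule sum.swap)
  also have "\<dots> = (\<Sum>k\<in>K. Q k (killing k x))"
  proof (rule sum.cong[OF refl])
    fix k assume k: "k \<in> K"
    have "(\<Sum>i<?m. h i k x *\<^sub>R Q k (e i x)) = Q k (\<Sum>i<?m. h i k x *\<^sub>R e i x)"
      by (simp add: linear_sum[OF linQ[OF k]] linear_cmul[OF linQ[OF k]])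
    also have "(\<Sum>i<?m. h i k x *\<^sub>R e i x) = killing k x"
      using U(5)[OF killing_tangent[OF x, of k]] by (simp add: h_def inner_commute)
    finally show "(\<Sum>i<?m. h i k x *\<^sub>R Q k (e i x)) = Q k (killing k x)" .
  qed
  also have "\<dots> = (\<Sum>k\<in>K. ?P (differential M (Gk k) x (killing k x)))
      - G x (torus_proj x (\<Sum>k\<in>K. killing k (killing k x)))"
    by (simp add: Q_def sum_subtractf linear_sum[OF linear_torus_proj] linear_sum[OF lin[OF x]])
  \<comment> \<open>The second derivatives of the Killing flows sum to a vector normal to the torus,
    so the connection of \<open>M\<close> contributes nothing.\<close>
  also have "torus_proj x (\<Sum>k\<in>K. killing k (killing k x)) = 0"
    unfolding sum_killing_square torus_proj_def using inner_M[OF x] R1 R2 by (simp add: zero_prod_def)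
  finally show ?thesis by (simp add: Gk_def linear_0[OF lin[OF x]])
qed

lemma smooth_on_killing: "smooth_on S (killing k)"
  by (rule smooth_on_linear[OF bounded_linear_killing])

lemma smooth_on_differential_killing: "smooth_on M f \<Longrightarrow> smooth_on M (\<lambda>y. differential M f y (killing k y))"
  by (rule smooth_on_differential[OF _ smooth_on_killing killing_tangent])

text \<open>\<open>frame_trace\<close> with the differential of \<open>\<phi>\<close> as
  \<open>G\<close>; its values are orthogonal to \<open>\<phi>\<close> because \<open>\<phi>\<close>
  has unit length.\<close>

lemma tension_M:
  fixes \<phi> :: "'a \<times> 'b \<Rightarrow> 'c::euclidean_space"
  assumes \<phi>: "smooth_map M (sphere 0 1) \<phi>" and x: "x \<in> M"
  shows "tension M (sphere 0 1) \<phi> x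
       = (\<Sum>k\<in>K. sphere_proj (\<phi> x) (differential M (\<lambda>y. differential M \<phi> y (killing k y)) x (killing k x)))"
proof -
  have s: "smooth_on M \<phi>" and n: "\<And>y. y \<in> M \<Longrightarrow> norm (\<phi> y) = 1"
    using \<phi> by (auto simp: smooth_map_def)
  have d: "\<And>y. y \<in> M \<Longrightarrow> \<phi> differentiable (at y within M)" using smooth_on_differentiable[OF s] .
  show ?thesis
    unfolding tension_def Let_def nabla_d_def
  proof (rule frame_trace[OF x frame_at[OF x]])
    show "differential M \<phi> x v \<bullet> \<phi> x = 0" if "v \<in> tangent_space M x" for v
      by (rule norm_one_differential[OF n x that d[OF x]])
    show "(\<lambda>y. differential M \<phi> y (killing k y)) differentiable (at x within M)" for k
      by (rule smooth_on_differentiable[OF smooth_on_differential_killing[OF s] x])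
  qed (rule n[OF x], rule linear_differential, rule d)
qed

lemma smooth_on_sphere_proj:
  "smooth_on S f \<Longrightarrow> smooth_on S g \<Longrightarrow> smooth_on S (\<lambda>y. sphere_proj (f y) (g y))"
  unfolding sphere_proj_def by (intro smooth_on_intros)

text \<open>\<open>frame_trace\<close> with the covariant derivative of \<open>V\<close> as
  \<open>G\<close>; the projection makes its values orthogonal to \<open>\<phi>\<close>.\<close>

lemma rough_laplacian_M:
  fixes \<phi> :: "'a \<times> 'b \<Rightarrow> 'c::euclidean_space"
  assumes \<phi>: "smooth_map M (sphere 0 1) \<phi>" and V: "smooth_on M V" and x: "x \<in> M"
  shows "rough_laplacian M (sphere 0 1) \<phi> V x
       = - (\<Sum>k\<in>K. sphere_proj (\<phi> x) (differential M (\<lambda>y. sphere_proj (\<phi> y) (differential M V y (killing k y))) x (killing k x)))"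
proof -
  have s: "smooth_on M \<phi>" and n: "\<And>y. y \<in> M \<Longrightarrow> norm (\<phi> y) = 1"
    using \<phi> by (auto simp: smooth_map_def)
  have c: "induced_conn M (sphere 0 1) \<phi> v V y = sphere_proj (\<phi> y) (differential M V y v)" if "y \<in> M" for v y
    using induced_conn_sphere[of \<phi> y, OF n[OF that]] .
  have d: "\<And>y. y \<in> M \<Longrightarrow> V differentiable (at y within M)" using smooth_on_differentiable[OF V] .
  have "(\<Sum>i<manifold_dim M. induced_conn M (sphere 0 1) \<phi> (frame_at M x i x)
            (\<lambda>y. induced_conn M (sphere 0 1) \<phi> (frame_at M x i y) V y) x
          - induced_conn M (sphere 0 1) \<phi> (levi_civita M (frame_at M x i x) (frame_at M x i) x) V x)
     = (\<Sum>k\<in>K. sphere_proj (\<phi> x) (differential M (\<lambda>y. induced_conn M (sphere 0 1) \<phi> (killing k y) V y) x (killing k x)))"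
  proof (rule frame_trace[where G = "\<lambda>y v. induced_conn M (sphere 0 1) \<phi> v V y", OF x frame_at[OF x]])
    show "norm (\<phi> x) = 1" using n x .
    show "linear (\<lambda>v. induced_conn M (sphere 0 1) \<phi> v V y)" if "y \<in> M" for y
      unfolding c[OF that]
      by (rule linear_compose[unfolded o_def, OF linear_differential[OF d[OF that]] linear_sphere_proj])
    show "induced_conn M (sphere 0 1) \<phi> v V x \<bullet> \<phi> x = 0" for v
      unfolding c[OF x] by (rule sphere_proj_inner[OF n[OF x]])
    have "smooth_on M (\<lambda>y. sphere_proj (\<phi> y) (differential M V y (killing k y)))" for k
      by (intro smooth_on_sphere_proj s smooth_on_differential_killing V)
    then have "smooth_on M (\<lambda>y. induced_conn M (sphere 0 1) \<phi> (killing k y) V y)" for k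
      by (rule smooth_on_cong[rotated]) (simp add: c)
    then show "(\<lambda>y. induced_conn M (sphere 0 1) \<phi> (killing k y) V y) differentiable (at x within M)" for k
      using x by (rule smooth_on_differentiable)
  qed
  also have "\<dots> = (\<Sum>k\<in>K. sphere_proj (\<phi> x) (differential M (\<lambda>y. sphere_proj (\<phi> y) (differential M V y (killing k y))) x (killing k x)))"
    by (intro sum.cong refl arg_cong[where f = "sphere_proj (\<phi> x)"] fun_cong[OF differential_cong[OF open_UNIV]])
       (use x c in auto)
  finally show ?thesis unfolding rough_laplacian_def Let_def by simp
qed

text \<open>The squared Hilbert-Schmidt norm of the covariant derivative at \<open>x\<close> does
  not depend on the resolution of the identity: one argument is expanded in Killing fields, then the
  frame is summed up in the other.\<close>

lemma energy_density_M:
  fixes \<phi> :: "'a \<times> 'b \<Rightarrow> 'c::euclidean_space"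
  assumes n: "norm (\<phi> x) = 1" and W: "W differentiable (at x within M)" and x: "x \<in> M"
  shows "(\<Sum>j<manifold_dim M. induced_conn M (sphere 0 1) \<phi> (frame_at M x j x) W x
                    \<bullet> induced_conn M (sphere 0 1) \<phi> (frame_at M x j x) W x)
       = (\<Sum>k\<in>K. sphere_proj (\<phi> x) (differential M W x (killing k x)) \<bullet> sphere_proj (\<phi> x) (differential M W x (killing k x)))"
proof -
  let ?e = "\<lambda>i. frame_at M x i x" and ?m = "manifold_dim M"
  define L where "L v = sphere_proj (\<phi> x) (differential M W x v)" for v
  have L: "linear L" unfolding L_def
    by (rule linear_compose[unfolded o_def, OF linear_differential[OF W] linear_sphere_proj])
  obtain U where U: "open U" "x \<in> U" "\<And>i y. i < ?m \<Longrightarrow> y \<in> U \<inter> M \<Longrightarrow> frame_at M x i y \<in> tangent_space M y"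
    "\<And>i. i < ?m \<Longrightarrow> frame_at M x i differentiable (at x within M)"
    "\<And>v. v \<in> tangent_space M x \<Longrightarrow> (\<Sum>i<?m. (v \<bullet> ?e i) *\<^sub>R ?e i) = v"
    by (rule frame_properties[OF x frame_at[OF x]]) (rule that)
  have "(\<Sum>i<?m. L (?e i) \<bullet> L (?e i)) = (\<Sum>i<?m. L (?e i) \<bullet> L (\<Sum>k\<in>K. (?e i \<bullet> killing k x) *\<^sub>R killing k x))"
    by (rule sum.cong) (use sum_killing_expand[OF x] U(3) x U(2) in auto)
  also have "\<dots> = (\<Sum>i<?m. \<Sum>k\<in>K. ((?e i \<bullet> killing k x) *\<^sub>R L (?e i)) \<bullet> L (killing k x))"
    by (simp add: linear_sum[OF L] linear_cmul[OF L] inner_sum_right)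
  also have "\<dots> = (\<Sum>k\<in>K. \<Sum>i<?m. ((?e i \<bullet> killing k x) *\<^sub>R L (?e i)) \<bullet> L (killing k x))"
    by (rule sum.swap)
  also have "\<dots> = (\<Sum>k\<in>K. L (\<Sum>i<?m. (killing k x \<bullet> ?e i) *\<^sub>R ?e i) \<bullet> L (killing k x))"
    by (simp add: linear_sum[OF L] linear_cmul[OF L] inner_sum_left inner_commute[of _ "killing _ x"])
  also have "\<dots> = (\<Sum>k\<in>K. L (killing k x) \<bullet> L (killing k x))"
    using U(5)[OF killing_tangent[OF x]] by simp
  finally show ?thesis unfolding induced_conn_sphere[of \<phi> x, OF n] L_def .
qed

end

section \<open>Integration over the torus\<close>

text \<open>Differentiation under the integral: the mean value theorem bounds the difference
  quotients by \<open>C'\<close>, a constant is integrable for a finite measure, and dominated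
  convergence applies along every null sequence.\<close>

lemma has_real_derivative_integral:
  fixes g :: "real \<Rightarrow> 'z \<Rightarrow> real"
  assumes fin: "finite_measure \<mu>" and \<delta>: "\<delta> > 0"
    and meas: "\<And>s. \<bar>s\<bar> < \<delta> \<Longrightarrow> g s \<in> borel_measurable \<mu>"
    and meas': "g' 0 \<in> borel_measurable \<mu>"
    and bnd: "\<And>s x. \<bar>s\<bar> < \<delta> \<Longrightarrow> x \<in> space \<mu> \<Longrightarrow> \<bar>g s x\<bar> \<le> C"
    and bnd': "\<And>s x. \<bar>s\<bar> < \<delta> \<Longrightarrow> x \<in> space \<mu> \<Longrightarrow> \<bar>g' s x\<bar> \<le> C'"
    and der: "\<And>s x. \<bar>s\<bar> < \<delta> \<Longrightarrow> x \<in> space \<mu> \<Longrightarrow> ((\<lambda>s. g s x) has_real_derivative g' s x) (at s)"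
  shows "((\<lambda>s. \<integral>x. g s x \<partial>\<mu>) has_real_derivative (\<integral>x. g' 0 x \<partial>\<mu>)) (at 0)"
proof -
  interpret finite_measure \<mu> by fact
  have int: "integrable \<mu> (g s)" if "\<bar>s\<bar> < \<delta>" for s
    using bnd[OF that] meas[OF that] by (intro integrable_const_bound[of _ C] AE_I2) auto
  have quot: "\<bar>(g h x - g 0 x) / h\<bar> \<le> C'" if h: "\<bar>h\<bar> < \<delta>" "h \<noteq> 0" and x: "x \<in> space \<mu>" for h x
  proof -
    have "norm (g h x - g 0 x) \<le> C' * norm (h - 0)"
    proof (rule field_differentiable_bound)
      show "((\<lambda>s. g s x) has_real_derivative g' s x) (at s within {-\<delta><..<\<delta>})" if "s \<in> {-\<delta><..<\<delta>}" for s
        by (rule has_field_derivative_at_within, rule der) (use that x in auto)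
      show "norm (g' s x) \<le> C'" if "s \<in> {-\<delta><..<\<delta>}" for s
        using bnd'[of s x] that x by (simp add: abs_less_iff)
    qed (use h \<delta> in auto)
    then show ?thesis using h by (simp add: abs_divide divide_le_eq)
  qed
  show ?thesis
    unfolding has_field_derivative_iff tendsto_at_iff_sequentially
  proof (intro allI impI)
    fix X :: "nat \<Rightarrow> real" assume X0: "\<forall>i. X i \<in> UNIV - {0}" and X: "X \<longlonglongrightarrow> 0"
    \<comment> \<open>The value 0 for indices with \<open>X n\<close> outside the interval makes
      \<open>q n\<close> measurable and bounded for every \<open>n\<close>; it does not affect the
      limit.\<close>
    define q where "q n x = (if \<bar>X n\<bar> < \<delta> then (g (X n) x - g 0 x) / X n else 0)" for n x
    have ev: "\<forall>\<^sub>F n in sequentially. \<bar>X n\<bar> < \<delta>"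
      using X \<delta> by (auto simp: tendsto_iff dist_norm)
    have C': "0 \<le> C'" if "x \<in> space \<mu>" for x using bnd'[of 0 x] \<delta> that by auto
    have "(\<lambda>n. \<integral>x. q n x \<partial>\<mu>) \<longlonglongrightarrow> (\<integral>x. g' 0 x \<partial>\<mu>)"
    proof (rule integral_dominated_convergence[where w = "\<lambda>_. C'"])
      show "q n \<in> borel_measurable \<mu>" for n
        unfolding q_def using meas[of 0] meas[of "X n"] \<delta> by (cases "\<bar>X n\<bar> < \<delta>") auto
      show "AE x in \<mu>. norm (q n x) \<le> C'" for n
        using quot[of "X n"] X0 C' by (intro AE_I2) (auto simp: q_def)
      show "AE x in \<mu>. (\<lambda>n. q n x) \<longlonglongrightarrow> g' 0 x"
      proof (rule AE_I2)
        fix x assume x: "x \<in> space \<mu>"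
        have "((\<lambda>h. (g h x - g 0 x) / (h - 0)) \<longlongrightarrow> g' 0 x) (at 0)"
          using der[of 0 x] \<delta> x by (simp add: has_field_derivative_iff)
        then have "(\<lambda>n. (g (X n) x - g 0 x) / (X n - 0)) \<longlonglongrightarrow> g' 0 x"
          using X0 X unfolding tendsto_at_iff_sequentially by (auto simp: o_def)
        then show "(\<lambda>n. q n x) \<longlonglongrightarrow> g' 0 x"
          by (rule Lim_transform_eventually) (use ev in \<open>auto simp: q_def elim!: eventually_mono\<close>)
      qed
    qed (use meas' in auto)
    then show "((\<lambda>h. ((\<integral>x. g h x \<partial>\<mu>) - (\<integral>x. g 0 x \<partial>\<mu>)) / (h - 0)) \<circ> X) \<longlonglongrightarrow> (\<integral>x. g' 0 x \<partial>\<mu>)"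
    proof (rule Lim_transform_eventually)
      show "\<forall>\<^sub>F n in sequentially. (\<integral>x. q n x \<partial>\<mu>) = ((\<lambda>h. ((\<integral>x. g h x \<partial>\<mu>) - (\<integral>x. g 0 x \<partial>\<mu>)) / (h - 0)) \<circ> X) n"
        using ev
      proof eventually_elim
        case (elim n)
        then show ?case using int[of "X n"] int[of 0] \<delta> by (simp add: q_def Bochner_Integration.integral_diff)
      qed
    qed
  qed
qed

text \<open>Flow of \<open>rot_gen b c\<close>. The formula presupposes orthogonal unit vectors, so
  \<open>b = c\<close>, where the generator vanishes, is a separate case.\<close>

definition rot :: "'a::euclidean_space \<Rightarrow> 'a \<Rightarrow> real \<Rightarrow> 'a \<Rightarrow> 'a" where
  "rot b c \<theta> x = (if b = c then x else
     x + ((cos \<theta> - 1) * (x \<bullet> b) - sin \<theta> * (x \<bullet> c)) *\<^sub>R b + (sin \<theta> * (x \<bullet> b) + (cos \<theta> - 1) * (x \<bullet> c)) *\<^sub>R c)"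

context
  fixes b c :: "'a::euclidean_space"
  assumes b: "b \<in> Basis" and c: "c \<in> Basis"
begin

lemma rot_inner:
  assumes "b \<noteq> c"
  shows "rot b c \<theta> x \<bullet> b = cos \<theta> * (x \<bullet> b) - sin \<theta> * (x \<bullet> c)"
    "rot b c \<theta> x \<bullet> c = sin \<theta> * (x \<bullet> b) + cos \<theta> * (x \<bullet> c)"
  using b c assms by (simp_all add: rot_def inner_add_left inner_Basis algebra_simps)

lemma rot_derivative: "((\<lambda>\<theta>. rot b c \<theta> x) has_vector_derivative rot_gen b c (rot b c \<theta> x)) (at \<theta>)"
proof (cases "b = c")
  case True
  then show ?thesis by (simp add: rot_def rot_gen_def)
next
  case False
  then show ?thesis
    unfolding rot_gen_def rot_inner[OF False] unfolding rot_def
    by (auto intro!: derivative_eq_intros simp: has_vector_derivative_def fun_eq_iff algebra_simps)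
qed

lemma rot_inverse: "rot b c (- \<theta>) (rot b c \<theta> x) = x"
proof (cases "b = c")
  case False
  define A B where "A = x \<bullet> b" and "B = x \<bullet> c"
  have sc: "sin \<theta> * sin \<theta> = 1 - cos \<theta> * cos \<theta>"
    using sin_cos_squared_add[of \<theta>] by (simp add: power2_eq_square)
  have 1: "((cos \<theta> - 1) * A - sin \<theta> * B) + ((cos \<theta> - 1) * (cos \<theta> * A - sin \<theta> * B) + sin \<theta> * (sin \<theta> * A + cos \<theta> * B)) = 0"
    using sc by algebra
  have 2: "(sin \<theta> * A + (cos \<theta> - 1) * B) + (- sin \<theta> * (cos \<theta> * A - sin \<theta> * B) + (cos \<theta> - 1) * (sin \<theta> * A + cos \<theta> * B)) = 0"
    using sc by algebra
  have "rot b c (- \<theta>) (rot b c \<theta> x) = rot b c \<theta> x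
      + ((cos \<theta> - 1) * (cos \<theta> * A - sin \<theta> * B) + sin \<theta> * (sin \<theta> * A + cos \<theta> * B)) *\<^sub>R b
      + (- sin \<theta> * (cos \<theta> * A - sin \<theta> * B) + (cos \<theta> - 1) * (sin \<theta> * A + cos \<theta> * B)) *\<^sub>R c"
    using False by (subst rot_def) (simp add: rot_inner A_def B_def)
  also have "\<dots> = x
      + (((cos \<theta> - 1) * A - sin \<theta> * B) + ((cos \<theta> - 1) * (cos \<theta> * A - sin \<theta> * B) + sin \<theta> * (sin \<theta> * A + cos \<theta> * B))) *\<^sub>R b
      + ((sin \<theta> * A + (cos \<theta> - 1) * B) + (- sin \<theta> * (cos \<theta> * A - sin \<theta> * B) + (cos \<theta> - 1) * (sin \<theta> * A + cos \<theta> * B))) *\<^sub>R c"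
    using False by (simp add: rot_def A_def B_def scaleR_add_left)
  finally show ?thesis unfolding 1 2 by simp
qed (simp add: rot_def)

text \<open>The derivative of the squared length in \<open>\<theta>\<close> is zero because the
  generator is skew.\<close>

lemma norm_rot: "norm (rot b c \<theta> x) = norm x"
proof (cases "b = c")
  case False
  have "((\<lambda>\<theta>. rot b c \<theta> x \<bullet> rot b c \<theta> x) has_real_derivative 0) (at \<theta>)" for \<theta>
  proof -
    have "((\<lambda>\<theta>. rot b c \<theta> x \<bullet> rot b c \<theta> x) has_vector_derivative
        rot b c \<theta> x \<bullet> rot_gen b c (rot b c \<theta> x) + rot_gen b c (rot b c \<theta> x) \<bullet> rot b c \<theta> x) (at \<theta>)"
      by (rule bounded_bilinear.has_vector_derivative[OF bounded_bilinear_inner rot_derivative rot_derivative])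
    then show ?thesis
      by (simp add: rot_gen_skew inner_commute[of _ "rot_gen _ _ _"] has_real_derivative_iff_has_vector_derivative)
  qed
  then have "rot b c \<theta> x \<bullet> rot b c \<theta> x = rot b c 0 x \<bullet> rot b c 0 x"
    using DERIV_isconst_all by blast
  then show ?thesis by (simp add: norm_eq_sqrt_inner rot_def[of b c 0])
qed (simp add: rot_def)

lemma rot_diff: "rot b c \<theta> (x - y) = rot b c \<theta> x - rot b c \<theta> y"
  by (simp add: rot_def inner_diff_left algebra_simps)

end

section \<open>The flows of the Killing fields and the invariance of the volume\<close>

context clifford
begin

text \<open>The angle is a rescaled time, so that the velocity is \<open>killing k\<close> and not
  the bare generator.\<close>

fun flow :: "'a \<times> 'a + 'b \<times> 'b \<Rightarrow> real \<Rightarrow> 'a \<times> 'b \<Rightarrow> 'a \<times> 'b" where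
  "flow (Inl (b, c)) s z = (rot b c (s / (sqrt 2 * R1)) (fst z), snd z)"
| "flow (Inr (b, c)) s z = (fst z, rot b c (s / (sqrt 2 * R2)) (snd z))"

lemma K_cases:
  assumes "k \<in> K"
  obtains b c where "k = Inl (b, c)" "b \<in> Basis" "c \<in> Basis"
  | b c where "k = Inr (b, c)" "b \<in> Basis" "c \<in> Basis"
  using assms unfolding K_def by auto

lemma flow_inverse: "k \<in> K \<Longrightarrow> flow k (- s) (flow k s z) = z"
  by (erule K_cases) (simp_all add: rot_inverse)

lemma flow_in_M: "k \<in> K \<Longrightarrow> z \<in> M \<Longrightarrow> flow k s z \<in> M"
  by (erule K_cases) (simp_all add: M_iff norm_rot)

lemma flow_0: "flow k 0 z = z"
  by (cases "(k, 0::real, z)" rule: flow.cases) (simp_all add: rot_def)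

lemma dist_flow: "k \<in> K \<Longrightarrow> dist (flow k s y) (flow k s z) = dist y z"
  by (erule K_cases) (simp_all add: dist_prod_def dist_norm rot_diff[symmetric] norm_rot)

lemma flow_derivative:
  assumes "k \<in> K"
  shows "((\<lambda>s. flow k s z) has_vector_derivative killing k (flow k s z)) (at s)"
  using assms
proof (cases rule: K_cases)
  case (1 b c)
  have "((\<lambda>s. s / (sqrt 2 * R1)) has_vector_derivative 1 / (sqrt 2 * R1)) (at s)"
    using R1 by (auto intro!: derivative_eq_intros simp: has_vector_derivative_def)
  from vector_diff_chain_at[OF this rot_derivative[OF 1(2,3), of "fst z"]]
  show ?thesis unfolding 1(1) by (auto intro!: has_vector_derivative_Pair simp: o_def)
next
  case (2 b c)
  have "((\<lambda>s. s / (sqrt 2 * R2)) has_vector_derivative 1 / (sqrt 2 * R2)) (at s)"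
    using R2 by (auto intro!: derivative_eq_intros simp: has_vector_derivative_def)
  from vector_diff_chain_at[OF this rot_derivative[OF 2(2,3), of "snd z"]]
  show ?thesis unfolding 2(1) by (auto intro!: has_vector_derivative_Pair simp: o_def)
qed

lemma compose_flow_derivative:
  assumes k: "k \<in> K" and z: "z \<in> M" and f: "\<And>y. y \<in> M \<Longrightarrow> f differentiable (at y within M)"
  shows "((\<lambda>s. f (flow k s z)) has_vector_derivative differential M f (flow k s z) (killing k (flow k s z))) (at s)"
proof -
  have y: "flow k s z \<in> M" using flow_in_M[OF k z] .
  have d: "(f has_derivative differential M f (flow k s z)) (at (flow k s z) within M)"
    by (rule differentiable_imp_has_derivative_differential[OF f[OF y]])
  have "(f has_derivative differential M f (flow k s z)) (at (flow k s z) within range (\<lambda>s. flow k s z))"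
    by (rule has_derivative_subset[OF d]) (use flow_in_M[OF k z] in auto)
  moreover have "((\<lambda>s. flow k s z) has_derivative (\<lambda>t. t *\<^sub>R killing k (flow k s z))) (at s)"
    using flow_derivative[OF k] unfolding has_vector_derivative_def .
  ultimately have "((\<lambda>s. f (flow k s z)) has_derivative
      (\<lambda>t. differential M f (flow k s z) (t *\<^sub>R killing k (flow k s z)))) (at s)"
    by (rule has_derivative_in_compose[rotated])
  then show ?thesis
    by (simp add: has_vector_derivative_def linear_cmul[OF has_derivative_linear[OF d]])
qed

definition vol :: "('a \<times> 'b) measure" where "vol = volume_measure M"

lemma M_borel: "M \<in> sets borel"
  using compact_M by (simp add: borel_compact)

lemma space_vol: "space vol = M"
  and sets_vol: "sets vol = sets (restrict_space borel M)"
  by (simp_all add: vol_def volume_measure_def space_restrict_space sets_restrict_space)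

lemma emeasure_vol: "A \<in> sets borel \<Longrightarrow> A \<subseteq> M \<Longrightarrow> emeasure vol A = hausdorff_outer (manifold_dim M) A"
  unfolding vol_def volume_measure_def
  by (subst emeasure_restrict_space) (auto simp: M_borel emeasure_hausdorff_measure)

lemma manifold_dim_M_add_2: "manifold_dim M + 2 = DIM('a) + DIM('b)"
  using DIM_positive[where 'a='a] DIM_positive[where 'a='b] unfolding manifold_dim_M by linarith

lemma finite_measure_vol: "finite_measure vol"
proof
  have "hausdorff_outer (manifold_dim M) M < top"
    unfolding M
    by (rule hausdorff_outer_clifford_torus_finite[OF R1 R2])
       (use manifold_dim_M_add_2 in \<open>simp add: M\<close>)
  then show "emeasure vol (space vol) \<noteq> \<infinity>"
    by (simp add: space_vol emeasure_vol M_borel)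
qed

lemma measure_vol_pos: "measure vol M > 0"
proof -
  interpret finite_measure vol by (rule finite_measure_vol)
  have "0 < hausdorff_outer (manifold_dim M) M"
    unfolding M
    by (rule hausdorff_outer_clifford_torus_pos[OF R1 R2])
       (use manifold_dim_M_add_2 in \<open>simp add: M\<close>)
  then have "0 < emeasure vol M" by (simp add: emeasure_vol M_borel)
  then show ?thesis by (simp add: emeasure_eq_measure)
qed

lemma measurable_vol: "continuous_on M f \<Longrightarrow> f \<in> borel_measurable vol"
  using borel_measurable_continuous_on_restrict[of M f] measurable_cong_sets[OF sets_vol refl] by blast

lemma bounded_on_M:
  fixes f :: "'a \<times> 'b \<Rightarrow> real"
  assumes "continuous_on M f"
  obtains C where "\<And>x. x \<in> M \<Longrightarrow> \<bar>f x\<bar> \<le> C"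
  using compact_imp_bounded[OF compact_continuous_image[OF assms compact_M]]
  unfolding bounded_iff by auto

lemma integrable_vol:
  fixes f :: "'a \<times> 'b \<Rightarrow> real"
  assumes "continuous_on M f" shows "integrable vol f"
proof -
  interpret finite_measure vol by (rule finite_measure_vol)
  obtain C where C: "\<And>x. x \<in> M \<Longrightarrow> \<bar>f x\<bar> \<le> C" by (rule bounded_on_M[OF assms]) (rule that)
  then show ?thesis
    using measurable_vol[OF assms] by (intro integrable_const_bound[of _ C] AE_I2) (auto simp: space_vol)
qed

lemma flow_continuous: "k \<in> K \<Longrightarrow> continuous_on A (flow k s)"
  unfolding continuous_on_iff by (auto simp: dist_flow)

lemma flow_image_M: assumes k: "k \<in> K" shows "flow k s -` A \<inter> M = flow k (- s) ` (A \<inter> M)"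
proof (intro equalityI subsetI)
  fix z assume "z \<in> flow k s -` A \<inter> M"
  then show "z \<in> flow k (- s) ` (A \<inter> M)"
    using flow_inverse[OF k, of s z] flow_in_M[OF k, of z s] by (intro image_eqI[of _ _ "flow k s z"]) auto
next
  fix z assume "z \<in> flow k (- s) ` (A \<inter> M)"
  then show "z \<in> flow k s -` A \<inter> M"
    using flow_inverse[OF k, of "- s"] flow_in_M[OF k] by auto
qed

text \<open>On \<open>M\<close> the preimage of a set under the flow is its image under the inverse
  flow. Both maps are isometries, so the two inequalities for outer measures make \<open>vol\<close>
  its own push-forward.\<close>

lemma integral_flow:
  fixes f :: "'a \<times> 'b \<Rightarrow> real"
  assumes k: "k \<in> K" and f: "f \<in> borel_measurable vol"
  shows "(\<integral>x. f (flow k s x) \<partial>vol) = (\<integral>x. f x \<partial>vol)"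
proof -
  have fm: "flow k s \<in> measurable vol vol"
  proof -
    have "flow k s \<in> measurable (restrict_space borel M) (restrict_space borel M)"
      using borel_measurable_continuous_on_restrict[OF flow_continuous[OF k]] flow_in_M[OF k]
      by (intro measurable_restrict_space2) (auto simp: space_restrict_space)
    then show ?thesis using measurable_cong_sets[OF sets_vol sets_vol] by blast
  qed
  have "distr vol vol (flow k s) = vol"
  proof (rule measure_eqI)
    fix A assume "A \<in> sets (distr vol vol (flow k s))"
    then have A: "A \<in> sets vol" by simp
    have AM: "A \<subseteq> M" using sets.sets_into_space[OF A] by (simp add: space_vol)
    have Ab: "A \<in> sets borel"
      using A M_borel by (auto simp: sets_vol sets_restrict_space)
    have eq: "flow k s -` A \<inter> M = flow k (- s) ` A" using flow_image_M[OF k, of s A] AM by (simp add: Int_absorb2)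
    have B: "flow k s -` A \<inter> M \<in> sets vol" using measurable_sets[OF fm A] by (simp add: space_vol)
    then have Bb: "flow k (- s) ` A \<in> sets borel"
      using M_borel unfolding eq by (auto simp: sets_vol sets_restrict_space)
    have "emeasure (distr vol vol (flow k s)) A = emeasure vol (flow k (- s) ` A)"
      using A fm eq by (simp add: emeasure_distr space_vol)
    also have "\<dots> = hausdorff_outer (manifold_dim M) (flow k (- s) ` A)"
      using eq by (intro emeasure_vol[OF Bb]) auto
    also have "\<dots> = hausdorff_outer (manifold_dim M) A"
    proof (rule antisym)
      show "hausdorff_outer (manifold_dim M) (flow k (- s) ` A) \<le> hausdorff_outer (manifold_dim M) A"
        by (rule hausdorff_outer_isometry[OF dist_flow[OF k]])
      have "flow k s ` (flow k (- s) ` A) = A"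
        using flow_inverse[OF k, of "- s"] by (simp add: image_image)
      then show "hausdorff_outer (manifold_dim M) A \<le> hausdorff_outer (manifold_dim M) (flow k (- s) ` A)"
        using hausdorff_outer_isometry[OF dist_flow[OF k, of s], of "manifold_dim M" "flow k (- s) ` A"] by simp
    qed
    also have "\<dots> = emeasure vol A" using emeasure_vol[OF Ab AM] by simp
    finally show "emeasure (distr vol vol (flow k s)) A = emeasure vol A" .
  qed simp
  then show ?thesis using integral_distr[OF fm f] by metis
qed

text \<open>The rotations preserve the volume, so the integral of \<open>f\<close> along the flow is constant.\<close>

lemma integral_differential_killing:
  fixes f :: "'a \<times> 'b \<Rightarrow> real"
  assumes k: "k \<in> K" and f: "smooth_on M f"
  shows "(\<integral>x. differential M f x (killing k x) \<partial>vol) = 0"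
proof -
  let ?F = "\<lambda>x. differential M f x (killing k x)"
  have cf: "continuous_on M f" and cF: "continuous_on M ?F"
    using f smooth_on_differential_killing[OF f] by (auto intro: smooth_on_continuous_on)
  obtain C where C: "\<And>x. x \<in> M \<Longrightarrow> \<bar>f x\<bar> \<le> C" by (rule bounded_on_M[OF cf]) (rule that)
  obtain C' where C': "\<And>x. x \<in> M \<Longrightarrow> \<bar>?F x\<bar> \<le> C'" by (rule bounded_on_M[OF cF]) (rule that)
  have cflow: "continuous_on M (\<lambda>x. h (flow k s x))" if "continuous_on M h" for h :: "'a \<times> 'b \<Rightarrow> real" and s
    using continuous_on_compose2[OF that flow_continuous[OF k]] flow_in_M[OF k] by blast
  have "((\<lambda>s. \<integral>x. f (flow k s x) \<partial>vol) has_real_derivative (\<integral>x. ?F (flow k 0 x) \<partial>vol)) (at 0)"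
  proof (rule has_real_derivative_integral[OF finite_measure_vol zero_less_one, where g' = "\<lambda>s x. ?F (flow k s x)" and C = C and C' = C'])
    show "((\<lambda>s. f (flow k s x)) has_real_derivative ?F (flow k s x)) (at s)" if "x \<in> space vol" for s x
      using compose_flow_derivative[OF k _ smooth_on_differentiable[OF f]] that
      by (simp add: space_vol has_real_derivative_iff_has_vector_derivative)
  qed (use C[OF flow_in_M[OF k]] C'[OF flow_in_M[OF k]] in \<open>auto simp: space_vol intro!: measurable_vol cflow cf cF\<close>)
  moreover have "(\<lambda>s. \<integral>x. f (flow k s x) \<partial>vol) = (\<lambda>s. \<integral>x. f x \<partial>vol)"
    using integral_flow[OF k measurable_vol[OF cf]] by auto
  ultimately have "(\<integral>x. ?F (flow k 0 x) \<partial>vol) = 0"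
    using DERIV_unique[OF _ DERIV_const] by force
  then show ?thesis by (simp add: flow_0)
qed

end

section \<open>Variations of the inclusion\<close>

lemma Ck_on_open_slice:
  fixes f :: "'t::real_normed_vector \<times> 'z::real_normed_vector \<Rightarrow> 'c::real_normed_vector"
  assumes "open U"
  shows "Ck_on_open k f U \<Longrightarrow> Ck_on_open k (\<lambda>x. f (t, x)) (Pair t -` U)"
proof (induction k arbitrary: f)
  case 0
  then show ?case
    by (auto intro!: continuous_on_compose2[of U f] continuous_intros)
next
  case (Suc k)
  have op: "open (Pair t -` U)"
    using assms by (intro open_vimage continuous_intros)
  show ?case
  proof (rule Ck_on_open_SucI[OF op, where f' = "\<lambda>x v. frechet_derivative f (at (t, x)) (0, v)"])
    fix x assume "x \<in> Pair t -` U"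
    then have d: "(f has_derivative frechet_derivative f (at (t, x))) (at (t, x))"
      using Ck_on_open_SucD[OF assms Suc.prems] by simp
    have "(Pair t has_derivative (\<lambda>v. (0, v))) (at x)"
      by (auto intro!: derivative_eq_intros)
    from has_derivative_compose[OF this d]
    show "((\<lambda>x. f (t, x)) has_derivative (\<lambda>v. frechet_derivative f (at (t, x)) (0, v))) (at x)" .
  next
    show "Ck_on_open k (\<lambda>x. frechet_derivative f (at (t, x)) (0, v)) (Pair t -` U)" for v
      using Suc.IH[of "\<lambda>z. frechet_derivative f (at z) (0, v)"] Suc.prems by simp
  qed
qed

lemma smooth_on_slice:
  assumes f: "smooth_on (I \<times> M) f" and t: "t \<in> I"
  shows "smooth_on M (\<lambda>x. f (t, x))"
  unfolding smooth_on_def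
proof
  fix x assume x: "x \<in> M"
  then obtain U g where U: "open U" "(t, x) \<in> U" "\<And>k. Ck_on_open k g U" "\<And>y. y \<in> U \<inter> I \<times> M \<Longrightarrow> f y = g y"
    using f t unfolding smooth_on_def by (metis mem_Sigma_iff)
  have "open (Pair t -` U)" using U(1) by (intro open_vimage continuous_intros)
  then show "\<exists>V h. open V \<and> x \<in> V \<and> (\<forall>k. Ck_on_open k h V) \<and> (\<forall>y\<in>V \<inter> M. f (t, y) = h y)"
    using U t Ck_on_open_slice[OF U(1) U(3)]
    by (intro exI[of _ "Pair t -` U"] exI[of _ "\<lambda>x. g (t, x)"]) auto
qed

lemma tangent_space_time:
  fixes \<epsilon> t :: real and x :: "'a::euclidean_space"
  assumes t: "t \<in> {-\<epsilon><..<\<epsilon>}" and x: "x \<in> M"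
  shows "(1, 0) \<in> tangent_space ({-\<epsilon><..<\<epsilon>} \<times> M) (t, x)"
proof -
  let ?\<gamma> = "\<lambda>s. (t + s, x)"
  have "(?\<gamma> has_vector_derivative (1, 0)) (at 0)"
    by (auto intro!: derivative_eq_intros simp: has_vector_derivative_def)
  then show ?thesis
    unfolding tangent_space_def using assms
    by (auto intro!: exI[of _ "\<epsilon> - \<bar>t\<bar>"] exI[of _ ?\<gamma>] smooth_on_intros)
qed

lemma tangent_space_slice:
  assumes t: "t \<in> I" and v: "v \<in> tangent_space M x"
  shows "(0, v) \<in> tangent_space (I \<times> M) (t, x)"
proof -
  obtain \<epsilon> \<gamma> where \<gamma>: "\<epsilon> > 0" "smooth_on {-\<epsilon><..<\<epsilon>} \<gamma>" "\<gamma> ` {-\<epsilon><..<\<epsilon>} \<subseteq> M" "\<gamma> 0 = x"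
    "(\<gamma> has_vector_derivative v) (at 0)"
    using v unfolding tangent_space_def mem_Collect_eq by (elim exE conjE) (rule that)
  have "((\<lambda>s. (t, \<gamma> s)) has_vector_derivative (0, v)) (at 0)"
    by (intro has_vector_derivative_Pair \<gamma> has_vector_derivative_const)
  then show ?thesis
    unfolding tangent_space_def using t \<gamma>
    by (auto intro!: exI[of _ \<epsilon>] exI[of _ "\<lambda>s. (t, \<gamma> s)"] smooth_on_intros)
qed

text \<open>The variation is one function on the product of the time interval and \<open>M\<close>.
  This product is again a subset of a Euclidean space, so the calculus of
  \<open>differential\<close> covers time and space derivatives alike.\<close>

locale torus_variation = clifford +
  fixes \<epsilon> :: real and u :: "real \<times> ('a \<times> 'b) \<Rightarrow> 'a \<times> 'b"
  assumes R12: "R1\<^sup>2 + R2\<^sup>2 = 1" and \<epsilon>: "\<epsilon> > 0"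
    and smooth_u: "smooth_on ({-\<epsilon><..<\<epsilon>} \<times> M) u"
    and norm_u: "\<And>z. z \<in> {-\<epsilon><..<\<epsilon>} \<times> M \<Longrightarrow> norm (u z) = 1"
    and u0: "\<And>x. x \<in> M \<Longrightarrow> u (0, x) = x"
begin

definition S :: "(real \<times> ('a \<times> 'b)) set" where "S = {-\<epsilon><..<\<epsilon>} \<times> M"

definition dk :: "'a \<times> 'a + 'b \<times> 'b \<Rightarrow> (real \<times> ('a \<times> 'b) \<Rightarrow> 'c::euclidean_space) \<Rightarrow> real \<times> ('a \<times> 'b) \<Rightarrow> 'c" where
  "dk k f z = differential S f z (0, killing k (snd z))"

definition dt :: "(real \<times> ('a \<times> 'b) \<Rightarrow> 'c::euclidean_space) \<Rightarrow> real \<times> ('a \<times> 'b) \<Rightarrow> 'c" where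
  "dt f z = differential S f z (1, 0)"

lemma S0: "x \<in> M \<Longrightarrow> (0, x) \<in> S" using \<epsilon> by (simp add: S_def)

lemma tangent_t: "z \<in> S \<Longrightarrow> (1, 0) \<in> tangent_space S z"
  unfolding S_def using tangent_space_time by (cases z) auto

lemma tangent_k: "z \<in> S \<Longrightarrow> (0, killing k (snd z)) \<in> tangent_space S z"
  unfolding S_def
  by (cases z) (auto intro!: tangent_space_slice killing_tangent)

lemma bounded_linear_killing_snd: "bounded_linear (\<lambda>z. (0::real, killing k (snd (z :: real \<times> ('a \<times> 'b)))))"
  by (intro bounded_linear_Pair bounded_linear_zero bounded_linear_compose[OF bounded_linear_killing] bounded_linear_snd)

lemma smooth_dk: "smooth_on S f \<Longrightarrow> smooth_on S (dk k f)"
  unfolding dk_def[abs_def]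
  by (rule smooth_on_differential[OF _ smooth_on_linear[OF bounded_linear_killing_snd] tangent_k])

lemma smooth_dt: "smooth_on S f \<Longrightarrow> smooth_on S (dt f)"
  unfolding dt_def[abs_def]
  by (rule smooth_on_differential[OF _ smooth_on_const tangent_t])

text \<open>The space field does not depend on time and the time field is constant, so their bracket
  vanishes and \<open>differential_commute\<close> applies.\<close>

lemma dt_dk:
  assumes f: "smooth_on S f" and z: "z \<in> S"
  shows "dt (dk k f) z = dk k (dt f) z"
proof -
  have "dt (dk k f) z = differential S (\<lambda>y. differential S f y (0, killing k (snd y))) z (1, 0)"
    by (simp add: dt_def dk_def[abs_def])
  also have "\<dots> = differential S (\<lambda>y. differential S f y (1, 0)) z (0, killing k (snd z))"
  proof (rule differential_commute[OF f smooth_on_linear[OF bounded_linear_killing_snd] tangent_k smooth_on_const tangent_t z])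
    show "differential S (\<lambda>y. (0 :: real, killing k (snd y))) z (1, 0) = differential S (\<lambda>y. (1, 0)) z (0, killing k (snd z))"
    proof (rule trans)
      show "differential S (\<lambda>y. (0 :: real, killing k (snd y))) z (1, 0) = (0, killing k (snd (1 :: real, 0)))"
        by (rule differential_linear[OF tangent_t[OF z] bounded_linear_killing_snd])
      have "killing k (snd (1 :: real, 0)) = 0"
        unfolding snd_conv by (rule linear_0[OF bounded_linear.linear[OF bounded_linear_killing]])
      moreover have "differential S (\<lambda>y. (1 :: real, 0 :: 'a \<times> 'b)) z (0, killing k (snd z)) = 0"
        by (rule differential_const[OF tangent_k[OF z]])
      ultimately show "(0, killing k (snd (1 :: real, 0))) = differential S (\<lambda>y. (1 :: real, 0)) z (0, killing k (snd z))"
        by (simp only: zero_prod_def[where 'a=real])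
    qed
  qed
  also have "\<dots> = dk k (dt f) z" by (simp add: dk_def dt_def[abs_def])
  finally show ?thesis .
qed

lemma smooth_slice: "smooth_on S f \<Longrightarrow> t \<in> {-\<epsilon><..<\<epsilon>} \<Longrightarrow> smooth_on M (\<lambda>x. f (t, x))"
  unfolding S_def by (rule smooth_on_slice)

lemma dk_slice:
  assumes f: "smooth_on S f" and t: "t \<in> {-\<epsilon><..<\<epsilon>}" and x: "x \<in> M"
  shows "differential M (\<lambda>x. f (t, x)) x (killing k x) = dk k f (t, x)"
proof -
  have z: "(t, x) \<in> S" using t x by (simp add: S_def)
  have d: "(f has_derivative differential S f (t, x)) (at (t, x) within S)"
    by (rule differentiable_imp_has_derivative_differential[OF smooth_on_differentiable[OF f z]])
  have "(f has_derivative differential S f (t, x)) (at (t, x) within Pair t ` M)"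
    by (rule has_derivative_subset[OF d]) (use t in \<open>auto simp: S_def\<close>)
  moreover have "(Pair t has_derivative (\<lambda>v. (0, v))) (at x within M)"
    by (auto intro!: derivative_eq_intros)
  ultimately have "((\<lambda>x. f (t, x)) has_derivative (\<lambda>v. differential S f (t, x) (0, v))) (at x within M)"
    by (rule has_derivative_in_compose[rotated])
  from differential_eqI[OF killing_tangent[OF x] this] show ?thesis by (simp add: dk_def)
qed

lemma dt_derivative:
  assumes f: "smooth_on S f" and t: "t \<in> {-\<epsilon><..<\<epsilon>}" and x: "x \<in> M"
  shows "((\<lambda>t. f (t, x)) has_vector_derivative dt f (t, x)) (at t)"
proof -
  have z: "(t, x) \<in> S" using t x by (simp add: S_def)
  have d: "(f has_derivative differential S f (t, x)) (at (t, x) within S)"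
    by (rule differentiable_imp_has_derivative_differential[OF smooth_on_differentiable[OF f z]])
  have "(f has_derivative differential S f (t, x)) (at (t, x) within (\<lambda>t. (t, x)) ` {-\<epsilon><..<\<epsilon>})"
    by (rule has_derivative_subset[OF d]) (use x in \<open>auto simp: S_def\<close>)
  moreover have "((\<lambda>t. (t, x)) has_derivative (\<lambda>s. s *\<^sub>R (1, 0))) (at t within {-\<epsilon><..<\<epsilon>})"
    by (auto intro!: derivative_eq_intros)
  ultimately have "((\<lambda>t. f (t, x)) has_derivative (\<lambda>s. differential S f (t, x) (s *\<^sub>R (1, 0)))) (at t within {-\<epsilon><..<\<epsilon>})"
    by (rule has_derivative_in_compose[rotated])
  then show ?thesis
    unfolding at_within_open[OF t open_greaterThanLessThan] has_vector_derivative_def dt_def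
      linear_cmul[OF has_derivative_linear[OF d]] .
qed

text \<open>At time 0 the sections in question are restrictions of linear maps \<open>g\<close>. The
  direction \<open>(0, killing k x)\<close> stays in the slice of time 0, so these values alone
  determine the derivative.\<close>

lemma dk_at_0:
  assumes f: "smooth_on S f" and g: "bounded_linear g" "\<forall>x\<in>M. f (0, x) = g x" and x: "x \<in> M"
  shows "dk k f (0, x) = g (killing k x)"
proof -
  have "dk k f (0, x) = differential M (\<lambda>x. f (0, x)) x (killing k x)"
    using dk_slice[OF f _ x, of 0 k] \<epsilon> by simp
  also have "\<dots> = differential M g x (killing k x)"
    using differential_cong[OF open_UNIV, of x M "\<lambda>x. f (0, x)" g] g(2) x by simp
  also have "\<dots> = g (killing k x)" by (rule differential_linear[OF killing_tangent[OF x] g(1)])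
  finally show ?thesis .
qed

lemma d_cong:
  assumes "z \<in> S" "\<And>y. y \<in> S \<Longrightarrow> f y = g y"
  shows "dk k f z = dk k g z" "dt f z = dt g z"
  using differential_cong[OF open_UNIV, of z S f g] assms by (simp_all add: dk_def dt_def)

lemma d_add:
  assumes "smooth_on S f" "smooth_on S g" "z \<in> S"
  shows "dk k (\<lambda>z. f z + g z) z = dk k f z + dk k g z" "dt (\<lambda>z. f z + g z) z = dt f z + dt g z"
  unfolding dk_def dt_def
  by (rule differential_add[OF tangent_k[OF assms(3)] smooth_on_differentiable[OF assms(1,3)] smooth_on_differentiable[OF assms(2,3)]])
     (rule differential_add[OF tangent_t[OF assms(3)] smooth_on_differentiable[OF assms(1,3)] smooth_on_differentiable[OF assms(2,3)]])

lemma d_diff: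
  assumes "smooth_on S f" "smooth_on S g" "z \<in> S"
  shows "dk k (\<lambda>z. f z - g z) z = dk k f z - dk k g z"
  unfolding dk_def
  by (rule differential_diff[OF tangent_k[OF assms(3)] smooth_on_differentiable[OF assms(1,3)] smooth_on_differentiable[OF assms(2,3)]])

lemma d_minus:
  assumes "smooth_on S f" "z \<in> S"
  shows "dt (\<lambda>z. - f z) z = - dt f z"
  unfolding dt_def
  by (rule differential_linear_compose[OF tangent_t[OF assms(2)] bounded_linear_minus[OF bounded_linear_ident] smooth_on_differentiable[OF assms]])

lemma d_sum:
  assumes "\<And>i. i \<in> I \<Longrightarrow> smooth_on S (f i)" "z \<in> S"
  shows "dt (\<lambda>z. \<Sum>i\<in>I. f i z) z = (\<Sum>i\<in>I. dt (f i) z)"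
  unfolding dt_def
  by (rule differential_sum[OF tangent_t[OF assms(2)] smooth_on_differentiable[OF assms(1) assms(2)]])

lemma d_inner:
  assumes "smooth_on S f" "smooth_on S g" "z \<in> S"
  shows "dk k (\<lambda>z. f z \<bullet> g z) z = f z \<bullet> dk k g z + dk k f z \<bullet> g z"
    "dt (\<lambda>z. f z \<bullet> g z) z = f z \<bullet> dt g z + dt f z \<bullet> g z"
  unfolding dk_def dt_def
  by (rule differential_inner[OF tangent_k[OF assms(3)] smooth_on_differentiable[OF assms(1,3)] smooth_on_differentiable[OF assms(2,3)]])
     (rule differential_inner[OF tangent_t[OF assms(3)] smooth_on_differentiable[OF assms(1,3)] smooth_on_differentiable[OF assms(2,3)]])

lemma d_scaleR:
  assumes "smooth_on S f" "smooth_on S g" "z \<in> S"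
  shows "dk k (\<lambda>z. f z *\<^sub>R g z) z = f z *\<^sub>R dk k g z + dk k f z *\<^sub>R g z"
    "dt (\<lambda>z. f z *\<^sub>R g z) z = f z *\<^sub>R dt g z + dt f z *\<^sub>R g z"
  unfolding dk_def dt_def
  by (rule differential_scaleR[OF tangent_k[OF assms(3)] smooth_on_differentiable[OF assms(1,3)] smooth_on_differentiable[OF assms(2,3)]])
     (rule differential_scaleR[OF tangent_t[OF assms(3)] smooth_on_differentiable[OF assms(1,3)] smooth_on_differentiable[OF assms(2,3)]])

lemma d_const:
  assumes "z \<in> S" shows "dk k (\<lambda>z. c) z = 0" "dt (\<lambda>z. c) z = 0"
  unfolding dk_def dt_def
  by (rule differential_const[OF tangent_k[OF assms]]) (rule differential_const[OF tangent_t[OF assms]])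

lemma d_linear_snd:
  assumes h: "bounded_linear h" and z: "z \<in> S"
  shows "dk k (\<lambda>z. h (snd z)) z = h (killing k (snd z))" "dt (\<lambda>z. h (snd z)) z = 0"
proof -
  have b: "bounded_linear (\<lambda>z :: real \<times> ('a \<times> 'b). h (snd z))"
    by (rule bounded_linear_compose[OF h bounded_linear_snd])
  show "dk k (\<lambda>z. h (snd z)) z = h (killing k (snd z))"
    using differential_linear[OF tangent_k[OF z] b] by (simp add: dk_def)
  show "dt (\<lambda>z. h (snd z)) z = 0"
    using differential_linear[OF tangent_t[OF z] b] linear_0[OF bounded_linear.linear[OF h]] by (simp add: dt_def)
qed

section \<open>Covariant derivatives along the variation and the normal field\<close>

lemma su: "smooth_on S u" using smooth_u by (simp add: S_def)

lemma u_unit: "z \<in> S \<Longrightarrow> u z \<bullet> u z = 1" using norm_u by (simp add: S_def dot_square_norm)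

lemma d_u_orthogonal:
  assumes z: "z \<in> S" shows "dk k u z \<bullet> u z = 0" "dt u z \<bullet> u z = 0"
proof -
  have "dk k (\<lambda>z. u z \<bullet> u z) z = 0" "dt (\<lambda>z. u z \<bullet> u z) z = 0"
    using d_cong[OF z, of "\<lambda>z. u z \<bullet> u z" "\<lambda>z. 1"] d_const[OF z] u_unit by simp_all
  then show "dk k u z \<bullet> u z = 0" "dt u z \<bullet> u z = 0"
    using d_inner[OF su su z] by (simp_all add: inner_commute)
qed

definition Dk :: "'a \<times> 'a + 'b \<times> 'b \<Rightarrow> (real \<times> ('a \<times> 'b) \<Rightarrow> 'a \<times> 'b) \<Rightarrow> real \<times> ('a \<times> 'b) \<Rightarrow> 'a \<times> 'b" where
  "Dk k V z = sphere_proj (u z) (dk k V z)"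

lemma smooth_Dk: "smooth_on S V \<Longrightarrow> smooth_on S (Dk k V)"
  unfolding Dk_def[abs_def] by (intro smooth_on_sphere_proj su smooth_dk)

lemma Dk_orthogonal: "z \<in> S \<Longrightarrow> Dk k V z \<bullet> u z = 0"
  unfolding Dk_def using norm_u by (intro sphere_proj_inner) (simp add: S_def)

text \<open>Gauss formula of the unit sphere: differentiating \<open>V \<bullet> u = 0\<close> gives
  the component of \<open>dk k V\<close> along \<open>u\<close> in terms of the first derivative of
  \<open>u\<close>.\<close>

lemma Dk_tangent:
  assumes V: "smooth_on S V" "\<forall>z\<in>S. V z \<bullet> u z = 0" and z: "z \<in> S"
  shows "Dk k V z = dk k V z + (V z \<bullet> dk k u z) *\<^sub>R u z"
proof -
  have "dk k (\<lambda>z. V z \<bullet> u z) z = 0"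
    using d_cong(1)[OF z, of "\<lambda>z. V z \<bullet> u z" "\<lambda>z. 0" k] V(2) d_const(1)[OF z] by simp
  then have "dk k V z \<bullet> u z = - (V z \<bullet> dk k u z)"
    using d_inner(1)[OF V(1) su z] by simp
  then show ?thesis by (simp add: Dk_def sphere_proj_def)
qed

text \<open>Here \<open>dt\<close> is the ambient time derivative. The term along
  \<open>dt u\<close> is one part of the curvature of the sphere; the other part hides in the
  component of \<open>dt V\<close> along \<open>u\<close>. The term along \<open>u\<close> drops out
  of pairings with vectors orthogonal to \<open>u\<close>.\<close>

lemma dt_Dk:
  assumes V: "smooth_on S V" "\<forall>z\<in>S. V z \<bullet> u z = 0" and z: "z \<in> S"
  shows "dt (Dk k V) z = dk k (dt V) z + ((V z \<bullet> dk k u z) *\<^sub>R dt u z + dt (\<lambda>z. V z \<bullet> dk k u z) z *\<^sub>R u z)"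
proof -
  have s: "smooth_on S (\<lambda>z. V z \<bullet> dk k u z)" by (intro smooth_on_inner V smooth_dk su)
  have "dt (Dk k V) z = dt (\<lambda>z. dk k V z + (V z \<bullet> dk k u z) *\<^sub>R u z) z"
    by (rule d_cong(2)[OF z]) (rule Dk_tangent[OF V])
  also have "\<dots> = dt (dk k V) z + dt (\<lambda>z. (V z \<bullet> dk k u z) *\<^sub>R u z) z"
    by (rule d_add(2)[OF smooth_dk[OF V(1)] smooth_on_scaleR[OF s su] z])
  finally show ?thesis by (simp only: dt_dk[OF V(1) z] d_scaleR(2)[OF s su z])
qed

lemma dk_u_0: "x \<in> M \<Longrightarrow> dk k u (0, x) = killing k x"
  by (rule dk_at_0[OF su bounded_linear_ident]) (simp_all add: u0)

text \<open>\<open>R1 * R2\<close> times \<open>L\<close> is the unit normal of the torus in the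
  unit sphere. With this scaling the two factors contribute 1 and -1 to
  \<open>L z \<bullet> z\<close> on \<open>M\<close>, and no square roots enter the
  coefficients.\<close>

definition L :: "'a \<times> 'b \<Rightarrow> 'a \<times> 'b" where
  "L z = ((1 / R1\<^sup>2) *\<^sub>R fst z, (- (1 / R2\<^sup>2)) *\<^sub>R snd z)"

lemma bounded_linear_L: "bounded_linear L"
  unfolding L_def[abs_def]
  by (intro bounded_linear_Pair bounded_linear_compose[OF bounded_linear_scaleR_right] bounded_linear_fst bounded_linear_snd)

lemmas linear_L = bounded_linear.linear[OF bounded_linear_L]

lemma L_orthogonal: "x \<in> M \<Longrightarrow> L x \<bullet> x = 0" "x \<in> M \<Longrightarrow> x \<bullet> L x = 0"
  using R1 R2 by (simp_all add: L_def inner_prod_def inner_M)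

lemma L_killing: "L x \<bullet> killing k x = 0" "x \<bullet> L (killing k x) = 0"
  using killing_fst_snd[of k x] by (simp_all add: L_def inner_prod_def inner_commute)

text \<open>Up to orientation, the principal curvatures of the torus are \<open>R2 / R1\<close>,
  with multiplicity \<open>p\<close>, and \<open>- R1 / R2\<close>, with multiplicity
  \<open>q\<close>. So \<open>lam\<close> is the squared length of the second fundamental form and
  \<open>c_tau / (R1 * R2)\<close> is, up to sign, its trace. The constant \<open>sig\<close> is the
  trace of \<open>L\<close> on the tangent space of the torus.\<close>

definition c_tau :: real where "c_tau = q * R1\<^sup>2 - p * R2\<^sup>2"
definition lam :: real where "lam = p * R2\<^sup>2 / R1\<^sup>2 + q * R1\<^sup>2 / R2\<^sup>2"
definition sig :: real where "sig = p / R1\<^sup>2 - q / R2\<^sup>2"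

text \<open>Both sides act as scalars on each factor, and the two scalar equations follow from
  \<open>R1\<^sup>2 + R2\<^sup>2 = 1\<close>. The splitting separates a normal part, tangent to the
  sphere on the torus, from a radial part.\<close>

lemma L_sum_killing_square: "L (\<Sum>k\<in>K. killing k (killing k z)) = - (lam *\<^sub>R L z) - sig *\<^sub>R z"
proof -
  define a b where "a = R1\<^sup>2" and "b = R2\<^sup>2"
  have ab: "a > 0" "b > 0" "a + b = 1" using R1 R2 R12 by (simp_all add: a_def b_def)
  have b': "b = 1 - a" using ab by simp
  have 1: "- (p / a) / a = - (lam / a) - sig"
    using ab unfolding lam_def sig_def a_def[symmetric] b_def[symmetric]
    by (simp add: divide_simps) (use b' in algebra)
  have 2: "q / b / b = lam / b - sig"
    using ab unfolding lam_def sig_def a_def[symmetric] b_def[symmetric]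
    by (simp add: divide_simps) (use b' in algebra)
  show ?thesis
    unfolding sum_killing_square
  proof (rule prod_eqI)
    have "fst (L (- (p / R1\<^sup>2) *\<^sub>R fst z, - (q / R2\<^sup>2) *\<^sub>R snd z)) = (- (p / a) / a) *\<^sub>R fst z"
      by (simp add: L_def a_def)
    also have "\<dots> = fst (- (lam *\<^sub>R L z) - sig *\<^sub>R z)"
      unfolding 1 by (simp add: L_def a_def scaleR_left_diff_distrib)
    finally show "fst (L (- (p / R1\<^sup>2) *\<^sub>R fst z, - (q / R2\<^sup>2) *\<^sub>R snd z)) = fst (- (lam *\<^sub>R L z) - sig *\<^sub>R z)" .
    have "snd (L (- (p / R1\<^sup>2) *\<^sub>R fst z, - (q / R2\<^sup>2) *\<^sub>R snd z)) = (q / b / b) *\<^sub>R snd z"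
      by (simp add: L_def b_def)
    also have "\<dots> = snd (- (lam *\<^sub>R L z) - sig *\<^sub>R z)"
      unfolding 2 by (simp add: L_def b_def scaleR_left_diff_distrib)
    finally show "snd (L (- (p / R1\<^sup>2) *\<^sub>R fst z, - (q / R2\<^sup>2) *\<^sub>R snd z)) = snd (- (lam *\<^sub>R L z) - sig *\<^sub>R z)" .
  qed
qed

lemma sum_inner_L_killing_square:
  "(\<Sum>k\<in>K. v \<bullet> L (killing k (killing k x))) = - lam * (v \<bullet> L x) - sig * (v \<bullet> x)"
proof -
  have "(\<Sum>k\<in>K. v \<bullet> L (killing k (killing k x))) = v \<bullet> L (\<Sum>k\<in>K. killing k (killing k x))"
    by (simp add: linear_sum[OF linear_L] inner_sum_right)
  then show ?thesis by (simp add: L_sum_killing_square inner_diff_right)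
qed

lemma sum_L_killing_inner: "x \<in> M \<Longrightarrow> (\<Sum>k\<in>K. L (killing k x) \<bullet> killing k x) = sig"
  using sum_killing_norm[of x "1 / R1\<^sup>2" "- (1 / R2\<^sup>2)"] by (simp add: L_def sig_def)

lemma sum_killing_inner: "x \<in> M \<Longrightarrow> (\<Sum>k\<in>K. killing k x \<bullet> killing k x) = p + q"
  using sum_killing_norm[of x 1 1] by simp

lemma bounded_linear_L_killing: "bounded_linear (\<lambda>x. L (killing k x))"
  by (rule bounded_linear_compose[OF bounded_linear_L bounded_linear_killing])

lemma smooth_linear_snd: "bounded_linear h \<Longrightarrow> smooth_on S (\<lambda>z. h (snd z))"
  by (rule smooth_on_linear[OF bounded_linear_compose[OF _ bounded_linear_snd]])

lemma dk_inner_linear: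
  assumes "smooth_on S V" "bounded_linear h" "x \<in> M"
  shows "dk k (\<lambda>z. V z \<bullet> h (snd z)) (0, x) = V (0, x) \<bullet> h (killing k x) + dk k V (0, x) \<bullet> h x"
  using d_inner(1)[OF assms(1) smooth_linear_snd[OF assms(2)] S0[OF assms(3)]]
    d_linear_snd(1)[OF assms(2) S0[OF assms(3)]] by simp

text \<open>Pointwise form of integration by parts: the Leibniz rule moves \<open>dk k\<close> onto
  \<open>L\<close> and leaves a term with integral zero. The correction along \<open>u\<close>
  vanishes because \<open>L x\<close> is orthogonal to \<open>x\<close>.\<close>

lemma dt_Dk_inner_L:
  assumes Y: "smooth_on S Y" "\<forall>z\<in>S. Y z \<bullet> u z = 0" and x: "x \<in> M"
  shows "dt (Dk k Y) (0, x) \<bullet> L x = dk k (\<lambda>z. dt Y z \<bullet> L (snd z)) (0, x)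
     - dt Y (0, x) \<bullet> L (killing k x) + (Y (0, x) \<bullet> killing k x) * (dt u (0, x) \<bullet> L x)"
  unfolding dt_Dk[OF Y S0[OF x]] dk_inner_linear[OF smooth_dt[OF Y(1)] bounded_linear_L x]
  using L_orthogonal[OF x] by (simp add: inner_add_left dk_u_0[OF x] u0[OF x])

text \<open>At time 0 \<open>V\<close> is parallel to \<open>L\<close>, hence orthogonal to
  \<open>killing k x\<close>, and \<open>L (killing k x)\<close> is orthogonal to \<open>x\<close>.
  So both correction terms of \<open>dt_Dk\<close> disappear.\<close>

lemma dt_Dk_inner_L_killing:
  assumes V: "smooth_on S V" "\<forall>z\<in>S. V z \<bullet> u z = 0" and x: "x \<in> M"
    and V0: "V (0, x) = w *\<^sub>R L x"
  shows "dt (Dk k V) (0, x) \<bullet> L (killing k x) = dk k (\<lambda>z. dt V z \<bullet> L (killing k (snd z))) (0, x)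
     - dt V (0, x) \<bullet> L (killing k (killing k x))"
  unfolding dt_Dk[OF V S0[OF x]] dk_inner_linear[OF smooth_dt[OF V(1)] bounded_linear_L_killing x]
  using L_killing[of x k] by (simp add: inner_add_left dk_u_0[OF x] u0[OF x] V0)

text \<open>This radial component, obtained by differentiating \<open>V \<bullet> u = 0\<close> in
  time, is the second place where the curvature of the sphere enters.\<close>

lemma dt_inner_u_0:
  assumes V: "smooth_on S V" "\<forall>z\<in>S. V z \<bullet> u z = 0" and x: "x \<in> M"
    and V0: "V (0, x) = w *\<^sub>R L x"
  shows "dt V (0, x) \<bullet> x = - w * (dt u (0, x) \<bullet> L x)"
proof -
  have "dt (\<lambda>z. V z \<bullet> u z) (0, x) = 0"
    using d_cong(2)[OF S0[OF x], of "\<lambda>z. V z \<bullet> u z" "\<lambda>z. 0"] V(2) d_const(2)[OF S0[OF x]] by simp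
  then show ?thesis
    using d_inner(2)[OF V(1) su S0[OF x]] by (simp add: u0[OF x] V0 inner_commute)
qed

lemma Dk_0:
  assumes V: "smooth_on S V" and x: "x \<in> M" and V0: "\<forall>x\<in>M. V (0, x) = w *\<^sub>R L x"
  shows "Dk k V (0, x) = w *\<^sub>R L (killing k x)"
proof -
  have b: "bounded_linear (\<lambda>x. w *\<^sub>R L x)"
    by (rule bounded_linear_compose[OF bounded_linear_scaleR_right bounded_linear_L])
  have "dk k V (0, x) = w *\<^sub>R L (killing k x)"
    by (rule dk_at_0[OF V b V0 x])
  moreover have "w *\<^sub>R L (killing k x) \<bullet> x = 0"
    using L_killing(2)[of x k] by (simp add: inner_commute)
  ultimately show ?thesis by (simp add: Dk_def u0[OF x] sphere_proj_tangent)
qed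

text \<open>The projection to the sphere removes the radial part of
  \<open>L_sum_killing_square\<close>, so \<open>L\<close> becomes an eigensection.\<close>

lemma Dk_Dk_0:
  assumes V: "smooth_on S V" and x: "x \<in> M" and V0: "\<forall>x\<in>M. V (0, x) = w *\<^sub>R L x"
  shows "(\<Sum>k\<in>K. Dk k (Dk k V) (0, x)) = - (lam * w) *\<^sub>R L x"
proof -
  have b: "bounded_linear (\<lambda>x. w *\<^sub>R L (killing k x))" for k
    by (rule bounded_linear_compose[OF bounded_linear_scaleR_right bounded_linear_L_killing])
  have "Dk k (Dk k V) (0, x) = sphere_proj x (w *\<^sub>R L (killing k (killing k x)))" for k
  proof -
    have "\<forall>x\<in>M. Dk k V (0, x) = w *\<^sub>R L (killing k x)" using Dk_0[OF V _ V0] by blast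
    from dk_at_0[OF smooth_Dk[OF V] b this x, of k] show ?thesis by (subst Dk_def) (simp add: u0[OF x])
  qed
  then have "(\<Sum>k\<in>K. Dk k (Dk k V) (0, x)) = sphere_proj x (w *\<^sub>R L (\<Sum>k\<in>K. killing k (killing k x)))"
    by (simp add: linear_sum[OF linear_sphere_proj] linear_sum[OF linear_L] scaleR_sum_right)
  also have "\<dots> = - (lam * w) *\<^sub>R L x"
  proof -
    have "x \<bullet> x = 1" using u_unit[OF S0[OF x]] by (simp add: u0[OF x])
    then show ?thesis
      unfolding L_sum_killing_square sphere_proj_def
      using L_orthogonal[OF x] by (simp add: inner_diff_left algebra_simps)
  qed
  finally show ?thesis .
qed

section \<open>Integrated first-variation identities for the tension field and its
  Laplacians\<close>

definition Int0 :: "(real \<times> ('a \<times> 'b) \<Rightarrow> real) \<Rightarrow> real" where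
  "Int0 f = (\<integral>x. f (0, x) \<partial>vol)"

lemma integrable_slice:
  fixes f :: "real \<times> ('a \<times> 'b) \<Rightarrow> real"
  assumes "smooth_on S f" shows "integrable vol (\<lambda>x. f (0, x))"
  by (rule integrable_vol, rule smooth_on_continuous_on, rule smooth_slice[OF assms]) (use \<epsilon> in simp)

lemma Int0_dk:
  fixes f :: "real \<times> ('a \<times> 'b) \<Rightarrow> real"
  assumes k: "k \<in> K" and f: "smooth_on S f"
  shows "Int0 (dk k f) = 0"
proof -
  have "Int0 (dk k f) = (\<integral>x. differential M (\<lambda>x. f (0, x)) x (killing k x) \<partial>vol)"
    unfolding Int0_def by (rule Bochner_Integration.integral_cong[OF refl])
      (use dk_slice[OF f, of 0] \<epsilon> in \<open>simp add: space_vol\<close>)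
  also have "\<dots> = 0"
    by (rule integral_differential_killing[OF k smooth_slice[OF f]]) (use \<epsilon> in simp)
  finally show ?thesis .
qed

text \<open>Common shape of the identities below: a sum of Killing derivatives, which integrates to
  zero, plus multiples of two scalar functions.\<close>

lemma Int0_divergence:
  assumes f: "\<And>k. k \<in> K \<Longrightarrow> smooth_on S (f k)" and g: "smooth_on S g" and g': "smooth_on S g'"
    and eq: "\<And>x. x \<in> M \<Longrightarrow> h (0, x) = (\<Sum>k\<in>K. dk k (f k) (0, x)) + \<alpha> * g (0, x) + \<beta> * g' (0, x)"
  shows "Int0 h = \<alpha> * Int0 g + \<beta> * Int0 g'"
proof -
  have "Int0 h = (\<integral>x. (\<Sum>k\<in>K. dk k (f k) (0, x)) + \<alpha> * g (0, x) + \<beta> * g' (0, x) \<partial>vol)"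
    unfolding Int0_def by (rule Bochner_Integration.integral_cong[OF refl]) (simp add: space_vol eq)
  also have "\<dots> = (\<Sum>k\<in>K. Int0 (dk k (f k))) + \<alpha> * Int0 g + \<beta> * Int0 g'"
    unfolding Int0_def using integrable_slice[OF smooth_dk[OF f]] integrable_slice[OF g] integrable_slice[OF g']
    by (simp add: Bochner_Integration.integral_add Bochner_Integration.integral_sum)
  also have "(\<Sum>k\<in>K. Int0 (dk k (f k))) = 0"
    using Int0_dk f by simp
  finally show ?thesis by simp
qed

definition J :: real where "J = Int0 (\<lambda>z. dt u z \<bullet> L (snd z))"

definition lap :: "(real \<times> ('a \<times> 'b) \<Rightarrow> 'a \<times> 'b) \<Rightarrow> real \<times> ('a \<times> 'b) \<Rightarrow> 'a \<times> 'b" where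
  "lap V z = - (\<Sum>k\<in>K. Dk k (Dk k V) z)"

definition tau :: "real \<times> ('a \<times> 'b) \<Rightarrow> 'a \<times> 'b" where
  "tau z = (\<Sum>k\<in>K. Dk k (dk k u) z)"

lemma smooth_dt_L: "smooth_on S V \<Longrightarrow> smooth_on S (\<lambda>z. dt V z \<bullet> L (snd z))"
  by (intro smooth_on_inner smooth_dt smooth_linear_snd bounded_linear_L)

lemma smooth_dt_L_killing: "smooth_on S V \<Longrightarrow> smooth_on S (\<lambda>z. dt V z \<bullet> L (killing k (snd z)))"
  by (intro smooth_on_inner smooth_dt smooth_linear_snd[OF bounded_linear_L_killing])

lemma smooth_lap: "smooth_on S V \<Longrightarrow> smooth_on S (lap V)"
  unfolding lap_def[abs_def]
  by (intro smooth_on_linear_compose[OF bounded_linear_minus[OF bounded_linear_ident]] smooth_on_sum smooth_Dk)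

lemma smooth_tau: "smooth_on S tau"
  unfolding tau_def[abs_def] by (intro smooth_on_sum smooth_Dk smooth_dk su)

lemma lap_orthogonal: "z \<in> S \<Longrightarrow> lap V z \<bullet> u z = 0"
  by (simp add: lap_def inner_sum_left Dk_orthogonal)

lemma tau_orthogonal: "z \<in> S \<Longrightarrow> tau z \<bullet> u z = 0"
  by (simp add: tau_def inner_sum_left Dk_orthogonal)

lemma lap_0:
  assumes "smooth_on S V" "x \<in> M" "\<forall>x\<in>M. V (0, x) = w *\<^sub>R L x"
  shows "lap V (0, x) = (lam * w) *\<^sub>R L x"
  using Dk_Dk_0[OF assms] by (simp add: lap_def)

lemma dt_dk_u_inner_L_killing:
  assumes x: "x \<in> M"
  shows "dt (dk k u) (0, x) \<bullet> L (killing k x) = dk k (\<lambda>z. dt u z \<bullet> L (killing k (snd z))) (0, x)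
     - dt u (0, x) \<bullet> L (killing k (killing k x))"
  unfolding dt_dk[OF su S0[OF x]] dk_inner_linear[OF smooth_dt[OF su] bounded_linear_L_killing x] by simp

lemma dt_u_inner_0: "x \<in> M \<Longrightarrow> dt u (0, x) \<bullet> x = 0"
  using d_u_orthogonal(2)[OF S0, of x] by (simp add: u0)

text \<open>The Leibniz rule moves both space derivatives from \<open>dt u\<close> onto
  \<open>L\<close>, which gives \<open>- lam\<close>; the radial part is invisible to
  \<open>dt u\<close>. The commutation term along \<open>dt u\<close> adds the trace
  \<open>p + q\<close>.\<close>

lemma dt_tau_inner_L:
  assumes x: "x \<in> M"
  shows "dt tau (0, x) \<bullet> L x
     = (\<Sum>k\<in>K. dk k (\<lambda>z. dt (dk k u) z \<bullet> L (snd z) - dt u z \<bullet> L (killing k (snd z))) (0, x))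
      + (p + q - lam) * (dt u (0, x) \<bullet> L x)"
proof -
  have o: "\<forall>z\<in>S. dk k u z \<bullet> u z = 0" for k using d_u_orthogonal(1) by blast
  have "dt tau (0, x) = (\<Sum>k\<in>K. dt (Dk k (dk k u)) (0, x))"
    unfolding tau_def[abs_def] by (rule d_sum[OF smooth_Dk[OF smooth_dk[OF su]] S0[OF x]])
  then have "dt tau (0, x) \<bullet> L x = (\<Sum>k\<in>K. dt (Dk k (dk k u)) (0, x) \<bullet> L x)"
    by (simp add: inner_sum_left)
  also have "\<dots> = (\<Sum>k\<in>K. dk k (\<lambda>z. dt (dk k u) z \<bullet> L (snd z) - dt u z \<bullet> L (killing k (snd z))) (0, x)
      + dt u (0, x) \<bullet> L (killing k (killing k x)) + (killing k x \<bullet> killing k x) * (dt u (0, x) \<bullet> L x))"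
    unfolding dt_Dk_inner_L[OF smooth_dk[OF su] o x] dt_dk_u_inner_L_killing[OF x] dk_u_0[OF x]
      d_diff[OF smooth_dt_L[OF smooth_dk[OF su]] smooth_dt_L_killing[OF su] S0[OF x]]
    by (simp add: algebra_simps)
  also have "\<dots> = (\<Sum>k\<in>K. dk k (\<lambda>z. dt (dk k u) z \<bullet> L (snd z) - dt u z \<bullet> L (killing k (snd z))) (0, x))
      + (- lam * (dt u (0, x) \<bullet> L x)) + (p + q) * (dt u (0, x) \<bullet> L x)"
    by (simp add: sum.distrib sum_inner_L_killing_square sum_killing_inner[OF x] dt_u_inner_0[OF x]
        sum_distrib_right[symmetric])
  finally show ?thesis by (simp add: algebra_simps)
qed

text \<open>Curvature enters twice with the amount \<open>w * sig\<close>: through commuting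
  \<open>dt\<close> with the outer covariant derivative and through the radial component of
  \<open>dt V\<close>. The inner commutation contributes nothing.\<close>

lemma dt_lap_inner_L:
  assumes V: "smooth_on S V" "\<forall>z\<in>S. V z \<bullet> u z = 0" and V0: "\<forall>x\<in>M. V (0, x) = w *\<^sub>R L x" and x: "x \<in> M"
  shows "dt (lap V) (0, x) \<bullet> L x
     = (\<Sum>k\<in>K. dk k (\<lambda>z. dt V z \<bullet> L (killing k (snd z)) - dt (Dk k V) z \<bullet> L (snd z)) (0, x))
      + lam * (dt V (0, x) \<bullet> L x) + (- 2 * w * sig) * (dt u (0, x) \<bullet> L x)"
proof -
  have o: "\<forall>z\<in>S. Dk k V z \<bullet> u z = 0" for k using Dk_orthogonal by blast
  have V0x: "V (0, x) = w *\<^sub>R L x" using V0 x by blast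
  have "dt (lap V) (0, x) = - dt (\<lambda>z. \<Sum>k\<in>K. Dk k (Dk k V) z) (0, x)"
    unfolding lap_def[abs_def]
    by (rule d_minus[OF smooth_on_sum[OF smooth_Dk[OF smooth_Dk[OF V(1)]]] S0[OF x]])
  also have "dt (\<lambda>z. \<Sum>k\<in>K. Dk k (Dk k V) z) (0, x) = (\<Sum>k\<in>K. dt (Dk k (Dk k V)) (0, x))"
    by (rule d_sum[OF smooth_Dk[OF smooth_Dk[OF V(1)]] S0[OF x]])
  finally have "dt (lap V) (0, x) = - (\<Sum>k\<in>K. dt (Dk k (Dk k V)) (0, x))" .
  then have "dt (lap V) (0, x) \<bullet> L x = - (\<Sum>k\<in>K. dt (Dk k (Dk k V)) (0, x) \<bullet> L x)"
    by (simp add: inner_sum_left)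
  also have "\<dots> = - (\<Sum>k\<in>K. - dk k (\<lambda>z. dt V z \<bullet> L (killing k (snd z)) - dt (Dk k V) z \<bullet> L (snd z)) (0, x)
      + dt V (0, x) \<bullet> L (killing k (killing k x)) + (L (killing k x) \<bullet> killing k x) * (w * (dt u (0, x) \<bullet> L x)))"
    unfolding dt_Dk_inner_L[OF smooth_Dk[OF V(1)] o x] dt_Dk_inner_L_killing[OF V x V0x] Dk_0[OF V(1) x V0]
      d_diff[OF smooth_dt_L_killing[OF V(1)] smooth_dt_L[OF smooth_Dk[OF V(1)]] S0[OF x]]
    by (simp add: algebra_simps)
  also have "\<dots> = (\<Sum>k\<in>K. dk k (\<lambda>z. dt V z \<bullet> L (killing k (snd z)) - dt (Dk k V) z \<bullet> L (snd z)) (0, x))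
      - (- lam * (dt V (0, x) \<bullet> L x) - sig * (dt V (0, x) \<bullet> x)) - sig * (w * (dt u (0, x) \<bullet> L x))"
    by (simp only: sum.distrib sum_negf sum_inner_L_killing_square sum_L_killing_inner[OF x]
        sum_distrib_right[symmetric] minus_add_distrib minus_minus diff_conv_add_uminus)
  finally show ?thesis by (simp add: dt_inner_u_0[OF V x V0x] algebra_simps)
qed

text \<open>Only the radial component of \<open>dt V\<close> carries curvature here, so
  \<open>w * sig\<close> enters once. This is the half step needed for odd \<open>r\<close>.\<close>

lemma dt_Dk_sum_inner:
  assumes V: "smooth_on S V" "\<forall>z\<in>S. V z \<bullet> u z = 0" and V0: "\<forall>x\<in>M. V (0, x) = w *\<^sub>R L x" and x: "x \<in> M"
  shows "(\<Sum>k\<in>K. dt (Dk k V) (0, x) \<bullet> L (killing k x))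
     = (\<Sum>k\<in>K. dk k (\<lambda>z. dt V z \<bullet> L (killing k (snd z))) (0, x))
      + lam * (dt V (0, x) \<bullet> L x) + (- w * sig) * (dt u (0, x) \<bullet> L x)"
proof -
  have V0x: "V (0, x) = w *\<^sub>R L x" using V0 x by blast
  show ?thesis
    unfolding dt_Dk_inner_L_killing[OF V x V0x]
    by (simp add: sum_subtractf sum_inner_L_killing_square dt_inner_u_0[OF V x V0x] algebra_simps)
qed

lemma Int0_dt_tau: "Int0 (\<lambda>z. dt tau z \<bullet> L (snd z)) = (p + q - lam) * J"
proof -
  \<comment> \<open>There is a single lower-order term; the second slot of
    \<open>Int0_divergence\<close> is filled with the zero function.\<close>
  have "Int0 (\<lambda>z. dt tau z \<bullet> L (snd z)) = (p + q - lam) * Int0 (\<lambda>z. dt u z \<bullet> L (snd z)) + 0 * Int0 (\<lambda>z. 0)"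
  proof (rule Int0_divergence[where f = "\<lambda>k z. dt (dk k u) z \<bullet> L (snd z) - dt u z \<bullet> L (killing k (snd z))"])
    show "smooth_on S (\<lambda>z. dt (dk k u) z \<bullet> L (snd z) - dt u z \<bullet> L (killing k (snd z)))" for k
      by (intro smooth_on_diff smooth_dt_L smooth_dk su smooth_dt_L_killing)
  qed (simp_all add: dt_tau_inner_L smooth_dt_L su smooth_on_const)
  then show ?thesis by (simp add: J_def)
qed

lemma Int0_dt_lap:
  assumes V: "smooth_on S V" "\<forall>z\<in>S. V z \<bullet> u z = 0" and V0: "\<forall>x\<in>M. V (0, x) = w *\<^sub>R L x"
  shows "Int0 (\<lambda>z. dt (lap V) z \<bullet> L (snd z)) = lam * Int0 (\<lambda>z. dt V z \<bullet> L (snd z)) - 2 * w * sig * J"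
proof -
  have "Int0 (\<lambda>z. dt (lap V) z \<bullet> L (snd z))
      = lam * Int0 (\<lambda>z. dt V z \<bullet> L (snd z)) + (- 2 * w * sig) * Int0 (\<lambda>z. dt u z \<bullet> L (snd z))"
  proof (rule Int0_divergence[where f = "\<lambda>k z. dt V z \<bullet> L (killing k (snd z)) - dt (Dk k V) z \<bullet> L (snd z)"])
    show "smooth_on S (\<lambda>z. dt V z \<bullet> L (killing k (snd z)) - dt (Dk k V) z \<bullet> L (snd z))" for k
      by (intro smooth_on_diff smooth_dt_L smooth_Dk V smooth_dt_L_killing)
  qed (simp_all add: dt_lap_inner_L[OF V V0] smooth_dt_L su V)
  then show ?thesis by (simp add: J_def)
qed

lemma Int0_dt_Dk:
  assumes V: "smooth_on S V" "\<forall>z\<in>S. V z \<bullet> u z = 0" and V0: "\<forall>x\<in>M. V (0, x) = w *\<^sub>R L x"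
  shows "Int0 (\<lambda>z. \<Sum>k\<in>K. dt (Dk k V) z \<bullet> L (killing k (snd z)))
       = lam * Int0 (\<lambda>z. dt V z \<bullet> L (snd z)) - w * sig * J"
proof -
  have "Int0 (\<lambda>z. \<Sum>k\<in>K. dt (Dk k V) z \<bullet> L (killing k (snd z)))
      = lam * Int0 (\<lambda>z. dt V z \<bullet> L (snd z)) + (- w * sig) * Int0 (\<lambda>z. dt u z \<bullet> L (snd z))"
  proof (rule Int0_divergence[where f = "\<lambda>k z. dt V z \<bullet> L (killing k (snd z))"])
    show "smooth_on S (\<lambda>z. dt V z \<bullet> L (killing k (snd z)))" for k
      by (intro smooth_dt_L_killing V)
  qed (simp_all add: dt_Dk_sum_inner[OF V V0] smooth_dt_L su V)
  then show ?thesis by (simp add: J_def)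
qed

text \<open>The Casimir sum pairs with \<open>x\<close> to \<open>- (p + q)\<close>, so projecting
  adds \<open>(p + q) *\<^sub>R x\<close>. What remains is a multiple of \<open>L x\<close> because
  \<open>R1\<^sup>2 + R2\<^sup>2 = 1\<close>.\<close>

lemma tau_0:
  assumes x: "x \<in> M"
  shows "tau (0, x) = c_tau *\<^sub>R L x"
proof -
  have xx: "x \<bullet> x = 1" using u_unit[OF S0[OF x]] by (simp add: u0[OF x])
  have "Dk k (dk k u) (0, x) = sphere_proj x (killing k (killing k x))" for k
  proof -
    have "\<forall>x\<in>M. dk k u (0, x) = killing k x" using dk_u_0 by blast
    from dk_at_0[OF smooth_dk[OF su] bounded_linear_killing this x, of k]
    show ?thesis by (subst Dk_def) (simp add: u0[OF x])
  qed
  then have "tau (0, x) = sphere_proj x (- (p / R1\<^sup>2) *\<^sub>R fst x, - (q / R2\<^sup>2) *\<^sub>R snd x)"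
    by (simp add: tau_def linear_sum[OF linear_sphere_proj, symmetric] sum_killing_square)
  also have "\<dots> = (- (p / R1\<^sup>2) *\<^sub>R fst x, - (q / R2\<^sup>2) *\<^sub>R snd x) + (p + q) *\<^sub>R x"
    using R1 R2 by (simp add: sphere_proj_def inner_prod_def inner_M[OF x] algebra_simps)
  also have "\<dots> = c_tau *\<^sub>R L x"
  proof (rule prod_eqI)
    have a: "p + q - p / R1\<^sup>2 = c_tau / R1\<^sup>2"
    proof -
      have "c_tau = (p + q) * R1\<^sup>2 - p" using R12 by (simp add: c_tau_def) algebra
      moreover have "p + q - p / R1\<^sup>2 = ((p + q) * R1\<^sup>2 - p) / R1\<^sup>2"
        using R1 by (simp add: diff_divide_distrib)
      ultimately show ?thesis by metis
    qed
    have "fst ((- (p / R1\<^sup>2) *\<^sub>R fst x, - (q / R2\<^sup>2) *\<^sub>R snd x) + (p + q) *\<^sub>R x) = (p + q - p / R1\<^sup>2) *\<^sub>R fst x"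
      by (simp add: scaleR_left_diff_distrib)
    then show "fst ((- (p / R1\<^sup>2) *\<^sub>R fst x, - (q / R2\<^sup>2) *\<^sub>R snd x) + (p + q) *\<^sub>R x) = fst (c_tau *\<^sub>R L x)"
      unfolding a by (simp add: L_def)
    have b: "p + q - q / R2\<^sup>2 = - (c_tau / R2\<^sup>2)"
    proof -
      have "- c_tau = (p + q) * R2\<^sup>2 - q" using R12 by (simp add: c_tau_def) algebra
      moreover have "p + q - q / R2\<^sup>2 = ((p + q) * R2\<^sup>2 - q) / R2\<^sup>2"
        using R2 by (simp add: diff_divide_distrib)
      ultimately show ?thesis by (metis minus_divide_left)
    qed
    have "snd ((- (p / R1\<^sup>2) *\<^sub>R fst x, - (q / R2\<^sup>2) *\<^sub>R snd x) + (p + q) *\<^sub>R x) = (p + q - q / R2\<^sup>2) *\<^sub>R snd x"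
      by (simp add: scaleR_left_diff_distrib)
    then show "snd ((- (p / R1\<^sup>2) *\<^sub>R fst x, - (q / R2\<^sup>2) *\<^sub>R snd x) + (p + q) *\<^sub>R x) = snd (c_tau *\<^sub>R L x)"
      unfolding b by (simp add: L_def)
  qed
  finally show ?thesis .
qed

text \<open>Iterated Laplacians of the tension fields of all maps of the variation at once. Their
  joint smoothness in time and position is not visible from the frame-based definitions at a fixed
  time.\<close>

fun W :: "nat \<Rightarrow> real \<times> ('a \<times> 'b) \<Rightarrow> 'a \<times> 'b" where
  "W 0 = tau"
| "W (Suc n) = lap (W n)"

lemma smooth_W: "smooth_on S (W n)"
  by (induction n) (auto intro: smooth_tau smooth_lap)

lemma W_orthogonal: "\<forall>z\<in>S. W n z \<bullet> u z = 0"
  by (cases n) (auto simp: tau_orthogonal lap_orthogonal)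

lemma W_0: "\<forall>x\<in>M. W n (0, x) = (lam ^ n * c_tau) *\<^sub>R L x"
proof (induction n)
  case 0
  then show ?case using tau_0 by simp
next
  case (Suc n)
  then show ?case using lap_0[OF smooth_W _ Suc] by (auto simp: mult.assoc)
qed

text \<open>Solution of the recursion in \<open>Int0_dt_lap\<close>, whose inhomogeneous term is
  \<open>2 * lam ^ n * c_tau * sig * J\<close>. The factor \<open>lam\<close> on the left avoids the
  exponent \<open>n - 1\<close>.\<close>

lemma Int0_dt_W:
  "lam * Int0 (\<lambda>z. dt (W n) z \<bullet> L (snd z)) = lam ^ n * (lam * (p + q - lam) - 2 * real n * c_tau * sig) * J"
proof (induction n)
  case 0
  then show ?case by (simp add: Int0_dt_tau)
next
  case (Suc n)
  have "lam * Int0 (\<lambda>z. dt (W (Suc n)) z \<bullet> L (snd z))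
      = lam * (lam * Int0 (\<lambda>z. dt (W n) z \<bullet> L (snd z))) - lam * (2 * (lam ^ n * c_tau) * sig * J)"
    unfolding W.simps Int0_dt_lap[OF smooth_W W_orthogonal W_0, of n] right_diff_distrib ..
  also have "\<dots> = lam ^ Suc n * (lam * (p + q - lam) - 2 * real (Suc n) * c_tau * sig) * J"
    unfolding Suc by (simp add: algebra_simps)
  finally show ?case .
qed

end

section \<open>The first variation of the energies\<close>

context torus_variation
begin

lemma smooth_map_slice: "t \<in> {-\<epsilon><..<\<epsilon>} \<Longrightarrow> smooth_map M (sphere 0 1) (\<lambda>x. u (t, x))"
  unfolding smooth_map_def using smooth_slice[OF su] norm_u by auto

text \<open>The iterates agree with \<open>W\<close> only on \<open>M\<close>, not as functions. So
  the induction runs over all points of \<open>M\<close>, and \<open>differential_cong\<close>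
  transfers the derivatives.\<close>

lemma W_eq_iterated_rough_laplacian:
  assumes t: "t \<in> {-\<epsilon><..<\<epsilon>}" and x: "x \<in> M"
  shows "(rough_laplacian M (sphere 0 1) (\<lambda>x. u (t, x)) ^^ n) (tension M (sphere 0 1) (\<lambda>x. u (t, x))) x = W n (t, x)"
  using x
proof (induction n arbitrary: x)
  case 0
  have "differential M (\<lambda>y. differential M (\<lambda>x. u (t, x)) y (killing k y)) x (killing k x) = dk k (dk k u) (t, x)" for k
  proof -
    have "differential M (\<lambda>y. differential M (\<lambda>x. u (t, x)) y (killing k y)) x
        = differential M (\<lambda>y. dk k u (t, y)) x"
      by (rule differential_cong[OF open_UNIV]) (use 0 dk_slice[OF su t] in auto)
    then show ?thesis using dk_slice[OF smooth_dk[OF su] t 0] by simp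
  qed
  then show ?case
    by (simp add: tension_M[OF smooth_map_slice[OF t] 0] tau_def Dk_def)
next
  case (Suc n)
  let ?V = "(rough_laplacian M (sphere 0 1) (\<lambda>x. u (t, x)) ^^ n) (tension M (sphere 0 1) (\<lambda>x. u (t, x)))"
  have sV: "smooth_on M ?V"
    by (rule smooth_on_cong[OF _ smooth_slice[OF smooth_W t]]) (simp add: Suc.IH)
  have 1: "differential M ?V y (killing k y) = dk k (W n) (t, y)" if "y \<in> M" for y k
  proof -
    have "differential M ?V y = differential M (\<lambda>y. W n (t, y)) y"
      by (rule differential_cong[OF open_UNIV]) (use that Suc.IH in auto)
    then show ?thesis using dk_slice[OF smooth_W t that] by simp
  qed
  have 2: "differential M (\<lambda>y. sphere_proj (u (t, y)) (differential M ?V y (killing k y))) x (killing k x)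
      = dk k (Dk k (W n)) (t, x)" for k
  proof -
    have "differential M (\<lambda>y. sphere_proj (u (t, y)) (differential M ?V y (killing k y))) x
        = differential M (\<lambda>y. Dk k (W n) (t, y)) x"
      by (rule differential_cong[OF open_UNIV]) (use Suc.prems 1 in \<open>auto simp: Dk_def\<close>)
    then show ?thesis using dk_slice[OF smooth_Dk[OF smooth_W] t Suc.prems] by simp
  qed
  show ?case
    unfolding funpow.simps o_apply rough_laplacian_M[OF smooth_map_slice[OF t] sV Suc.prems] 2 W.simps lap_def
    by (simp add: Dk_def[of _ "Dk _ _"])
qed

definition energy_density :: "nat \<Rightarrow> real \<times> ('a \<times> 'b) \<Rightarrow> real" where
  "energy_density r z = (if even r then W (r div 2 - 1) z \<bullet> W (r div 2 - 1) z
     else \<Sum>k\<in>K. Dk k (W (r div 2 - 1)) z \<bullet> Dk k (W (r div 2 - 1)) z)"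

lemma smooth_energy_density: "smooth_on S (energy_density r)"
  unfolding energy_density_def[abs_def]
  by (cases "even r") (auto intro!: smooth_on_inner smooth_on_sum smooth_W smooth_Dk)

lemma r_energy_eq:
  assumes t: "t \<in> {-\<epsilon><..<\<epsilon>}"
  shows "r_energy r M (sphere 0 1) (\<lambda>x. u (t, x)) = 1/2 * (\<integral>x. energy_density r (t, x) \<partial>vol)"
proof -
  define n where "n = r div 2 - 1"
  have ed: "energy_density r z = (if even r then W n z \<bullet> W n z else \<Sum>k\<in>K. Dk k (W n) z \<bullet> Dk k (W n) z)" for z
    unfolding energy_density_def n_def ..
  let ?V = "(rough_laplacian M (sphere 0 1) (\<lambda>x. u (t, x)) ^^ (n)) (tension M (sphere 0 1) (\<lambda>x. u (t, x)))"
  have V: "?V x = W (n) (t, x)" if "x \<in> M" for x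
    using W_eq_iterated_rough_laplacian[OF t that] .
  have sV: "smooth_on M ?V"
    by (rule smooth_on_cong[OF _ smooth_slice[OF smooth_W[of "n"] t]]) (rule V[symmetric])
  have D: "(\<Sum>j<manifold_dim M. induced_conn M (sphere 0 1) (\<lambda>x. u (t, x)) (frame_at M x j x) ?V x
                    \<bullet> induced_conn M (sphere 0 1) (\<lambda>x. u (t, x)) (frame_at M x j x) ?V x)
      = (\<Sum>k\<in>K. Dk k (W (n)) (t, x) \<bullet> Dk k (W (n)) (t, x))" if x: "x \<in> M" for x
  proof -
    have "differential M ?V x = differential M (\<lambda>y. W (n) (t, y)) x"
      by (rule differential_cong[OF open_UNIV]) (use x V in auto)
    then have *: "sphere_proj (u (t, x)) (differential M ?V x (killing k x)) = Dk k (W (n)) (t, x)" for k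
      using dk_slice[OF smooth_W t x] by (simp add: Dk_def)
    have n: "norm (u (t, x)) = 1" using norm_u t x by simp
    show ?thesis
      using energy_density_M[of "\<lambda>x. u (t, x)" x ?V, OF n smooth_on_differentiable[OF sV x] x] unfolding * .
  qed
  show ?thesis
  proof (cases "even r")
    case True
    have "(\<integral>x. ?V x \<bullet> ?V x \<partial>vol) = (\<integral>x. energy_density r (t, x) \<partial>vol)"
      by (rule Bochner_Integration.integral_cong[OF refl]) (simp add: space_vol V ed True)
    then show ?thesis using True unfolding r_energy_def Let_def vol_def n_def[symmetric] by simp
  next
    case False
    have "(\<integral>x. (\<Sum>j<manifold_dim M. induced_conn M (sphere 0 1) (\<lambda>x. u (t, x)) (frame_at M x j x) ?V x
                    \<bullet> induced_conn M (sphere 0 1) (\<lambda>x. u (t, x)) (frame_at M x j x) ?V x) \<partial>vol)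
        = (\<integral>x. energy_density r (t, x) \<partial>vol)"
      by (rule Bochner_Integration.integral_cong[OF refl]) (simp add: space_vol D ed False)
    then show ?thesis using False unfolding r_energy_def Let_def vol_def n_def[symmetric] by simp
  qed
qed

text \<open>The time interval is open, so a smooth function may be unbounded near its ends; on the
  closed half interval compactness applies.\<close>

lemma bounded_near_0:
  fixes f :: "real \<times> ('a \<times> 'b) \<Rightarrow> real"
  assumes f: "smooth_on S f"
  obtains C where "\<And>t x. \<bar>t\<bar> < \<epsilon> / 2 \<Longrightarrow> x \<in> M \<Longrightarrow> \<bar>f (t, x)\<bar> \<le> C"
proof -
  have sub: "{-\<epsilon>/2..\<epsilon>/2} \<times> M \<subseteq> S" using \<epsilon> by (auto simp: S_def)
  have "compact (f ` ({-\<epsilon>/2..\<epsilon>/2} \<times> M))"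
    by (intro compact_continuous_image continuous_on_subset[OF smooth_on_continuous_on[OF f] sub]
        compact_Times compact_Icc compact_M)
  then obtain C where C: "\<And>y. y \<in> f ` ({-\<epsilon>/2..\<epsilon>/2} \<times> M) \<Longrightarrow> norm y \<le> C"
    using compact_imp_bounded bounded_iff by metis
  show thesis
  proof (rule that)
    fix t x assume "\<bar>t\<bar> < \<epsilon> / 2" "x \<in> M"
    then have "(t, x) \<in> {-\<epsilon>/2..\<epsilon>/2} \<times> M" by auto
    then show "\<bar>f (t, x)\<bar> \<le> C" using C[of "f (t, x)"] by force
  qed
qed

lemma integral_time_derivative:
  fixes f :: "real \<times> ('a \<times> 'b) \<Rightarrow> real"
  assumes f: "smooth_on S f"
  shows "((\<lambda>t. \<integral>x. f (t, x) \<partial>vol) has_real_derivative Int0 (dt f)) (at 0)"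
proof -
  obtain C where C: "\<And>t x. \<bar>t\<bar> < \<epsilon> / 2 \<Longrightarrow> x \<in> M \<Longrightarrow> \<bar>f (t, x)\<bar> \<le> C"
    by (rule bounded_near_0[OF f]) (rule that)
  obtain C' where C': "\<And>t x. \<bar>t\<bar> < \<epsilon> / 2 \<Longrightarrow> x \<in> M \<Longrightarrow> \<bar>dt f (t, x)\<bar> \<le> C'"
    by (rule bounded_near_0[OF smooth_dt[OF f]]) (rule that)
  have e2: "\<epsilon> / 2 > 0" using \<epsilon> by simp
  have I: "t \<in> {-\<epsilon><..<\<epsilon>}" if "\<bar>t\<bar> < \<epsilon> / 2" for t using that \<epsilon> by auto
  have meas: "(\<lambda>x. h (t, x)) \<in> borel_measurable vol" if "smooth_on S h" "\<bar>t\<bar> < \<epsilon> / 2"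
    for h :: "real \<times> ('a \<times> 'b) \<Rightarrow> real" and t
    by (rule measurable_vol, rule smooth_on_continuous_on, rule smooth_slice[OF that(1) I[OF that(2)]])
  show ?thesis
    unfolding Int0_def
  proof (rule has_real_derivative_integral[OF finite_measure_vol e2, where g = "\<lambda>t x. f (t, x)" and g' = "\<lambda>t x. dt f (t, x)" and C = C and C' = C'])
    show "((\<lambda>t. f (t, x)) has_real_derivative dt f (t, x)) (at t)" if "\<bar>t\<bar> < \<epsilon> / 2" "x \<in> space vol" for t x
      using dt_derivative[OF f I[OF that(1)]] that(2)
      by (simp add: space_vol has_real_derivative_iff_has_vector_derivative)
  qed (use C C' meas[OF f] meas[OF smooth_dt[OF f]] e2 in \<open>simp_all add: space_vol\<close>)
qed

text \<open>The coefficient \<open>r - 2\<close> counts curvature contributions: two for each of the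
  \<open>r div 2 - 1\<close> Laplacians and one more for the gradient if \<open>r\<close> is
  odd.\<close>

definition Q :: "nat \<Rightarrow> real" where
  "Q r = lam * (p + q - lam) - (real r - 2) * c_tau * sig"

lemma dt_inner_self: "smooth_on S f \<Longrightarrow> z \<in> S \<Longrightarrow> dt (\<lambda>z. f z \<bullet> f z) z = 2 * (dt f z \<bullet> f z)"
  using d_inner(2)[of f f z] by (simp add: inner_commute)

lemma Int0_cmult: "Int0 (\<lambda>z. c * f z) = c * Int0 f"
  by (simp add: Int0_def)

lemma Int0_cong: "(\<And>x. x \<in> M \<Longrightarrow> f (0, x) = g (0, x)) \<Longrightarrow> Int0 f = Int0 g"
  unfolding Int0_def by (rule Bochner_Integration.integral_cong[OF refl]) (simp add: space_vol)

lemma Int0_dt_energy_density_even: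
  assumes r: "r = 2 * n + 2"
  shows "lam * Int0 (dt (energy_density r)) = 2 * (lam ^ (2 * n) * c_tau * Q r * J)"
proof -
  have W0: "W n (0, x) = (lam ^ n * c_tau) *\<^sub>R L x" if "x \<in> M" for x using W_0 that by blast
  have "energy_density r = (\<lambda>z. W n z \<bullet> W n z)"
    using r by (auto simp: energy_density_def)
  then have "Int0 (dt (energy_density r)) = Int0 (\<lambda>z. (2 * (lam ^ n * c_tau)) * (dt (W n) z \<bullet> L (snd z)))"
    by (intro Int0_cong) (simp add: dt_inner_self[OF smooth_W S0] W0)
  also have "\<dots> = 2 * (lam ^ n * c_tau) * Int0 (\<lambda>z. dt (W n) z \<bullet> L (snd z))" by (rule Int0_cmult)
  finally have "lam * Int0 (dt (energy_density r)) = 2 * (lam ^ n * c_tau) * (lam * Int0 (\<lambda>z. dt (W n) z \<bullet> L (snd z)))"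
    by (simp add: mult_ac)
  also have "\<dots> = 2 * (lam ^ n * c_tau) * (lam ^ n * Q r * J)"
    unfolding Int0_dt_W Q_def using r by simp
  also have "\<dots> = 2 * (lam ^ (2 * n) * c_tau * Q r * J)" unfolding mult_2[of n] power_add by (simp only: mult_ac)
  finally show ?thesis .
qed

text \<open>No factor \<open>lam\<close> is needed on the left: \<open>Int0_dt_Dk\<close> itself
  supplies the one that \<open>Int0_dt_W\<close> asks for.\<close>

lemma Int0_dt_energy_density_odd:
  assumes r: "r = 2 * n + 3"
  shows "Int0 (dt (energy_density r)) = 2 * (lam ^ (2 * n) * c_tau * Q r * J)"
proof -
  have "energy_density r = (\<lambda>z. \<Sum>k\<in>K. Dk k (W n) z \<bullet> Dk k (W n) z)"
  proof -
    have "odd r" "r div 2 - 1 = n" using r by auto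
    then show ?thesis by (simp add: energy_density_def[abs_def])
  qed
  moreover have "dt (\<lambda>z. \<Sum>k\<in>K. Dk k (W n) z \<bullet> Dk k (W n) z) (0, x)
      = 2 * (lam ^ n * c_tau) * (\<Sum>k\<in>K. dt (Dk k (W n)) (0, x) \<bullet> L (killing k x))" if x: "x \<in> M" for x
    unfolding d_sum[OF smooth_on_inner[OF smooth_Dk[OF smooth_W] smooth_Dk[OF smooth_W]] S0[OF x]]
      dt_inner_self[OF smooth_Dk[OF smooth_W] S0[OF x]] Dk_0[OF smooth_W x W_0]
    by (simp add: sum_distrib_left mult_ac)
  ultimately have "Int0 (dt (energy_density r))
      = Int0 (\<lambda>z. (2 * (lam ^ n * c_tau)) * (\<Sum>k\<in>K. dt (Dk k (W n)) z \<bullet> L (killing k (snd z))))"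
    by (intro Int0_cong) simp
  also have "\<dots> = 2 * (lam ^ n * c_tau) * (lam * Int0 (\<lambda>z. dt (W n) z \<bullet> L (snd z)) - (lam ^ n * c_tau) * sig * J)"
    unfolding Int0_cmult Int0_dt_Dk[OF smooth_W W_orthogonal W_0] ..
  also have "\<dots> = 2 * (lam ^ n * c_tau) * (lam ^ n * Q r * J)"
    unfolding Int0_dt_W Q_def using r by (simp add: algebra_simps)
  also have "\<dots> = 2 * (lam ^ (2 * n) * c_tau * Q r * J)" unfolding mult_2[of n] power_add by (simp only: mult_ac)
  finally show ?thesis .
qed

text \<open>Only the vanishing of the derivative matters later, so its value \<open>D\<close>, whose
  power of \<open>lam\<close> depends on the parity of \<open>r\<close>, stays hidden.\<close>

lemma r_energy_derivative:
  assumes r: "r \<ge> 2" and lam: "lam \<noteq> 0"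
  shows "\<exists>D. ((\<lambda>t. r_energy r M (sphere 0 1) (\<lambda>x. u (t, x))) has_real_derivative D) (at 0)
     \<and> (D = 0 \<longleftrightarrow> c_tau * Q r * J = 0)"
proof -
  define D where "D = 1/2 * Int0 (dt (energy_density r))"
  have 1: "((\<lambda>t. 1/2 * (\<integral>x. energy_density r (t, x) \<partial>vol)) has_real_derivative D) (at 0)"
    unfolding D_def by (intro DERIV_cmult integral_time_derivative smooth_energy_density)
  have 2: "\<forall>\<^sub>F t in nhds 0. r_energy r M (sphere 0 1) (\<lambda>x. u (t, x)) = 1/2 * (\<integral>x. energy_density r (t, x) \<partial>vol)"
    by (rule eventually_nhds[THEN iffD2], rule exI[of _ "{-\<epsilon><..<\<epsilon>}"]) (use \<epsilon> r_energy_eq in auto)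
  have "((\<lambda>t. r_energy r M (sphere 0 1) (\<lambda>x. u (t, x))) has_real_derivative D) (at 0)"
    by (rule DERIV_cong_ev[OF refl 2 refl, THEN iffD2]) (rule 1)
  moreover have "D = 0 \<longleftrightarrow> c_tau * Q r * J = 0"
  proof (cases "even r")
    case True
    then obtain m where "r = 2 * m" by (rule evenE)
    with r have "r = 2 * (m - 1) + 2" by simp
    from Int0_dt_energy_density_even[OF this] have "lam * D = lam ^ (2 * (m - 1)) * c_tau * Q r * J"
      by (simp add: D_def)
    then show ?thesis using lam by (metis (no_types, lifting) mult_eq_0_iff power_not_zero)
  next
    case False
    then obtain m where "r = 2 * m + 1" by (rule oddE)
    with r have "r = 2 * (m - 1) + 3" by simp
    from Int0_dt_energy_density_odd[OF this] have "D = lam ^ (2 * (m - 1)) * c_tau * Q r * J"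
      by (simp add: D_def)
    then show ?thesis using lam by simp
  qed
  ultimately show ?thesis by blast
qed

lemma tension_at_0: "x \<in> M \<Longrightarrow> tension M (sphere 0 1) (\<lambda>x. u (0, x)) x = c_tau *\<^sub>R L x"
  using W_eq_iterated_rough_laplacian[of 0 x 0] \<epsilon> tau_0 by simp

end

section \<open>The critical radii\<close>

context torus_variation
begin

lemma c_tau_eq: "c_tau = (p + q) * R1\<^sup>2 - p"
  unfolding c_tau_def using R12 by algebra

lemma c_tau_eq_0_iff:
  assumes "p + q > 0"
  shows "c_tau = 0 \<longleftrightarrow> R1\<^sup>2 = p / (p + q) \<and> R2\<^sup>2 = q / (p + q)"
proof -
  have "c_tau = 0 \<longleftrightarrow> R1\<^sup>2 = p / (p + q)"
    unfolding c_tau_eq using assms by (auto simp: field_simps)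
  moreover have "R2\<^sup>2 = q / (p + q)" if "R1\<^sup>2 = p / (p + q)"
  proof -
    have "R2\<^sup>2 = 1 - p / (p + q)" using R12 that by simp
    also have "\<dots> = q / (p + q)" using assms by (simp add: field_simps)
    finally show ?thesis .
  qed
  ultimately show ?thesis by blast
qed

lemma lam_pos: "p > 0 \<Longrightarrow> q > 0 \<Longrightarrow> lam > 0"
  unfolding lam_def using R1 R2 by (intro add_pos_pos divide_pos_pos mult_pos_pos zero_less_power)

text \<open>With \<open>a = R1\<^sup>2\<close> and \<open>b = R2\<^sup>2\<close> one has
  \<open>a * b * (p + q - lam) = (a - b) * (p * b - q * a)\<close> and
  \<open>a * b * sig = p * b - q * a\<close>. Both are multiples of
  \<open>c_tau = q * a - p * b\<close>, which therefore splits off; substituting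
  \<open>b = 1 - a\<close> leaves the cubic.\<close>

lemma Q_polynomial:
  "(R1\<^sup>2)\<^sup>2 * (R2\<^sup>2)\<^sup>2 * Q r = - c_tau * (real r * (p + q) * (R1\<^sup>2) ^ 3
     + (q - p - real r * (q + 2 * p)) * (R1\<^sup>2)\<^sup>2 + (2 * p + real r * p) * R1\<^sup>2 - p)"
proof -
  define a b where "a = R1\<^sup>2" and "b = R2\<^sup>2"
  have ab: "a > 0" "b > 0" "a + b = 1" using R1 R2 R12 by (simp_all add: a_def b_def)
  have l: "a * b * lam = p * b\<^sup>2 + q * a\<^sup>2"
    using ab unfolding lam_def a_def[symmetric] b_def[symmetric] by (simp add: field_simps power2_eq_square)
  have s: "a * b * sig = p * b - q * a"
    using ab unfolding sig_def a_def[symmetric] b_def[symmetric] by (simp add: field_simps)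
  have c: "c_tau = q * a - p * b" by (simp add: c_tau_def a_def b_def)
  have "a\<^sup>2 * b\<^sup>2 * Q r = (a * b * lam) * (a * b * (p + q) - a * b * lam) - (real r - 2) * c_tau * (a * b * (a * b * sig))"
    unfolding Q_def by (simp add: power2_eq_square algebra_simps)
  also have "\<dots> = - c_tau * (real r * (p + q) * a ^ 3 + (q - p - real r * (q + 2 * p)) * a\<^sup>2 + (2 * p + real r * p) * a - p)"
    unfolding l s c using ab(3) by algebra
  finally show ?thesis unfolding a_def b_def .
qed

lemma Q_eq_0_iff:
  assumes pq: "p > 0" "q > 0" and r: "r \<ge> 2" and c: "c_tau \<noteq> 0"
  shows "Q r = 0 \<longleftrightarrow> r = 2 \<and> p \<noteq> q \<and> R1\<^sup>2 = 1/2 \<and> R2\<^sup>2 = 1/2 \<or>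
     r \<ge> 3 \<and> real r * (p + q) * (R1\<^sup>2) ^ 3
     + (q - p - real r * (q + 2 * p)) * (R1\<^sup>2)\<^sup>2 + (2 * p + real r * p) * R1\<^sup>2 - p = 0"
proof -
  have Q: "Q r = 0 \<longleftrightarrow> real r * (p + q) * (R1\<^sup>2) ^ 3
     + (q - p - real r * (q + 2 * p)) * (R1\<^sup>2)\<^sup>2 + (2 * p + real r * p) * R1\<^sup>2 - p = 0"
    using Q_polynomial[of r] c R1 R2 by (metis mult_eq_0_iff neg_equal_0_iff_equal power_not_zero less_irrefl)
  show ?thesis
  proof (cases "r = 2")
    case True
    have b: "R2\<^sup>2 = 1 - R1\<^sup>2" using R12 by simp
    \<comment> \<open>For \<open>r = 2\<close> the cubic has the factor
      \<open>2 * R1\<^sup>2 - 1\<close>, and the other factor is positive.\<close>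
    have "real r * (p + q) * (R1\<^sup>2) ^ 3 + (q - p - real r * (q + 2 * p)) * (R1\<^sup>2)\<^sup>2 + (2 * p + real r * p) * R1\<^sup>2 - p
        = (2 * R1\<^sup>2 - 1) * (p * (R2\<^sup>2)\<^sup>2 + q * (R1\<^sup>2)\<^sup>2)"
      unfolding True b by (simp add: power2_eq_square power3_eq_cube algebra_simps)
    moreover have "p * (R2\<^sup>2)\<^sup>2 + q * (R1\<^sup>2)\<^sup>2 > 0"
      using pq R1 R2 by (intro add_pos_pos mult_pos_pos) auto
    ultimately have "Q r = 0 \<longleftrightarrow> R1\<^sup>2 = 1/2" unfolding Q by auto
    \<comment> \<open>At equal radii \<open>c_tau\<close> is \<open>(q - p) / 2\<close>, so
      non-minimality forces different dimensions.\<close>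
    moreover have "p \<noteq> q" if "R1\<^sup>2 = 1/2" using c unfolding c_tau_eq that by auto
    moreover have "R2\<^sup>2 = 1/2" if "R1\<^sup>2 = 1/2" unfolding b that by simp
    ultimately show ?thesis using True by auto
  next
    case False
    then show ?thesis using Q r by auto
  qed
qed

lemma L_inner_L: "x \<in> M \<Longrightarrow> L x \<bullet> L x = 1 / R1\<^sup>2 + 1 / R2\<^sup>2"
  using R1 R2 by (simp add: L_def inner_prod_def inner_M power2_eq_square)

lemma L_nonzero:
  assumes "x \<in> M" shows "L x \<noteq> 0"
proof
  assume "L x = 0"
  then have "1 / R1\<^sup>2 + 1 / R2\<^sup>2 = 0" using L_inner_L[OF assms] by simp
  moreover have "1 / R1\<^sup>2 + 1 / R2\<^sup>2 > 0" using R1 R2 by (intro add_pos_pos) auto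
  ultimately show False by simp
qed

end

section \<open>Explicit variations and the two equivalences\<close>

context clifford
begin

text \<open>Moving along the great circles tangent to the unit normal \<open>\<nu>\<close> of the torus.\<close>

lemma normal_variation_exists:
  assumes R12: "R1\<^sup>2 + R2\<^sup>2 = 1"
  shows "\<exists>u. torus_variation R1 R2 M 1 u \<and> torus_variation.J R1 R2 M 1 u \<noteq> 0"
proof -
  \<comment> \<open>This is \<open>R1 * R2\<close> times the normal field \<open>L\<close>; it has
    length 1 on \<open>M\<close> because \<open>R1\<^sup>2 + R2\<^sup>2 = 1\<close>.\<close>
  define \<nu> :: "'a \<times> 'b \<Rightarrow> 'a \<times> 'b" where "\<nu> x = ((R2 / R1) *\<^sub>R fst x, (- (R1 / R2)) *\<^sub>R snd x)" for x
  \<comment> \<open>Rational parametrization of the great circle, the parameter being the tangent of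
    half the angle. The closure rules give smoothness, and the speed at time 0 is 2.\<close>
  define u where "u z = inverse (1 + fst z * fst z) *\<^sub>R ((1 - fst z * fst z) *\<^sub>R snd z + (2 * fst z) *\<^sub>R \<nu> (snd z))"
    for z :: "real \<times> ('a \<times> 'b)"
  have b\<nu>: "bounded_linear \<nu>"
    unfolding \<nu>_def[abs_def]
    by (intro bounded_linear_Pair bounded_linear_compose[OF bounded_linear_scaleR_right] bounded_linear_fst bounded_linear_snd)
  have pos: "1 + t * t > (0::real)" for t by (simp add: add_pos_nonneg)
  have su: "smooth_on A u" for A
    unfolding u_def[abs_def]
    by (intro smooth_on_intros smooth_on_linear_compose[OF b\<nu>])
       (use pos in \<open>auto simp: less_imp_neq[symmetric]\<close>)
  have n: "x \<bullet> x = 1" "\<nu> x \<bullet> \<nu> x = 1" "x \<bullet> \<nu> x = 0" if "x \<in> M" for x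
    using that R1 R2 R12 by (simp_all add: inner_prod_def inner_M \<nu>_def power2_eq_square field_simps)
  have norm_u: "norm (u (t, x)) = 1" if x: "x \<in> M" for t x
  proof -
    have "u (t, x) \<bullet> u (t, x) = inverse (1 + t * t) * inverse (1 + t * t) * ((1 - t * t)\<^sup>2 + (2 * t)\<^sup>2)"
    proof -
      have "(a *\<^sub>R x + b *\<^sub>R \<nu> x) \<bullet> (a *\<^sub>R x + b *\<^sub>R \<nu> x) = a\<^sup>2 + b\<^sup>2" for a b
        using n[OF x] by (simp add: inner_add_left inner_add_right inner_commute[of "\<nu> x" x] power2_eq_square)
      then show ?thesis unfolding u_def by (simp only: inner_scaleR_left inner_scaleR_right fst_conv snd_conv mult.assoc)
    qed
    also have "(1 - t * t)\<^sup>2 + (2 * t)\<^sup>2 = (1 + t * t) * (1 + t * t)"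
      by (simp add: power2_eq_square algebra_simps)
    also have "inverse (1 + t * t) * inverse (1 + t * t) * ((1 + t * t) * (1 + t * t)) = 1"
    proof -
      have "inverse d * inverse d * (d * d) = 1" if "d \<noteq> 0" for d :: real
        using that by (simp add: field_simps)
      from this[OF less_imp_neq[OF pos[of t], symmetric]] show ?thesis .
    qed
    finally show ?thesis by (simp add: norm_eq_sqrt_inner)
  qed
  interpret V: torus_variation R1 R2 M 1 u
  proof
    show "norm (u z) = 1" if "z \<in> {-1<..<1} \<times> M" for z
      using norm_u[of "snd z" "fst z"] that by (cases z) auto
  qed (use R12 su in \<open>auto simp: u_def\<close>)
  have d: "V.dt u (0, x) = 2 *\<^sub>R \<nu> x" if x: "x \<in> M" for x
  proof (rule vector_derivative_unique_at)
    show "((\<lambda>t. u (t, x)) has_vector_derivative V.dt u (0, x)) (at 0)"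
      by (rule V.dt_derivative[OF V.su _ x]) simp
    show "((\<lambda>t. u (t, x)) has_vector_derivative 2 *\<^sub>R \<nu> x) (at 0)"
      unfolding u_def has_vector_derivative_def
      by (auto intro!: derivative_eq_intros simp: fun_eq_iff)
  qed
  have "2 *\<^sub>R \<nu> x \<bullet> V.L x = 2 * (R2 / R1 + R1 / R2)" if x: "x \<in> M" for x
    using R1 R2 by (simp add: \<nu>_def V.L_def inner_prod_def inner_M[OF x] power2_eq_square)
  then have "V.J = (\<integral>x. 2 * (R2 / R1 + R1 / R2) \<partial>vol)"
    unfolding V.J_def V.Int0_def
    by (intro Bochner_Integration.integral_cong[OF refl]) (simp add: space_vol d)
  also have "\<dots> = measure vol M * (2 * (R2 / R1 + R1 / R2))"
    by (simp add: space_vol)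
  also have "\<dots> > 0" using measure_vol_pos R1 R2 by (intro mult_pos_pos add_pos_pos) auto
  finally have "V.J \<noteq> 0" by simp
  then show ?thesis using V.torus_variation_axioms by blast
qed

lemma torus_variationI:
  assumes R12: "R1\<^sup>2 + R2\<^sup>2 = 1" and \<epsilon>: "\<epsilon> > 0"
    and \<Phi>: "smooth_variation M (sphere 0 1) clifford_inclusion \<epsilon> \<Phi>"
  shows "torus_variation R1 R2 M \<epsilon> (\<lambda>(t, x). \<Phi> t x)"
proof
  show "norm ((\<lambda>(t, x). \<Phi> t x) z) = 1" if "z \<in> {-\<epsilon><..<\<epsilon>} \<times> M" for z
    using \<Phi> that unfolding smooth_variation_def smooth_map_def by (force simp: image_subset_iff)
qed (use assms in \<open>auto simp: smooth_variation_def smooth_map_def clifford_inclusion_def\<close>)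

lemma clifford_inclusion_ident: "clifford_inclusion = (\<lambda>x. x)"
  by (auto simp: clifford_inclusion_def)

text \<open>Makes the results at time 0 available for the inclusion itself, in particular its
  tension field.\<close>

lemma constant_variation:
  assumes R12: "R1\<^sup>2 + R2\<^sup>2 = 1"
  shows "torus_variation R1 R2 M 1 snd"
proof
  show "norm (snd z) = 1" if "z \<in> {-1<..<1} \<times> M" for z :: "real \<times> ('a \<times> 'b)"
    using that R12 by (auto simp: M_iff norm_prod_def)
qed (use R12 in \<open>auto intro: smooth_on_snd smooth_on_ident\<close>)

lemma smooth_map_inclusion:
  assumes R12: "R1\<^sup>2 + R2\<^sup>2 = 1"
  shows "smooth_map M (sphere 0 1) (\<lambda>x. x)"
  using R12 by (auto simp: smooth_map_def smooth_on_ident M_iff norm_prod_def)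

lemma isometric_immersion_inclusion:
  assumes R12: "R1\<^sup>2 + R2\<^sup>2 = 1"
  shows "isometric_immersion M (sphere 0 1) clifford_inclusion"
  unfolding isometric_immersion_def clifford_inclusion_ident
  by (simp add: smooth_map_inclusion[OF R12] differential_linear[OF _ bounded_linear_ident])

lemma harmonic_inclusion_iff:
  assumes R12: "R1\<^sup>2 + R2\<^sup>2 = 1" and pq: "p + q > 0"
  shows "harmonic M (sphere 0 1) clifford_inclusion \<longleftrightarrow> R1\<^sup>2 = p / (p + q) \<and> R2\<^sup>2 = q / (p + q)"
proof -
  interpret V: torus_variation R1 R2 M 1 snd by (rule constant_variation[OF R12])
  obtain x where x: "x \<in> M" using M_nonempty by blast
  have "harmonic M (sphere 0 1) clifford_inclusion \<longleftrightarrow> (\<forall>x\<in>M. V.c_tau *\<^sub>R V.L x = 0)"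
    unfolding harmonic_def clifford_inclusion_ident
    using smooth_map_inclusion[OF R12] V.tension_at_0 by simp
  also have "\<dots> \<longleftrightarrow> V.c_tau = 0" using V.L_nonzero x by (metis scaleR_eq_0_iff)
  finally show ?thesis using V.c_tau_eq_0_iff[OF pq] by simp
qed

text \<open>If \<open>Q r\<close> vanishes, the energy is stationary along every variation.
  Conversely, for the variation along great circles \<open>J\<close> is nonzero, and so are
  \<open>c_tau\<close> and \<open>lam\<close>, so stationarity along it forces
  \<open>Q r = 0\<close>.\<close>

lemma proper_r_harmonic_inclusion_iff:
  assumes R12: "R1\<^sup>2 + R2\<^sup>2 = 1" and pq: "p > 0" "q > 0" and r: "r \<ge> 2"
    and nh: "\<not> harmonic M (sphere 0 1) clifford_inclusion"
  shows "r_harmonic r M (sphere 0 1) clifford_inclusion \<longleftrightarrow>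
     r = 2 \<and> p \<noteq> q \<and> R1\<^sup>2 = 1/2 \<and> R2\<^sup>2 = 1/2 \<or>
     r \<ge> 3 \<and> real r * (p + q) * (R1\<^sup>2) ^ 3
     + (q - p - real r * (q + 2 * p)) * (R1\<^sup>2)\<^sup>2 + (2 * p + real r * p) * R1\<^sup>2 - p = 0"
proof -
  obtain u where u: "torus_variation R1 R2 M 1 u" "torus_variation.J R1 R2 M 1 u \<noteq> 0"
    using normal_variation_exists[OF R12] by blast
  interpret V: torus_variation R1 R2 M 1 u by (rule u(1))
  have c: "V.c_tau \<noteq> 0"
    using nh harmonic_inclusion_iff[OF R12] V.c_tau_eq_0_iff pq by auto
  have lam: "V.lam \<noteq> 0" using V.lam_pos[OF pq] by simp
  have "r_harmonic r M (sphere 0 1) clifford_inclusion \<longleftrightarrow> V.Q r = 0"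
  proof
    assume h: "r_harmonic r M (sphere 0 1) clifford_inclusion"
    have "smooth_variation M (sphere 0 1) clifford_inclusion 1 (\<lambda>t x. u (t, x))"
      unfolding smooth_variation_def smooth_map_def clifford_inclusion_ident
      using V.smooth_u V.norm_u V.u0 by (auto simp: image_subset_iff)
    then have "((\<lambda>t. r_energy r M (sphere 0 1) (\<lambda>x. u (t, x))) has_real_derivative 0) (at 0)"
      using h unfolding r_harmonic_def by (meson zero_less_one)
    moreover obtain D where D: "((\<lambda>t. r_energy r M (sphere 0 1) (\<lambda>x. u (t, x))) has_real_derivative D) (at 0)"
      "D = 0 \<longleftrightarrow> V.c_tau * V.Q r * V.J = 0" using V.r_energy_derivative[OF r lam] by blast
    ultimately have "D = 0" using DERIV_unique by blast
    then show "V.Q r = 0" using D(2) c u(2) by simp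
  next
    assume Q: "V.Q r = 0"
    show "r_harmonic r M (sphere 0 1) clifford_inclusion"
      unfolding r_harmonic_def
    proof (intro conjI allI impI)
      show "smooth_map M (sphere 0 1) clifford_inclusion"
        using smooth_map_inclusion[OF R12] by (simp add: clifford_inclusion_ident)
    next
      fix \<epsilon> \<Phi> assume "(0::real) < \<epsilon>" "smooth_variation M (sphere 0 1) clifford_inclusion \<epsilon> \<Phi>"
      then interpret V': torus_variation R1 R2 M \<epsilon> "\<lambda>(t, x). \<Phi> t x"
        by (intro torus_variationI R12)
      \<comment> \<open>The constants \<open>c_tau\<close> and \<open>Q\<close> depend only on the
        radii and dimensions, so both interpretations share them; only \<open>J\<close> changes with
        the variation.\<close>
      obtain D where "((\<lambda>t. r_energy r M (sphere 0 1) (\<lambda>x. \<Phi> t x)) has_real_derivative D) (at 0)"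
        "D = 0 \<longleftrightarrow> V.c_tau * V.Q r * V'.J = 0" using V'.r_energy_derivative[OF r lam] by auto
      then show "((\<lambda>t. r_energy r M (sphere 0 1) (\<Phi> t)) has_real_derivative 0) (at 0)"
        using Q by simp
    qed
  qed
  then show ?thesis using V.Q_eq_0_iff[OF pq r c] by simp
qed

end

theorem theorem1p2:
  fixes r p q :: nat and R1 R2 :: real
    and M :: "((real ^ 'm) \<times> (real ^ 'n)) set"
    and N :: "((real ^ 'm) \<times> (real ^ 'n)) set"
  assumes "r \<ge> 2" and "p \<ge> 1" and "q \<ge> 1"
    and "CARD('m) = p + 1" and "CARD('n) = q + 1"
    and "R1 > 0" and "R2 > 0" and "R1\<^sup>2 + R2\<^sup>2 = 1"
    and "M = clifford_torus R1 R2" and "N = sphere 0 1"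
  shows "(minimal_immersion M N clifford_inclusion \<longleftrightarrow>
           R1\<^sup>2 = real p / (real p + real q) \<and> R2\<^sup>2 = real q / (real p + real q)) \<and>
         (proper_r_harmonic_submanifold r M N clifford_inclusion \<longleftrightarrow>
           \<not> (R1\<^sup>2 = real p / (real p + real q) \<and> R2\<^sup>2 = real q / (real p + real q)) \<and>
           (r = 2 \<and> p \<noteq> q \<and> R1\<^sup>2 = 1/2 \<and> R2\<^sup>2 = 1/2 \<or>
            r \<ge> 3 \<and> clifford_poly r p q (R1\<^sup>2) = 0))"
proof -
  interpret C: clifford R1 R2 M by unfold_locales (fact assms)+
  have dims: "C.p = real p" "C.q = real q"
    using assms(4,5) by (simp_all add: C.p_def C.q_def)
  have pq: "C.p > 0" "C.q > 0" using assms(2,3) by (simp_all add: dims)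
  have h: "harmonic M N clifford_inclusion \<longleftrightarrow>
      R1\<^sup>2 = real p / (real p + real q) \<and> R2\<^sup>2 = real q / (real p + real q)"
    using C.harmonic_inclusion_iff[OF assms(8)] pq unfolding dims assms(10) by simp
  have i: "isometric_immersion M N clifford_inclusion"
    using C.isometric_immersion_inclusion[OF assms(8)] by (simp add: assms(10))
  show ?thesis
    unfolding minimal_immersion_def proper_r_harmonic_submanifold_def clifford_poly_def
    using h i C.proper_r_harmonic_inclusion_iff[OF assms(8) pq assms(1)] unfolding dims assms(10)
    by auto
qed

end
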